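(* $\mathcal G[-1]$ is a graded Lie algebra with bracket $[\cdot,\cdot]^\phi$. That is, for oriented graphs $X,Y$, where $X$ has $x$ vertices, set $[X,Y]^\phi=(-1)^{x}[X,Y]$ (extended bilinearly to $\mathcal G$), and give an oriented graph with $x$ vertices the shifted degree $|X|=x-1$; then $[\cdot,\cdot]^\phi$ is a graded Lie bracket with respect to the shifted degree.
   Context: Graded Lie bracket on a graded vector space $V$: a bilinear map $[\cdot,\cdot]:V\times V\to V$ with $[v,w]=-(-1)^{|v||w|}[w,v]$ and $[u,[v,w]]+(-1)^{|w|(|u|+|v|)}[w,[u,v]]+(-1)^{|u|(|v|+|w|)}[v,[w,u]]=0$ for homogeneous $u,v,w$. $V[-1]$ denotes $V$ with the grading shifted downward by 1. Graphs. A graph is a finite 1-dimensional CW complex (not necessarily connected, multiple edges allowed, the empty graph allowed) all of whose vertices have valence at least 3. A labelling of a graph is a numbering $1,2,\dots$ of its vertices together with an arrow on each edge. An orientation is an equivalence class of labellings: reversing the arrow on one edge, or switching the numbers of two vertices, changes the orientation to the opposite one. $\mathcal G$ is the vector space, over a fixed field of characteristic zero, of linear combinations of (isomorphism classes of) oriented graphs modulo $(X,or)=-(X,-or)$; it is graded by the number of vertices. A graph with a loop is zero in $\mathcal G$, so graphs may be assumed loopless. The orientation is suppressed from the notation. Collapse. For a (non-loop) edge $e$ of $X$, $X_e$ is obtained by collapsing $e$ to a point. Induced orientation: represent the orientation of $X$ by a labelling in which the initial vertex of $e$ is 1 and the terminal vertex is 2; in $X_e$ the vertex resulting from the collapse is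 numbered 1, the numbers of all other vertices are reduced by one, and arrows on uncontracted edges are unchanged. Half-edges. Each half-edge $h$ begins at a vertex $v(h)$, lies in an edge $e(h)$, and has a complementary half-edge $\bar h$ with $e(h)=h\cup\bar h$. For distinct half-edges $h,k$ with $k\ne\bar h$, $X\langle hk\rangle$ is obtained by cutting $e(h)$ and $e(k)$ at their midpoints and gluing $h$ to $k$ and $\bar h$ to $\bar k$; orientation: represent the orientation of $X$ so that $h$ is the initial half-edge of $e(h)$ and $k$ is the terminal half-edge of $e(k)$; in $X\langle hk\rangle$ the edge $h\cup k$ is directed from $h$ to $k$ and the edge $\bar h\cup\bar k$ from $\bar k$ to $\bar h$, all else unchanged. If $v(h)\ne v(k)$, $X_{hk}:=(X\langle hk\rangle)_{h\cup k}$; if $v(h)=v(k)$, $X_{hk}:=0$. $\partial_H X=\sum X_{hk}$, sum over all unordered pairs $\{h,k\}$ of distinct half-edges of $X$ with $k\neq\bar h$. Product. If $X$ has vertices numbered $1,\dots,x$ and $Y$ has vertices numbered $1,\dots,y$, then $X\cdot Y$ is the disjoint union with the vertex numbers of $Y$ shifted to $x+1,\dots,x+y$ (arrows unchanged), extended bilinearly. Bracket. $[X,Y]=\partial_H(X\cdot Y)-\partial_H(X)\cdot Y-(-1)^{x}X\cdot\partial_H(Y)$, where $X$ has $x$ vertices; equivalently $[X,Y]=\sum_{h\in X,\,k\in Y}(X\cdot Y)_{hk}$, the sum over half-edges $h$ of $X$ and $k$ of $Y$. *)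

theory Defs
  imports Complex_Main "HOL-Library.Poly_Mapping" "HOL-Combinatorics.Transposition"
begin

section \<open>Graded vector spaces and graded Lie algebras\<close>

text \<open>
  A grading of the vector space with scalar multiplication \<open>scale\<close> is a family \<open>V\<close> of subspaces
  of which the space is the (internal) direct sum.
\<close>

definition graded_vector_space ::
    "('k::field \<Rightarrow> 'v::ab_group_add \<Rightarrow> 'v) \<Rightarrow> (int \<Rightarrow> 'v set) \<Rightarrow> bool" where
  "graded_vector_space scale V \<longleftrightarrow>
     vector_space scale \<and>
     (\<forall>d. module.subspace scale (V d)) \<and>
     (\<forall>u. \<exists>!c. (\<forall>d. c d \<in> V d) \<and> finite {d. c d \<noteq> 0} \<and> u = (\<Sum>d | c d \<noteq> 0. c d))"

definition shift_down :: "(int \<Rightarrow> 'v set) \<Rightarrow> int \<Rightarrow> 'v set" where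
  "shift_down V d = V (d + 1)"

definition graded_lie_algebra ::
    "('k::field \<Rightarrow> 'v::ab_group_add \<Rightarrow> 'v) \<Rightarrow> (int \<Rightarrow> 'v set) \<Rightarrow> ('v \<Rightarrow> 'v \<Rightarrow> 'v) \<Rightarrow> bool" where
  "graded_lie_algebra scale V B \<longleftrightarrow>
     graded_vector_space scale V \<and>
     (\<forall>u. Vector_Spaces.linear scale scale (B u)) \<and>
     (\<forall>v. Vector_Spaces.linear scale scale (\<lambda>u. B u v)) \<and>
     (\<forall>i j. \<forall>u\<in>V i. \<forall>v\<in>V j. B u v \<in> V (i + j)) \<and>
     (\<forall>i j. \<forall>v\<in>V i. \<forall>w\<in>V j. B v w = - scale ((-1) powi (i * j)) (B w v)) \<and>
     (\<forall>i j l. \<forall>u\<in>V i. \<forall>v\<in>V j. \<forall>w\<in>V l.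
        B u (B v w) + scale ((-1) powi (l * (i + j))) (B w (B u v))
          + scale ((-1) powi (i * (j + l))) (B v (B w u)) = 0)"


section \<open>Graphs and orientations\<close>

text \<open>
  A graph is given by its vertices, its half-edges, the vertex \<open>vtx h\<close> at which a half-edge \<open>h\<close>
  begins, and the half-edge \<open>bar h\<close> complementary to \<open>h\<close>; the edges are the sets \<open>{h, bar h}\<close>.
  Loops, multiple edges, disconnected graphs and the empty graph are allowed.  The values of
  \<open>vtx\<close> and \<open>bar\<close> outside the set of half-edges carry no information.
\<close>

record graph =
  verts :: "nat set"
  halves :: "nat set"
  vtx :: "nat \<Rightarrow> nat"
  bar :: "nat \<Rightarrow> nat"

definition is_graph :: "graph \<Rightarrow> bool" where
  "is_graph X \<longleftrightarrow>
     finite (verts X) \<and> finite (halves X) \<and>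
     (\<forall>h\<in>halves X. vtx X h \<in> verts X \<and>
        bar X h \<in> halves X \<and> bar X h \<noteq> h \<and> bar X (bar X h) = h) \<and>
     (\<forall>v\<in>verts X. 3 \<le> card {h \<in> halves X. vtx X h = v})"

text \<open>
  A labelling \<open>(vs, ini)\<close> consists of the list \<open>vs\<close> of all vertices in the order of their numbers
  \<open>1, 2, \<dots>\<close>, and the set \<open>ini\<close> of those half-edges which are the initial half of their edge.
\<close>

type_synonym labelling = "nat list \<times> nat set"

definition labellings :: "graph \<Rightarrow> labelling set" where
  "labellings X = {(vs, ini). distinct vs \<and> set vs = verts X \<and>
     ini \<subseteq> halves X \<and> (\<forall>h\<in>halves X. h \<in> ini \<longleftrightarrow> bar X h \<notin> ini)}"

inductive_set moves :: "graph \<Rightarrow> (labelling \<times> labelling) set" for X where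
  reverse_arrow: "(vs, ini) \<in> labellings X \<Longrightarrow> h \<in> ini \<Longrightarrow>
     ((vs, ini), (vs, insert (bar X h) (ini - {h}))) \<in> moves X"
| switch_numbers: "(vs, ini) \<in> labellings X \<Longrightarrow> v \<in> verts X \<Longrightarrow> w \<in> verts X \<Longrightarrow> v \<noteq> w \<Longrightarrow>
     ((vs, ini), (map (transpose v w) vs, ini)) \<in> moves X"

definition same_orientation :: "graph \<Rightarrow> (labelling \<times> labelling) set" where
  "same_orientation X = {(l, l'). l \<in> labellings X \<and> (l, l') \<in> (moves X O moves X)\<^sup>*}"

definition orientations :: "graph \<Rightarrow> labelling set set" where
  "orientations X = labellings X // same_orientation X"

text \<open>The empty graph has a single orientation, which is not opposite to itself.\<close>

definition opposite :: "graph \<Rightarrow> labelling set \<Rightarrow> labelling set \<Rightarrow> bool" where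
  "opposite X o1 o2 \<longleftrightarrow> (\<exists>l\<in>o1. \<exists>l'\<in>o2. (l, l') \<in> moves X)"

typedef ograph = "{(X, or). is_graph X \<and> or \<in> orientations X}"
proof -
  define E where "E = \<lparr>verts = {}, halves = {}, vtx = id, bar = id\<rparr>"
  have "is_graph E" by (simp add: is_graph_def E_def)
  moreover have "same_orientation E `` {([], {})} \<in> orientations E"
    unfolding orientations_def by (rule quotientI) (simp add: labellings_def E_def)
  ultimately show ?thesis by blast
qed

definition graph_of :: "ograph \<Rightarrow> graph" where
  "graph_of X = fst (Rep_ograph X)"

definition orientation_of :: "ograph \<Rightarrow> labelling set" where
  "orientation_of X = snd (Rep_ograph X)"

text \<open>The graph \<open>X\<close> with the orientation represented by the labelling \<open>l\<close>.\<close>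

definition orient :: "graph \<Rightarrow> labelling \<Rightarrow> ograph" where
  "orient X l = Abs_ograph (X, same_orientation X `` {l})"

definition nverts :: "ograph \<Rightarrow> nat" where
  "nverts X = card (verts (graph_of X))"

definition isomorphic :: "ograph \<Rightarrow> ograph \<Rightarrow> bool" where
  "isomorphic X Y \<longleftrightarrow> (\<exists>f g.
     bij_betw f (verts (graph_of X)) (verts (graph_of Y)) \<and>
     bij_betw g (halves (graph_of X)) (halves (graph_of Y)) \<and>
     (\<forall>h\<in>halves (graph_of X). vtx (graph_of Y) (g h) = f (vtx (graph_of X) h) \<and>
        bar (graph_of Y) (g h) = g (bar (graph_of X) h)) \<and>
     orientation_of Y = (\<lambda>(vs, ini). (map f vs, g ` ini)) ` orientation_of X)"


section \<open>The graph space\<close>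

definition fscale :: "'k::field_char_0 \<Rightarrow> (ograph \<Rightarrow>\<^sub>0 'k) \<Rightarrow> (ograph \<Rightarrow>\<^sub>0 'k)" where
  "fscale c u = Poly_Mapping.map ((*) c) u"

lemma lookup_fscale [simp]: "Poly_Mapping.lookup (fscale c u) X = c * Poly_Mapping.lookup u X"
  unfolding fscale_def by transfer (simp add: when_def)

interpretation fscale: vector_space fscale
  by unfold_locales (auto intro!: poly_mapping_eqI simp: lookup_add algebra_simps)

abbreviation basis :: "ograph \<Rightarrow> (ograph \<Rightarrow>\<^sub>0 'k::field_char_0)" where
  "basis X \<equiv> Poly_Mapping.single X 1"

definition relations :: "(ograph \<Rightarrow>\<^sub>0 'k::field_char_0) set" where
  "relations =
     {basis X - basis Y | X Y. isomorphic X Y} \<union>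
     {basis X + basis Y | X Y. graph_of X = graph_of Y \<and>
        opposite (graph_of X) (orientation_of X) (orientation_of Y)}"

definition graph_rel :: "(ograph \<Rightarrow>\<^sub>0 'k::field_char_0) \<Rightarrow> (ograph \<Rightarrow>\<^sub>0 'k) \<Rightarrow> bool" where
  "graph_rel u v \<longleftrightarrow> u - v \<in> fscale.span relations"

lemma equivp_graph_rel: "equivp graph_rel"
proof (rule equivpI)
  show "reflp graph_rel"
    by (simp add: reflp_def graph_rel_def fscale.span_zero)
  show "symp graph_rel"
    unfolding symp_def graph_rel_def by (intro allI impI, drule fscale.span_neg) simp
  show "transp graph_rel"
    unfolding transp_def graph_rel_def
    by (intro allI impI, drule (1) fscale.span_add) simp
qed

quotient_type (overloaded) 'k graph_space = "ograph \<Rightarrow>\<^sub>0 'k::field_char_0" / graph_rel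
  by (rule equivp_graph_rel)

instantiation graph_space :: (field_char_0) ab_group_add
begin

lift_definition zero_graph_space :: "'a graph_space" is 0 .

lift_definition plus_graph_space :: "'a graph_space \<Rightarrow> 'a graph_space \<Rightarrow> 'a graph_space" is "(+)"
  unfolding graph_rel_def by (drule (1) fscale.span_add) (simp add: algebra_simps)

lift_definition uminus_graph_space :: "'a graph_space \<Rightarrow> 'a graph_space" is uminus
  unfolding graph_rel_def by (drule fscale.span_neg) (simp add: algebra_simps)

lift_definition minus_graph_space :: "'a graph_space \<Rightarrow> 'a graph_space \<Rightarrow> 'a graph_space" is "(-)"
  unfolding graph_rel_def by (drule (1) fscale.span_diff) (simp add: algebra_simps)

instance
  by standard (transfer, simp add: graph_rel_def algebra_simps fscale.span_zero)+

end

lift_definition gscale :: "'k::field_char_0 \<Rightarrow> 'k graph_space \<Rightarrow> 'k graph_space" is fscale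
  unfolding graph_rel_def by (simp add: fscale.span_scale flip: fscale.scale_right_diff_distrib)

interpretation gscale: vector_space gscale
  by unfold_locales
    (transfer, simp add: graph_rel_def fscale.span_zero
       fscale.scale_right_distrib fscale.scale_left_distrib)+

definition graph_grading :: "int \<Rightarrow> 'k::field_char_0 graph_space set" where
  "graph_grading n = gscale.span {abs_graph_space (basis X) | X. int (nverts X) = n}"

definition bilinear_extension ::
    "(ograph \<Rightarrow> ograph \<Rightarrow> (ograph \<Rightarrow>\<^sub>0 'k::field_char_0)) \<Rightarrow>
       (ograph \<Rightarrow>\<^sub>0 'k) \<Rightarrow> (ograph \<Rightarrow>\<^sub>0 'k) \<Rightarrow> (ograph \<Rightarrow>\<^sub>0 'k)" where
  "bilinear_extension f u v =
     (\<Sum>X\<in>Poly_Mapping.keys u. \<Sum>Y\<in>Poly_Mapping.keys v.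
        fscale (Poly_Mapping.lookup u X * Poly_Mapping.lookup v Y) (f X Y))"


section \<open>Collapse, cutting and gluing\<close>

text \<open>
  Collapse of the non-loop edge containing \<open>h\<close>.  The merged vertex keeps the name \<open>vtx h\<close>; an
  orientation is represented by a labelling in which \<open>h\<close> is the initial half-edge,
  \<open>vtx h\<close> has number 1 and \<open>vtx (bar h)\<close> has number 2.
\<close>

definition collapse_graph :: "graph \<Rightarrow> nat \<Rightarrow> graph" where
  "collapse_graph X h =
     \<lparr>verts = verts X - {vtx X (bar X h)},
      halves = halves X - {h, bar X h},
      vtx = (\<lambda>k. if vtx X k = vtx X (bar X h) then vtx X h else vtx X k),
      bar = bar X\<rparr>"

definition collapse :: "ograph \<Rightarrow> nat \<Rightarrow> ograph" where
  "collapse X h =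
     (let G = graph_of X;
          (rest, ini) = (SOME (rest, ini).
             (vtx G h # vtx G (bar G h) # rest, ini) \<in> orientation_of X \<and> h \<in> ini)
      in orient (collapse_graph G h) (vtx G h # rest, ini - {h}))"

text \<open>
  \<open>X\<langle>hk\<rangle>\<close>.  When \<open>h\<close> and \<open>bar k\<close> are initial in \<open>X\<close>, the new edges have to be directed from
  \<open>h\<close> to \<open>k\<close> and from \<open>bar k\<close> to \<open>bar h\<close>, so the set of initial half-edges stays the same.
\<close>

definition reglue_graph :: "graph \<Rightarrow> nat \<Rightarrow> nat \<Rightarrow> graph" where
  "reglue_graph X h k =
     X\<lparr>bar := (bar X)(h := k, k := h, bar X h := bar X k, bar X k := bar X h)\<rparr>"

definition reglue :: "ograph \<Rightarrow> nat \<Rightarrow> nat \<Rightarrow> ograph" where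
  "reglue X h k =
     orient (reglue_graph (graph_of X) h k)
       (SOME (vs, ini). (vs, ini) \<in> orientation_of X \<and> h \<in> ini \<and> k \<notin> ini)"

definition contract :: "ograph \<Rightarrow> nat \<Rightarrow> nat \<Rightarrow> (ograph \<Rightarrow>\<^sub>0 'k::field_char_0)" where
  "contract X h k =
     (if vtx (graph_of X) h = vtx (graph_of X) k then 0 else basis (collapse (reglue X h k) h))"

text \<open>An unordered pair of distinct half-edges is listed once, as \<open>(h, k)\<close> with \<open>h < k\<close>.\<close>

definition boundary_H :: "ograph \<Rightarrow> (ograph \<Rightarrow>\<^sub>0 'k::field_char_0)" where
  "boundary_H X =
     (\<Sum>(h, k) | h \<in> halves (graph_of X) \<and> k \<in> halves (graph_of X) \<and>
                 h < k \<and> k \<noteq> bar (graph_of X) h. contract X h k)"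


section \<open>Product and bracket\<close>

text \<open>
  The disjoint union renames the vertices and half-edges of \<open>X\<close> to even and those of \<open>Y\<close> to odd
  numbers.
\<close>

definition union_graph :: "graph \<Rightarrow> graph \<Rightarrow> graph" where
  "union_graph X Y =
     \<lparr>verts = (\<lambda>v. 2 * v) ` verts X \<union> (\<lambda>v. 2 * v + 1) ` verts Y,
      halves = (\<lambda>h. 2 * h) ` halves X \<union> (\<lambda>h. 2 * h + 1) ` halves Y,
      vtx = (\<lambda>h. if even h then 2 * vtx X (h div 2) else 2 * vtx Y (h div 2) + 1),
      bar = (\<lambda>h. if even h then 2 * bar X (h div 2) else 2 * bar Y (h div 2) + 1)\<rparr>"

definition union_labelling :: "labelling \<Rightarrow> labelling \<Rightarrow> labelling" where
  "union_labelling l m =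
     (map (\<lambda>v. 2 * v) (fst l) @ map (\<lambda>v. 2 * v + 1) (fst m),
      (\<lambda>h. 2 * h) ` snd l \<union> (\<lambda>h. 2 * h + 1) ` snd m)"

definition oprod :: "ograph \<Rightarrow> ograph \<Rightarrow> ograph" where
  "oprod X Y =
     orient (union_graph (graph_of X) (graph_of Y))
       (union_labelling (SOME l. l \<in> orientation_of X) (SOME m. m \<in> orientation_of Y))"

definition fprod :: "(ograph \<Rightarrow>\<^sub>0 'k::field_char_0) \<Rightarrow> (ograph \<Rightarrow>\<^sub>0 'k) \<Rightarrow> (ograph \<Rightarrow>\<^sub>0 'k)" where
  "fprod = bilinear_extension (\<lambda>X Y. basis (oprod X Y))"

definition bracket :: "ograph \<Rightarrow> ograph \<Rightarrow> (ograph \<Rightarrow>\<^sub>0 'k::field_char_0)" where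
  "bracket X Y =
     boundary_H (oprod X Y) - fprod (boundary_H X) (basis Y)
       - fscale ((-1) ^ nverts X) (fprod (basis X) (boundary_H Y))"

definition bracket_phi :: "ograph \<Rightarrow> ograph \<Rightarrow> (ograph \<Rightarrow>\<^sub>0 'k::field_char_0)" where
  "bracket_phi X Y = fscale ((-1) ^ nverts X) (bracket X Y)"

text \<open>
  The induced operation on the quotient is computed on chosen representatives of its two
  arguments; that the result does not depend on them is not part of the definition.
\<close>

definition lie_bracket ::
    "'k::field_char_0 graph_space \<Rightarrow> 'k graph_space \<Rightarrow> 'k graph_space" where
  "lie_bracket a b =
     abs_graph_space (bilinear_extension bracket_phi (rep_graph_space a) (rep_graph_space b))"

end

theory Submission
  imports Defs "HOL-Combinatorics.Permutations"
begin

text \<open>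
  The bracket of \<open>X\<close> and \<open>Y\<close> is the sum of \<open>(X \<cdot> Y)\<^sub>h\<^sub>k\<close> over all half-edges \<open>h\<close> of \<open>X\<close> and \<open>k\<close> of \<open>Y\<close>: the
  other terms of the boundary of \<open>X \<cdot> Y\<close> cancel. Hence each of the three terms of the Jacobi identity is
  a sum over two successive gluings in \<open>X \<cdot> Y \<cdot> Z\<close>, in which two half-edges of one factor, the hub,
  are glued to half-edges of the two other factors. Every such pair of gluings occurs twice, once in
  either order. The two orders give the same graph, and its orientation changes sign because
  contracting two edges in the opposite order exchanges two vertex numbers.
\<close>


section \<open>Parity of labellings\<close>

text \<open>An orientation is given only as a class of labellings joined by an even number of moves,
  and \<open>reglue\<close>, \<open>collapse\<close> and \<open>oprod\<close> pick representatives
  with \<open>SOME\<close>. Hence every sign comes from comparing two labellings of one graph.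
  \<open>parity\<close> makes this a matter of counting; its absolute value depends on the names and
  means nothing by itself. Exchanging or rotating factors and reversing an orientation are all
  expressed by \<open>signed_iso\<close>, along which classes, gluings, products and brackets are
  transported. The twist by (-1)^x is what makes the Jacobi terms comparable: gluing inside the
  second factor of a product costs (-1)^x, because the merged vertex is numbered 1 and not x + 1.
  This sign and the twist of the outer bracket cancel, so that only the twist of the inner bracket
  remains. Two configurations are delicate: the two half-edges of the hub may begin at the same
  vertex, and they may be the two halves of one edge, which the first gluing then has already
  cut.\<close>

fun inversions :: "nat list \<Rightarrow> nat" where
  "inversions [] = 0"
| "inversions (x # xs) = card {y \<in> set xs. y < x} + inversions xs"

text \<open>
  The names of vertices and half-edges are natural numbers, and comparison with their order gives
  every labelling an absolute parity.
\<close>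

definition parity :: "graph \<Rightarrow> labelling \<Rightarrow> bool" where
  "parity G l \<longleftrightarrow> odd (inversions (fst l) + card {h \<in> snd l. bar G h < h})"

lemma card_filter_insert:
  assumes "finite S" "x \<notin> S"
  shows "card {y \<in> insert x S. P y} = (if P x then 1 else 0) + card {y \<in> S. P y}"
proof -
  have "{y \<in> insert x S. P y} = (if P x then insert x {y \<in> S. P y} else {y \<in> S. P y})" by auto
  then show ?thesis using assms by simp
qed

text \<open>Moving \<open>x\<close> to the front takes \<open>length as\<close> exchanges of
  neighbours, and each changes the number of inversions by one. All later reorderings of vertex
  lists are reduced to this.\<close>

lemma odd_inversions_move_front:
  "distinct (as @ x # bs) \<Longrightarrow>
     odd (inversions (as @ x # bs)) \<longleftrightarrow> odd (inversions (x # as @ bs)) \<noteq> odd (length as)"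
proof (induction as)
  case (Cons a as)
  define S where "S = set as \<union> set bs"
  have fin: "finite S" "x \<notin> S" "a \<notin> S" "x \<noteq> a" using Cons.prems by (auto simp: S_def)
  have 1: "set (as @ x # bs) = insert x S" "set (as @ bs) = S" "set (a # as @ bs) = insert a S"
    by (auto simp: S_def)
  have IH: "odd (inversions (as @ x # bs))
    \<longleftrightarrow> odd (card {y \<in> S. y < x} + inversions (as @ bs)) \<noteq> odd (length as)"
    using Cons unfolding inversions.simps(2) 1(2) by simp
  have "inversions ((a # as) @ x # bs) = card {y \<in> insert x S. y < a} + inversions (as @ x # bs)"
    using 1(1) by simp
  moreover have "inversions (x # (a # as) @ bs)
    = card {y \<in> insert a S. y < x} + (card {y \<in> S. y < a} + inversions (as @ bs))"
    by (metis 1(2,3) inversions.simps(2) append_Cons)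
  ultimately show ?case
    using IH fin
    by (simp only: card_filter_insert[OF fin(1,2)] card_filter_insert[OF fin(1,3)] length_Cons
      even_add)
      (auto simp del: inversions.simps)
qed simp

text \<open>In both lists the two entries are moved to the front. The cost depends only on the
  lengths of the segments, so it is the same for both lists, and there remain two lists that differ
  in the order of the first two entries.\<close>

lemma odd_inversions_transpose:
  assumes "distinct vs" "v \<in> set vs" "w \<in> set vs" "v \<noteq> w"
  shows "odd (inversions (map (transpose v w) vs)) \<longleftrightarrow> even (inversions vs)"
proof -
  have *: "odd (inversions (map (transpose v w) vs)) \<longleftrightarrow> even (inversions vs)"
    if vs: "vs = as @ v # bs @ w # cs" and d: "distinct vs" for v w as bs cs
  proof -
    have m: "map (transpose v w) vs = as @ w # bs @ v # cs"
      using d unfolding vs by (auto intro!: map_idI simp: transpose_def)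
    have 1: "odd (inversions (as @ x # bs @ y # cs)) \<longleftrightarrow>
        odd (inversions (y # x # as @ bs @ cs)) \<noteq> even (length bs)"
      if "distinct (as @ x # bs @ y # cs)" for x y
      using odd_inversions_move_front[of as x "bs @ y # cs"]
        odd_inversions_move_front[of "x # as @ bs" y cs] that
      by (auto simp del: inversions.simps)
    have 2: "odd (inversions (v # w # as @ bs @ cs)) \<longleftrightarrow> even (inversions (w # v # as @ bs @ cs))"
      using odd_inversions_move_front[of "[v]" w "as @ bs @ cs"] d vs
        by (auto simp del: inversions.simps)
    show ?thesis
      unfolding m using 1[of v w] 1[of w v] 2 d vs by (auto simp del: inversions.simps)
  qed
  obtain as bs where s: "vs = as @ v # bs" using assms(2) by (meson split_list)
  then consider "w \<in> set bs" | "w \<in> set as" using assms by auto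
  then show ?thesis
  proof cases
    case 1
    then obtain b c where "bs = b @ w # c" by (meson split_list)
    then show ?thesis using * s assms(1) by blast
  next
    case 2
    then obtain b c where "as = b @ w # c" by (meson split_list)
    then have "vs = b @ w # c @ v # bs" using s by simp
    then show ?thesis using *[of b w c v bs] assms(1) by (simp add: transpose_commute)
  qed
qed

section \<open>Moves between labellings, and parity as their only invariant\<close>

lemma graphD:
  assumes "is_graph G" "h \<in> halves G"
  shows "vtx G h \<in> verts G" "bar G h \<in> halves G" "bar G h \<noteq> h" "bar G (bar G h) = h"
  using assms by (auto simp: is_graph_def)

lemma labellings_finite: "is_graph G \<Longrightarrow> (vs, ini) \<in> labellings G \<Longrightarrow> finite ini"
  by (auto simp: labellings_def is_graph_def intro: finite_subset)

lemma moves_cases [consumes 1, case_names reverse_arrow switch_numbers]: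
  assumes "(l, l') \<in> moves G"
  obtains vs ini h where "l = (vs, ini)" "l' = (vs, insert (bar G h) (ini - {h}))"
    "l \<in> labellings G" "h \<in> ini"
  | vs ini v w where "l = (vs, ini)" "l' = (map (transpose v w) vs, ini)" "l \<in> labellings G"
      "v \<in> verts G" "w \<in> verts G" "v \<noteq> w"
proof -
  obtain vs ini vs' ini' where l: "l = (vs, ini)" "l' = (vs', ini')" by fastforce
  from assms[unfolded l] show thesis by (cases rule: moves.cases) (use l that in metis)+
qed

lemma moves_labellings:
  assumes "is_graph G" "(l, l') \<in> moves G"
  shows "l \<in> labellings G" "l' \<in> labellings G"
proof -
  show "l \<in> labellings G" using assms(2) by (cases rule: moves_cases) auto
  show "l' \<in> labellings G"
    using assms(2)
  proof (cases rule: moves_cases)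
    case (reverse_arrow vs ini h)
    have *: "bar G h \<in> halves G \<and> bar G h \<noteq> h \<and> bar G (bar G h) = h" if "h \<in> halves G" for h
      using assms(1) that by (simp add: is_graph_def)
    have "distinct vs" "set vs = verts G" "ini \<subseteq> halves G"
      and "\<And>m. m \<in> halves G \<Longrightarrow> m \<in> ini \<longleftrightarrow> bar G m \<notin> ini"
      using reverse_arrow by (auto simp: labellings_def)
    then have "m \<in> insert (bar G h) (ini - {h}) \<longleftrightarrow> bar G m \<notin> insert (bar G h) (ini - {h})"
      if "m \<in> halves G" for m
    proof -
      have "bar G m = bar G h \<longleftrightarrow> m = h" "bar G m = h \<longleftrightarrow> m = bar G h"
        using *[of m] *[of h] that reverse_arrow(4) \<open>ini \<subseteq> halves G\<close> by (metis subsetD)+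
      moreover have "bar G h \<noteq> h" using *[of h] reverse_arrow(4) \<open>ini \<subseteq> halves G\<close> by blast
      moreover have "m \<in> ini \<longleftrightarrow> bar G m \<notin> ini"
        using that \<open>\<And>m. m \<in> halves G \<Longrightarrow> m \<in> ini \<longleftrightarrow> bar G m \<notin> ini\<close> by blast
      ultimately show ?thesis by auto
    qed
    then show ?thesis using reverse_arrow(2,4) \<open>distinct vs\<close> \<open>set vs = verts G\<close> \<open>ini \<subseteq> halves G\<close> *
      by (auto simp: labellings_def)
  next
    case (switch_numbers vs ini v w)
    moreover have "transpose v w ` verts G = verts G"
      using switch_numbers by (auto simp: transpose_def image_iff)
    ultimately show ?thesis
      by (auto simp: labellings_def distinct_map inj_on_def transpose_eq_iff)
  qed
qed

lemma moves_parity: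
  assumes "is_graph G" "(l, l') \<in> moves G"
  shows "parity G l' \<longleftrightarrow> \<not> parity G l"
  using assms(2)
proof (cases rule: moves_cases)
  case (reverse_arrow vs ini h)
  have h: "h \<in> halves G" "bar G h \<noteq> h" "bar G (bar G h) = h" "bar G h \<notin> ini" "finite ini"
  proof -
    have *: "h \<in> halves G" using reverse_arrow by (auto simp: labellings_def)
    show "h \<in> halves G" "bar G h \<noteq> h" "bar G (bar G h) = h"
      using assms(1) * by (simp_all add: is_graph_def)
    show "bar G h \<notin> ini" using reverse_arrow * by (simp add: labellings_def)
    show "finite ini" using reverse_arrow labellings_finite[OF assms(1)] by simp
  qed
  have 1: "card {m \<in> insert (bar G h) (ini - {h}). bar G m < m}
      = (if h < bar G h then 1 else 0) + card {m \<in> ini - {h}. bar G m < m}"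
    using card_filter_insert[of "ini - {h}" "bar G h" "\<lambda>m. bar G m < m"] h by simp
  have "ini = insert h (ini - {h})" using reverse_arrow by auto
  then have 2: "card {m \<in> ini. bar G m < m}
      = (if bar G h < h then 1 else 0) + card {m \<in> ini - {h}. bar G m < m}"
    using card_filter_insert[of "ini - {h}" h "\<lambda>m. bar G m < m"] h by simp
  show ?thesis unfolding reverse_arrow parity_def fst_conv snd_conv 1 2 using h(2) by auto
next
  case (switch_numbers vs ini v w)
  then show ?thesis
    using odd_inversions_transpose[of vs v w] by (auto simp: parity_def labellings_def)
qed

text \<open>The two vertex lists differ by a permutation of the vertices, and
  \<open>permutes_induct\<close> builds it from transpositions, each of which is a move.\<close>

lemma moves_connected_verts:
  assumes "is_graph G" "(vs, ini) \<in> labellings G" "(vs', ini) \<in> labellings G"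
  shows "((vs, ini), (vs', ini)) \<in> (moves G)\<^sup>*"
proof -
  have d: "distinct vs" "distinct vs'" "set vs = verts G" "set vs' = verts G"
    using assms by (auto simp: labellings_def)
  have len: "length vs = length vs'" using d by (metis distinct_card)
  have b1: "bij_betw ((!) vs) {..<length vs} (verts G)"
    "bij_betw ((!) vs') {..<length vs} (verts G)"
    using d len by (simp_all add: bij_betw_nth)
  \<comment> \<open>\<open>q\<close> sends the vertex at each position of \<open>vs\<close> to the
    vertex at the same position of \<open>vs'\<close>; \<open>p\<close> extends it by the identity,
    as \<open>permutes\<close> demands.\<close>
  define q where "q = (!) vs' \<circ> inv_into {..<length vs} ((!) vs)"
  have bq: "bij_betw q (verts G) (verts G)"
    unfolding q_def using b1 by (meson bij_betw_inv_into bij_betw_trans)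
  define p where "p = (\<lambda>x. if x \<in> verts G then q x else x)"
  have p: "p permutes verts G"
    by (rule bij_imp_permutes) (use bq in \<open>auto simp: p_def cong: bij_betw_cong\<close>)
  have "q (vs ! i) = vs' ! i" if "i < length vs" for i
    using b1(1) that by (simp add: q_def bij_betw_inv_into_left)
  then have "vs' = map p vs"
    using d len by (intro nth_equalityI) (auto simp: p_def)
  moreover have fin: "finite (verts G)" using assms(1) by (simp add: is_graph_def)
  have "((vs, ini), (map p vs, ini)) \<in> (moves G)\<^sup>* \<and> (map p vs, ini) \<in> labellings G"
    using p fin
  proof (induction rule: permutes_induct)
    case id then show ?case using assms by simp
  next
    case (swap a b p)
    then have "((map p vs, ini), (map (transpose a b) (map p vs), ini)) \<in> moves G"
      by (intro switch_numbers) auto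
    then have m: "((map p vs, ini), (map (transpose a b \<circ> p) vs, ini)) \<in> moves G"
      by simp
    then show ?case using swap moves_labellings(2)[OF assms(1) m]
      by (meson rtrancl_into_rtrancl)
  qed
  ultimately show ?thesis by blast
qed

text \<open>Induction on the number of edges with different arrows. It equals
  \<open>card (ini - ini')\<close> because an arrow set contains exactly one half of every edge; for
  the same reason an inclusion of arrow sets is an equality.\<close>

lemma moves_connected_ini:
  assumes "is_graph G"
  shows "(vs, ini) \<in> labellings G \<Longrightarrow> (vs, ini') \<in> labellings G \<Longrightarrow>
     ((vs, ini), (vs, ini')) \<in> (moves G)\<^sup>*"
proof (induction "card (ini - ini')" arbitrary: ini rule: less_induct)
  case less
  have fin: "finite ini" using less labellings_finite assms by blast
  show ?case
  proof (cases "ini \<subseteq> ini'")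
    case True
    have "ini = ini'"
    proof (rule ccontr)
      assume "ini \<noteq> ini'"
      then obtain h where "h \<in> ini'" "h \<notin> ini" using True by auto
      moreover have "h \<in> halves G" using \<open>h \<in> ini'\<close> less by (auto simp: labellings_def)
      ultimately show False using less True by (auto simp: labellings_def)
    qed
    then show ?thesis by simp
  next
    case False
    then obtain h where h: "h \<in> ini" "h \<notin> ini'" by auto
    then have m: "((vs, ini), (vs, insert (bar G h) (ini - {h}))) \<in> moves G"
      using less by (intro reverse_arrow)
    have "bar G h \<in> ini'" using h less by (auto simp: labellings_def)
    then have "insert (bar G h) (ini - {h}) - ini' \<subset> ini - ini'" using h by auto
    then have "card (insert (bar G h) (ini - {h}) - ini') < card (ini - ini')"
      using fin by (intro psubset_card_mono) auto
    then have "((vs, insert (bar G h) (ini - {h})), (vs, ini')) \<in> (moves G)\<^sup>*"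
      using less moves_labellings[OF assms m] by blast
    with m show ?thesis by (rule converse_rtrancl_into_rtrancl)
  qed
qed

lemma moves_connected:
  assumes "is_graph G" "l \<in> labellings G" "l' \<in> labellings G"
  shows "(l, l') \<in> (moves G)\<^sup>*"
proof -
  obtain vs ini vs' ini' where l: "l = (vs, ini)" "l' = (vs', ini')" by fastforce
  have "(vs', ini) \<in> labellings G" using assms l by (auto simp: labellings_def)
  then show ?thesis using moves_connected_verts moves_connected_ini assms l
    by (meson rtrancl_trans)
qed

lemma relpow_moves_parity:
  assumes "is_graph G" "l \<in> labellings G"
  shows "(l, l') \<in> moves G ^^ n \<Longrightarrow> l' \<in> labellings G \<and> (parity G l' \<longleftrightarrow> parity G l \<noteq> odd n)"
proof (induction n arbitrary: l')
  case (Suc n)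
  then obtain l'' where "(l, l'') \<in> moves G ^^ n" and m: "(l'', l') \<in> moves G" by auto
  then have "parity G l'' \<longleftrightarrow> parity G l \<noteq> odd n" using Suc.IH by blast
  then show ?case using moves_labellings[OF assms(1) m] moves_parity[OF assms(1) m] by auto
qed (use assms in auto)

lemma rtrancl_double: "(R O R)\<^sup>* = {(a, b). \<exists>n. even n \<and> (a, b) \<in> R ^^ n}"
proof -
  have *: "(R O R) ^^ n = R ^^ (2 * n)" for n
    by (induction n) (simp_all add: O_assoc)
  have "(a, b) \<in> (R O R)\<^sup>* \<longleftrightarrow> (\<exists>n. even n \<and> (a, b) \<in> R ^^ n)" for a b
    unfolding rtrancl_power * by (metis dvd_triv_left evenE)
  then show ?thesis by blast
qed

text \<open>Each move flips \<open>parity\<close>, so all paths between two given labellings have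
  lengths of the same parity. Some path exists by \<open>moves_connected\<close>, and it is even
  exactly when the parities agree.\<close>

lemma same_orientation_iff:
  assumes "is_graph G"
  shows "(l, l') \<in> same_orientation G \<longleftrightarrow>
     l \<in> labellings G \<and> l' \<in> labellings G \<and> parity G l = parity G l'"
proof
  assume "(l, l') \<in> same_orientation G"
  then show "l \<in> labellings G \<and> l' \<in> labellings G \<and> parity G l = parity G l'"
    unfolding same_orientation_def rtrancl_double using relpow_moves_parity[OF assms] by blast
next
  assume *: "l \<in> labellings G \<and> l' \<in> labellings G \<and> parity G l = parity G l'"
  then obtain n where n: "(l, l') \<in> moves G ^^ n"
    using moves_connected[OF assms] rtrancl_power by blast
  then have "even n" using relpow_moves_parity[OF assms] * by blast
  then show "(l, l') \<in> same_orientation G"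
    unfolding same_orientation_def rtrancl_double using * n by blast
qed

text \<open>A path of moves goes to a path of the same length, so relative parity survives. This
  serves isomorphisms and disjoint unions. A gluing acts only on special labellings, so there the
  parities are counted directly.\<close>

lemma parity_transport:
  assumes "is_graph G" "is_graph U" "l \<in> labellings G" "l' \<in> labellings G"
    and \<phi>: "\<And>l. l \<in> labellings G \<Longrightarrow> \<phi> l \<in> labellings U"
    and m: "\<And>l l'. (l, l') \<in> moves G \<Longrightarrow> (\<phi> l, \<phi> l') \<in> moves U"
  shows "parity U (\<phi> l) = parity U (\<phi> l') \<longleftrightarrow> parity G l = parity G l'"
proof -
  obtain n where n: "(l, l') \<in> moves G ^^ n"
    using moves_connected[OF assms(1)] assms rtrancl_power by blast
  have "(\<phi> l, \<phi> k) \<in> moves U ^^ n" if "(l, k) \<in> moves G ^^ n" for k n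
    using that by (induction n arbitrary: k) (auto intro: m)
  from this[OF n] show ?thesis
    using relpow_moves_parity[OF assms(2)] relpow_moves_parity[OF assms(1,3) n] \<phi>[OF assms(3)]
      by blast
qed

section \<open>Gluing two half-edges and contracting the new edge\<close>

text \<open>From here on an orientation is a parity class of labellings, and equality of oriented
  graphs becomes a comparison of parities.\<close>

lemma orient_simps [simp]:
  assumes "is_graph G" "l \<in> labellings G"
  shows "graph_of (orient G l) = G"
    and "orientation_of (orient G l) = {l' \<in> labellings G. parity G l' = parity G l}"
proof -
  have "same_orientation G `` {l} \<in> orientations G"
    unfolding orientations_def by (rule quotientI) fact
  then have "Rep_ograph (orient G l) = (G, same_orientation G `` {l})"
    unfolding orient_def using assms by (intro Abs_ograph_inverse) auto
  moreover have "same_orientation G `` {l} = {l' \<in> labellings G. parity G l' = parity G l}"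
    using assms same_orientation_iff by blast
  ultimately show "graph_of (orient G l) = G"
    and "orientation_of (orient G l) = {l' \<in> labellings G. parity G l' = parity G l}"
    by (simp_all add: graph_of_def orientation_of_def)
qed

lemma ograph_eqI: "graph_of X = graph_of Y \<Longrightarrow> orientation_of X = orientation_of Y \<Longrightarrow> X = Y"
  by (metis Rep_ograph_inject graph_of_def orientation_of_def prod_eqI)

lemma ograph_cases [case_names orient, cases type: ograph]:
  obtains G l where "X = orient G l" "is_graph G" "l \<in> labellings G"
proof -
  obtain G oo where X: "Rep_ograph X = (G, oo)" by fastforce
  then have g: "is_graph G" "oo \<in> orientations G" using Rep_ograph[of X] by auto
  then obtain l where l: "l \<in> labellings G" "oo = same_orientation G `` {l}"
    by (auto simp: orientations_def elim: quotientE)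
  then have "X = orient G l" using X by (metis Rep_ograph_inverse orient_def)
  with g l that show thesis by blast
qed

lemma is_graph_graph_of [simp]: "is_graph (graph_of X)"
  by (cases X) simp

lemma orientation_of_labellings: "l \<in> orientation_of X \<Longrightarrow> l \<in> labellings (graph_of X)"
  by (cases X) simp

lemma orient_eqI:
  "is_graph G \<Longrightarrow> l \<in> labellings G \<Longrightarrow> l' \<in> labellings G \<Longrightarrow> parity G l = parity G l' \<Longrightarrow> orient G l
    = orient G l'"
  by (rule ograph_eqI) simp_all

lemma orient_orientation_of: "l \<in> orientation_of X \<Longrightarrow> orient (graph_of X) l = X"
  by (cases X) (auto intro: orient_eqI)

lemma some_orientation_of: "(SOME l. l \<in> orientation_of X) \<in> orientation_of X"
proof -
  have "\<exists>l. l \<in> orientation_of X" by (cases X) auto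
  then show ?thesis by (rule someI_ex)
qed

text \<open>The pairs for which X_hk is a graph: the boundary excludes \<open>k = bar G h\<close>,
  and \<open>contract\<close> is 0 when the two vertices coincide.\<close>

definition gluable :: "graph \<Rightarrow> nat \<Rightarrow> nat \<Rightarrow> bool" where
  "gluable G h k \<longleftrightarrow> h \<in> halves G \<and> k \<in> halves G \<and> k \<noteq> bar G h \<and> vtx G h \<noteq> vtx G k"

text \<open>Such labellings serve both for the cutting and for the collapse.\<close>

definition normal :: "graph \<Rightarrow> nat \<Rightarrow> nat \<Rightarrow> labelling \<Rightarrow> bool" where
  "normal G h k l \<longleftrightarrow> l \<in> labellings G \<and> h \<in> snd l \<and> k \<notin> snd l \<and>
     (\<exists>rest. fst l = vtx G h # vtx G k # rest)"

definition glued :: "graph \<Rightarrow> nat \<Rightarrow> nat \<Rightarrow> graph" where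
  "glued G h k = collapse_graph (reglue_graph G h k) h"

definition glue_labelling :: "graph \<Rightarrow> nat \<Rightarrow> labelling \<Rightarrow> labelling" where
  "glue_labelling G h l = (vtx G h # drop 2 (fst l), snd l - {h})"

text \<open>This is \<open>X\<^sub>h\<^sub>k\<close> when \<open>h\<close> and \<open>k\<close> begin at different vertices.\<close>

definition glue :: "ograph \<Rightarrow> nat \<Rightarrow> nat \<Rightarrow> ograph" where
  "glue X h k = collapse (reglue X h k) h"

lemma gluableD:
  assumes "is_graph G" "gluable G h k"
  shows "h \<in> halves G" "k \<in> halves G" "h \<noteq> k" "k \<noteq> bar G h" "h \<noteq> bar G k" "bar G h \<noteq> bar G k"
    "vtx G h \<noteq> vtx G k" "bar G h \<noteq> h" "bar G k \<noteq> k" "bar G (bar G h) = h" "bar G (bar G k) = k"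
    "bar G h \<in> halves G" "bar G k \<in> halves G" "vtx G h \<in> verts G" "vtx G k \<in> verts G"
  using assms graphD[OF assms(1)] by (auto simp: gluable_def) metis+

lemma glued_simps:
  assumes "is_graph G" "gluable G h k"
  shows "verts (glued G h k) = verts G - {vtx G k}"
    "halves (glued G h k) = halves G - {h, k}"
    "vtx (glued G h k) = (\<lambda>m. if vtx G m = vtx G k then vtx G h else vtx G m)"
    "bar (glued G h k) = (bar G)(h := k, k := h, bar G h := bar G k, bar G k := bar G h)"
  using gluableD[OF assms] by (auto simp: glued_def collapse_graph_def reglue_graph_def fun_eq_iff)

lemma bar_glued: "bar (glued G h k) = bar (reglue_graph G h k)"
  by (simp add: glued_def collapse_graph_def)

lemma labellingsD:
  assumes "is_graph G" "(vs, ini) \<in> labellings G"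
  shows "distinct vs" "set vs = verts G" "ini \<subseteq> halves G"
    "\<And>h. h \<in> halves G \<Longrightarrow> bar G h \<in> ini \<longleftrightarrow> h \<notin> ini" "finite ini"
  using assms labellings_finite[OF assms] by (auto simp: labellings_def)

lemma bar_outside:
  assumes "is_graph G" "gluable G h k" "m \<in> halves G" "m \<notin> {h, k, bar G h, bar G k}"
  shows "bar G m \<notin> {h, k, bar G h, bar G k}"
proof -
  note g = gluableD[OF assms(1,2)]
  have "m = bar G (bar G m)" using graphD[OF assms(1,3)] by simp
  then show ?thesis using g assms(4) by (metis insert_iff singletonD)
qed

lemma bar_reglue:
  assumes "is_graph G" "gluable G h k"
  shows "bar (reglue_graph G h k) h = k" "bar (reglue_graph G h k) k = h"
    "bar (reglue_graph G h k) (bar G h) = bar G k" "bar (reglue_graph G h k) (bar G k) = bar G h"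
    "m \<notin> {h, k, bar G h, bar G k} \<Longrightarrow> bar (reglue_graph G h k) m = bar G m"
  using gluableD[OF assms] by (auto simp: reglue_graph_def)

lemma reglue_simps:
  "verts (reglue_graph G h k) = verts G" "halves (reglue_graph G h k) = halves G"
  "vtx (reglue_graph G h k) = vtx G"
  by (simp_all add: reglue_graph_def)

lemma bar_reglue_involution:
  assumes "is_graph G" "gluable G h k" "m \<in> halves G"
  shows "bar (reglue_graph G h k) m \<in> halves G" "bar (reglue_graph G h k) m \<noteq> m"
    "bar (reglue_graph G h k) (bar (reglue_graph G h k) m) = m"
proof -
  have "bar (reglue_graph G h k) m \<in> halves G \<and> bar (reglue_graph G h k) m \<noteq> m \<and>
    bar (reglue_graph G h k) (bar (reglue_graph G h k) m) = m"
  proof (cases "m \<in> {h, k, bar G h, bar G k}")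
    case True
    then show ?thesis
      by (elim insertE emptyE)
        (simp_all add: bar_reglue[OF assms(1,2)] gluableD[OF assms(1,2)]
          gluableD(3,6)[OF assms(1,2), THEN not_sym])
  next
    case False
    then show ?thesis
      using bar_outside[OF assms False] bar_reglue(5)[OF assms(1,2)] graphD[OF assms(1,3)] by simp
  qed
  then show "bar (reglue_graph G h k) m \<in> halves G" "bar (reglue_graph G h k) m \<noteq> m"
    "bar (reglue_graph G h k) (bar (reglue_graph G h k) m) = m" by auto
qed

lemma is_graph_reglue:
  assumes "is_graph G" "gluable G h k"
  shows "is_graph (reglue_graph G h k)"
  using assms(1) bar_reglue_involution[OF assms] by (simp add: is_graph_def reglue_simps)

text \<open>With \<open>h\<close> and \<open>bar G k\<close> initial, each of the two new edges
  again has exactly one initial half, so the arrow set can stay as it is.\<close>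

lemma labellings_reglue:
  assumes "is_graph G" "gluable G h k" "(vs, ini) \<in> labellings G" "h \<in> ini" "k \<notin> ini"
  shows "(vs, ini) \<in> labellings (reglue_graph G h k)"
proof -
  note g = gluableD[OF assms(1,2)] and b = bar_reglue[OF assms(1,2)]
    and l = labellingsD[OF assms(1,3)]
  have "m \<in> ini \<longleftrightarrow> bar (reglue_graph G h k) m \<notin> ini" if "m \<in> halves G" for m
  proof (cases "m \<in> {h, k, bar G h, bar G k}")
    case True
    then show ?thesis
      by (elim insertE emptyE) (simp_all add: b l(4) g(1,2) assms(4,5))
  next
    case False
    then show ?thesis using b(5) l(4)[OF that] by simp
  qed
  then show ?thesis using l by (simp add: labellings_def reglue_simps)
qed

text \<open>The merged vertex loses \<open>h\<close> and \<open>k\<close> but unites two vertices of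
  valence at least 3, so its valence is at least 4. All other vertices keep their
  half-edges.\<close>

lemma is_graph_glued:
  assumes "is_graph G" "gluable G h k"
  shows "is_graph (glued G h k)"
proof -
  note g = gluableD[OF assms] and s = glued_simps[OF assms]
  let ?H = "glued G h k"
  have fin: "finite (verts G)" "finite (halves G)"
    and val: "\<And>v. v \<in> verts G \<Longrightarrow> 3 \<le> card {m \<in> halves G. vtx G m = v}"
    using assms(1) by (auto simp: is_graph_def)
  have "3 \<le> card {m \<in> halves ?H. vtx ?H m = v}" if v: "v \<in> verts ?H" for v
  proof (cases "v = vtx G h")
    case False
    then have "{m \<in> halves ?H. vtx ?H m = v} = {m \<in> halves G. vtx G m = v}"
      using v g by (auto simp: s)
    then show ?thesis using val[of v] v by (simp add: s)
  next
    case True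
    let ?A = "{m \<in> halves G. vtx G m = vtx G h}" and ?B = "{m \<in> halves G. vtx G m = vtx G k}"
    have eq: "{m \<in> halves ?H. vtx ?H m = v} = (?A - {h}) \<union> (?B - {k})"
      using True g by (auto simp: s)
    have "card (?A - {h}) \<ge> 2" "card (?B - {k}) \<ge> 2"
      using val[of "vtx G h"] val[of "vtx G k"] g fin by (simp_all add: card_Diff_singleton)
    moreover have "card ((?A - {h}) \<union> (?B - {k})) = card (?A - {h}) + card (?B - {k})"
      using g fin by (intro card_Un_disjoint) auto
    ultimately show ?thesis unfolding eq by linarith
  qed
  moreover have "bar ?H m \<in> halves ?H \<and> bar ?H m \<noteq> m \<and> bar ?H (bar ?H m) = m"
    if m: "m \<in> halves ?H" for m
  proof -
    have m': "m \<in> halves G" "m \<noteq> h" "m \<noteq> k" using m by (auto simp: s)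
    have "bar ?H m \<noteq> h" "bar ?H m \<noteq> k"
      using bar_reglue(1,2)[OF assms] bar_reglue_involution(3)[OF assms m'(1)] m'
      unfolding bar_glued by metis+
    then show ?thesis using bar_reglue_involution[OF assms m'(1)] by (simp add: s(2) bar_glued)
  qed
  moreover have "vtx ?H m \<in> verts ?H" if "m \<in> halves ?H" for m
    using that g graphD(1)[OF assms(1)] by (auto simp: s)
  ultimately show ?thesis
    using fin unfolding is_graph_def by (simp add: s(1,2))
qed

lemma normalE:
  assumes "normal G h k l"
  obtains rest ini where "l = (vtx G h # vtx G k # rest, ini)" "l \<in> labellings G" "h \<in> ini"
    "k \<notin> ini"
    "glue_labelling G h l = (vtx G h # rest, ini - {h})"
  using assms that by (cases l) (auto simp: normal_def glue_labelling_def)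

lemma labellings_collapse:
  assumes "is_graph G" "gluable G h k"
    and "(vtx G h # vtx G k # r, ini) \<in> labellings (reglue_graph G h k)" "h \<in> ini"
  shows "(vtx G h # r, ini - {h}) \<in> labellings (glued G h k)"
proof -
  note s = glued_simps[OF assms(1,2)]
  let ?R = "reglue_graph G h k"
  note l = labellingsD[OF is_graph_reglue[OF assms(1,2)] assms(3), unfolded reglue_simps]
  have "k \<notin> ini" using l(4)[of h] assms(4) gluableD[OF assms(1,2)] bar_reglue[OF assms(1,2)] by simp
  have "m \<in> ini - {h} \<longleftrightarrow> bar (glued G h k) m \<notin> ini - {h}" if m: "m \<in> halves (glued G h k)" for m
  proof -
    have m': "m \<in> halves G" "m \<noteq> h" "m \<noteq> k" using m by (auto simp: s)
    then have "bar ?R m \<noteq> h"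
      using bar_reglue(1)[OF assms(1,2)] bar_reglue_involution(3)[OF assms(1,2) m'(1)] by metis
    then show ?thesis using l(4)[OF m'(1)] m'(2) by (simp add: bar_glued)
  qed
  moreover have "ini - {h} \<subseteq> halves (glued G h k)" using l \<open>k \<notin> ini\<close> by (auto simp: s)
  moreover have "set (vtx G h # r) = verts (glued G h k)" "distinct (vtx G h # r)"
    using l by (auto simp: s(1))
  ultimately show ?thesis by (simp add: labellings_def)
qed

lemma labellings_glue_labelling:
  assumes "is_graph G" "gluable G h k" "normal G h k l"
  shows "glue_labelling G h l \<in> labellings (glued G h k)"
  using assms(3)
proof (cases rule: normalE)
  case (1 rest ini)
  then show ?thesis
    using labellings_collapse[OF assms(1,2)] labellings_reglue[OF assms(1,2)] by metis
qed

text \<open>The first two vertices and the two arrows can be prescribed at once; the issue is to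
  keep the parity. At least six half-edges begin at the two vertices and at most four lie in the
  edges to be cut, so there is a further edge whose reversal corrects the parity. The valence
  condition supplies it.\<close>

lemma normal_exists:
  assumes "is_graph G" "gluable G h k" "l \<in> labellings G"
  shows "\<exists>l'. normal G h k l' \<and> parity G l' = parity G l"
proof -
  note g = gluableD[OF assms(1,2)]
  obtain vs ini where l: "l = (vs, ini)" by fastforce
  note lD = labellingsD[OF assms(1) assms(3)[unfolded l]]
  define rest where "rest = filter (\<lambda>v. v \<noteq> vtx G h \<and> v \<noteq> vtx G k) vs"
  define i1 where "i1 = (ini - {bar G h, k}) \<union> {h, bar G k}"
  let ?l1 = "(vtx G h # vtx G k # rest, i1)"
  have lab1: "?l1 \<in> labellings G"
  proof -
    have "m \<in> i1 \<longleftrightarrow> bar G m \<notin> i1" if m: "m \<in> halves G" for m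
    proof (cases "m \<in> {h, k, bar G h, bar G k}")
      case True
      then show ?thesis
        by (elim insertE emptyE) (simp_all add: i1_def g g(3,4,5,6,8,9)[THEN not_sym])
    next
      case False
      from bar_outside[OF assms(1,2) m this] show ?thesis using False lD(4)[OF m]
        by (auto simp: i1_def)
    qed
    moreover have "i1 \<subseteq> halves G" using g lD by (auto simp: i1_def)
    moreover have "distinct (vtx G h # vtx G k # rest)" "set (vtx G h # vtx G k # rest) = verts G"
      using g lD by (auto simp: rest_def)
    ultimately show ?thesis by (simp add: labellings_def)
  qed
  show ?thesis
  proof (cases "parity G ?l1 = parity G l")
    case True
    moreover have "normal G h k ?l1" using lab1 g by (simp add: normal_def i1_def)
    ultimately show ?thesis by blast
  next
    case False
    let ?A = "{m \<in> halves G. vtx G m = vtx G h}" and ?B = "{m \<in> halves G. vtx G m = vtx G k}"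
    have fin: "finite (halves G)" and "card ?A \<ge> 3" "card ?B \<ge> 3"
      using assms(1) g by (auto simp: is_graph_def)
    moreover have "card (?A \<union> ?B) = card ?A + card ?B"
      using g fin by (intro card_Un_disjoint) auto
    moreover have "card {h, k, bar G h, bar G k} \<le> 4"
      using card_insert_le_m1 by (simp add: card_insert_if)
    ultimately have "\<not> ?A \<union> ?B \<subseteq> {h, k, bar G h, bar G k}"
      using card_mono[of "{h, k, bar G h, bar G k}" "?A \<union> ?B"] by fastforce
    then obtain m' where m': "m' \<in> halves G" "m' \<notin> {h, k, bar G h, bar G k}" by auto
    then have bm': "bar G m' \<in> halves G" "bar G m' \<notin> {h, k, bar G h, bar G k}"
      using bar_outside[OF assms(1,2) m'] graphD[OF assms(1) m'(1)] by blast+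
    obtain m where m: "m \<in> i1" "m \<in> halves G" "m \<notin> {h, k, bar G h, bar G k}"
      "bar G m \<notin> {h, k, bar G h, bar G k}"
    proof (cases "m' \<in> i1")
      case True then show ?thesis using that m' bm' by blast
    next
      case False
      then have "bar G m' \<in> i1" using lab1 m' by (auto simp: labellings_def)
      then show ?thesis using that m' bm' graphD[OF assms(1) m'(1)] by metis
    qed
    let ?l2 = "(vtx G h # vtx G k # rest, insert (bar G m) (i1 - {m}))"
    have mv: "(?l1, ?l2) \<in> moves G" using lab1 m by (intro reverse_arrow)
    have "parity G ?l2 = parity G l" using moves_parity[OF assms(1) mv] False by blast
    moreover have "normal G h k ?l2"
      using moves_labellings[OF assms(1) mv] m lab1 g by (auto simp: normal_def i1_def)
    ultimately show ?thesis by blast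
  qed
qed

lemma card_filter_remove:
  assumes "finite S" "x \<in> S"
  shows "card {y \<in> S. P y} = (if P x then 1 else 0) + card {y \<in> S - {x}. P y}"
  using card_filter_insert[of "S - {x}" x P] assms by (simp add: insert_absorb)

text \<open>Of the initial half-edges only \<open>h\<close> and \<open>bar G k\<close> get a new
  partner. Their contributions before and after do not depend on the labelling, so the parity shifts
  by the same amount for all labellings considered.\<close>

lemma parity_reglue:
  assumes "is_graph G" "gluable G h k"
    and "(vs, ini) \<in> labellings G" "h \<in> ini" "k \<notin> ini" "(vs', ini') \<in> labellings G" "h \<in> ini'"
      "k \<notin> ini'"
  shows "parity (reglue_graph G h k) (vs, ini) = parity (reglue_graph G h k) (vs', ini') \<longleftrightarrow>
    parity G (vs, ini) = parity G (vs', ini')"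
proof -
  note g = gluableD[OF assms(1,2)]
  let ?R = "reglue_graph G h k"
  \<comment> \<open>The contributions of \<open>h\<close> and \<open>bar G k\<close> are added
    crosswise, the old ones to the new count and the new ones to the old count, which avoids
    subtraction.\<close>
  have *: "card {m \<in> i. bar ?R m < m} + ((if bar G h < h then 1 else 0) +
    (if k < bar G k then 1 else 0))
      = card {m \<in> i. bar G m < m} + ((if k < h then 1 else 0) +
        (if bar G h < bar G k then 1 else 0))"
    if l: "(v, i) \<in> labellings G" "h \<in> i" "k \<notin> i" for v i
  proof -
    note lD = labellingsD[OF assms(1) l(1)]
    have i: "h \<in> i" "bar G k \<in> i - {h}" "bar G h \<notin> i" using l lD(4)[of h] lD(4)[of k] g by auto
    have eq: "{m \<in> i - {h} - {bar G k}. bar ?R m < m} = {m \<in> i - {h} - {bar G k}. bar G m < m}"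
      using l i by (auto simp: reglue_graph_def)
    have "bar ?R h = k" "bar ?R (bar G k) = bar G h" using g by (auto simp: reglue_graph_def)
    then show ?thesis
      using card_filter_remove[of i h "\<lambda>m. bar ?R m < m"]
        card_filter_remove[of i h "\<lambda>m. bar G m < m"]
       card_filter_remove[of "i - {h}" "bar G k" "\<lambda>m. bar ?R m < m"]
       card_filter_remove[of "i - {h}" "bar G k" "\<lambda>m. bar G m < m"] i lD(5) g eq by simp
  qed
  from *[OF assms(3-5)] *[OF assms(6-8)] have
    "card {m \<in> ini. bar ?R m < m} + card {m \<in> ini'. bar G m < m} =
     card {m \<in> ini'. bar ?R m < m} + card {m \<in> ini. bar G m < m}" by linarith
  then have "odd (card {m \<in> ini. bar ?R m < m} + card {m \<in> ini'. bar G m < m}) =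
     odd (card {m \<in> ini'. bar ?R m < m} + card {m \<in> ini. bar G m < m})" by simp
  then show ?thesis unfolding parity_def fst_conv snd_conv even_add by blast
qed

text \<open>What the collapse removes, namely the contribution of \<open>h\<close> and comparisons
  with the leading vertices \<open>a\<close> and \<open>b\<close>, depends only on the set of the
  remaining vertices. It is therefore the same for both labellings.\<close>

lemma parity_collapse:
  assumes "finite (set r)" "set r = set r'" "finite i" "finite i'" "h \<in> i" "h \<in> i'" "bar H = bar G"
  shows "parity H (a # r, i - {h}) = parity H (a # r', i' - {h}) \<longleftrightarrow>
    parity G (a # b # r, i) = parity G (a # b # r', i')"
proof -
  have "{y \<in> set (b # r). P y} = {y \<in> set (b # r'). P y}" for P using assms(2) by auto
  then show ?thesis
  using assms(2) card_filter_remove[OF assms(3,5), of "\<lambda>m. bar G m < m"]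
    card_filter_remove[OF assms(4,6), of "\<lambda>m. bar G m < m"]
  unfolding parity_def fst_conv snd_conv assms(7) inversions.simps even_add
    by (simp only: even_add) blast
qed

lemma labellings_rest:
  assumes "(a # b # r, i) \<in> labellings G"
  shows "set r = verts G - {a, b}"
  using assms by (auto simp: labellings_def)

lemma parity_glue_labelling:
  assumes "is_graph G" "gluable G h k" "normal G h k l" "normal G h k l'"
  shows "parity (glued G h k) (glue_labelling G h l) = parity (glued G h k) (glue_labelling G h l')
    \<longleftrightarrow> parity G l = parity G l'"
  using assms(3)
proof (cases rule: normalE)
  case (1 r i)
  show ?thesis
    using assms(4)
  proof (cases rule: normalE)
    case c2: (1 r' i')
    have "set r = set r'" using labellings_rest 1 c2 by metis
    moreover have "finite i" "finite i'"
      using labellings_finite[OF assms(1)] 1 c2 by metis+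
    ultimately show ?thesis
      using parity_collapse[of r r' i i' h "glued G h k" "reglue_graph G h k" "vtx G h" "vtx G k"]
        parity_reglue[OF assms(1,2)] 1 c2
      by (simp add: glued_def collapse_graph_def)
  qed
qed

text \<open>This eliminates the \<open>SOME\<close> choices in \<open>reglue\<close> and
  \<open>collapse\<close>: a chosen labelling satisfies the conditions that \<open>l\<close>
  satisfies and has its parity, and either step preserves relative parity.\<close>

lemma glue_orient:
  assumes "is_graph G" "gluable G h k" "normal G h k l"
  shows "glue (orient G l) h k = orient (glued G h k) (glue_labelling G h l)"
  using assms(3)
proof (cases rule: normalE)
  case (1 r i)
  note g = gluableD[OF assms(1,2)]
  let ?R = "reglue_graph G h k"
  have R: "is_graph ?R" "l \<in> labellings ?R"
    using is_graph_reglue[OF assms(1,2)] labellings_reglue[OF assms(1,2)] 1 by auto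
  have "reglue (orient G l) h k = orient ?R l"
  proof -
    let ?P = "\<lambda>(vs, ini). (vs, ini) \<in> orientation_of (orient G l) \<and> h \<in> ini \<and> k \<notin> ini"
    have "?P l" using 1 assms by simp
    then have "?P (Eps ?P)" by (rule someI)
    moreover obtain vs ini where "Eps ?P = (vs, ini)" by fastforce
    ultimately have e: "Eps ?P = (vs, ini)" "(vs, ini) \<in> labellings G"
      "parity G (vs, ini) = parity G l"
      "h \<in> ini" "k \<notin> ini" using 1 assms by auto
    have "orient ?R (vs, ini) = orient ?R l"
      using e 1 R labellings_reglue[OF assms(1,2)] parity_reglue[OF assms(1,2), of vs ini]
      by (intro orient_eqI) auto
    moreover have "reglue (orient G l) h k = orient ?R (Eps ?P)"
      unfolding reglue_def using assms(1) 1(2) by simp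
    ultimately show ?thesis by (simp add: e(1))
  qed
  moreover have "collapse (orient ?R l) h = orient (glued G h k) (glue_labelling G h l)"
  proof -
    have v: "vtx ?R h = vtx G h" "vtx ?R (bar ?R h) = vtx G k"
      using g by (auto simp: reglue_graph_def)
    let ?P = "\<lambda>(rest, ini). (vtx G h # vtx G k # rest, ini) \<in> orientation_of (orient ?R l)
      \<and> h \<in> ini"
    have "?P (r, i)" using 1 R by simp
    then have "?P (Eps ?P)" by (rule someI)
    moreover obtain r' i' where "Eps ?P = (r', i')" by fastforce
    ultimately have e: "Eps ?P = (r', i')" "(vtx G h # vtx G k # r', i') \<in> labellings ?R" "h \<in> i'"
      "parity ?R (vtx G h # vtx G k # r', i') = parity ?R l"
      using R by auto
    have "set r = set r'"
      using labellings_rest[OF e(2)] labellings_rest[of _ _ r i] R(2) 1(1) by metis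
    moreover have "finite i" "finite i'"
      using labellings_finite[OF R(1)] R(2) 1(1) e(2) by metis+
    moreover have "parity ?R (vtx G h # vtx G k # r', i') = parity ?R (vtx G h # vtx G k # r, i)"
      using e(4) 1(1) by simp
    ultimately have "parity (glued G h k) (vtx G h # r', i' - {h})
      = parity (glued G h k) (glue_labelling G h l)"
      unfolding 1(5) using parity_collapse[OF finite_set _ _ _ e(3) 1(3) bar_glued[of G h k]]
        by metis
    moreover have "(vtx G h # r', i' - {h}) \<in> labellings (glued G h k)"
      using labellings_collapse[OF assms(1,2) e(2,3)] .
    ultimately have "orient (glued G h k) (vtx G h # r', i' - {h})
      = orient (glued G h k) (glue_labelling G h l)"
      using labellings_glue_labelling[OF assms] is_graph_glued[OF assms(1,2)] by (intro orient_eqI)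
    moreover have "collapse (orient ?R l) h =
        (let (rest, ini) = Eps ?P in orient (glued G h k) (vtx G h # rest, ini - {h}))"
      unfolding collapse_def Let_def using R by (simp add: v glued_def)
    ultimately show ?thesis by (simp add: e(1))
  qed
  ultimately show ?thesis by (simp add: glue_def)
qed

section \<open>Signed isomorphisms\<close>

definition graph_iso :: "(nat \<Rightarrow> nat) \<Rightarrow> (nat \<Rightarrow> nat) \<Rightarrow> graph \<Rightarrow> graph \<Rightarrow> bool" where
  "graph_iso f g G G' \<longleftrightarrow> bij_betw f (verts G) (verts G') \<and> bij_betw g (halves G) (halves G') \<and>
     (\<forall>h\<in>halves G. vtx G' (g h) = f (vtx G h) \<and> bar G' (g h) = g (bar G h))"

definition map_labelling :: "(nat \<Rightarrow> nat) \<Rightarrow> (nat \<Rightarrow> nat) \<Rightarrow> labelling \<Rightarrow> labelling" where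
  "map_labelling f g l = (map f (fst l), g ` snd l)"

text \<open>The isomorphism \<open>(f, g)\<close> preserves the orientation if \<open>s\<close> is false and reverses it if \<open>s\<close> is true.\<close>

definition signed_iso :: "bool \<Rightarrow> (nat \<Rightarrow> nat) \<Rightarrow> (nat \<Rightarrow> nat) \<Rightarrow> ograph \<Rightarrow> ograph \<Rightarrow> bool" where
  "signed_iso s f g X X' \<longleftrightarrow> graph_iso f g (graph_of X) (graph_of X') \<and>
     (\<exists>l\<in>orientation_of X. \<exists>l'\<in>orientation_of X'.
        (parity (graph_of X') (map_labelling f g l) \<noteq> parity (graph_of X') l') = s)"

lemma labellings_map_labelling:
  assumes "is_graph G" "graph_iso f g G G'" "l \<in> labellings G"
  shows "map_labelling f g l \<in> labellings G'"
proof -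
  obtain vs ini where l: "l = (vs, ini)" by fastforce
  note lD = labellingsD[OF assms(1) assms(3)[unfolded l]]
  have f: "inj_on f (set vs)" "f ` set vs = verts G'"
    using assms(2) lD(2) by (auto simp: graph_iso_def bij_betw_def)
  have g: "inj_on g (halves G)" "g ` halves G = halves G'"
    using assms(2) by (auto simp: graph_iso_def bij_betw_def)
  have "g h \<in> g ` ini \<longleftrightarrow> bar G' (g h) \<notin> g ` ini" if h: "h \<in> halves G" for h
  proof -
    have "bar G' (g h) = g (bar G h)" using assms(2) h by (simp add: graph_iso_def)
    moreover have "g m \<in> g ` ini \<longleftrightarrow> m \<in> ini" if "m \<in> halves G" for m
      using g(1) that lD(3) by (simp add: inj_on_image_mem_iff)
    ultimately show ?thesis using lD(4)[OF h] h graphD(2)[OF assms(1) h] by simp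
  qed
  then show ?thesis
    using f g lD by (auto simp: map_labelling_def l labellings_def distinct_map simp flip: g(2))
qed

lemma moves_map_labelling:
  assumes "is_graph G" "graph_iso f g G G'" "(l, l') \<in> moves G"
  shows "(map_labelling f g l, map_labelling f g l') \<in> moves G'"
  using assms(3)
proof (cases rule: moves_cases)
  case (reverse_arrow vs ini h)
  note lD = labellingsD[OF assms(1) reverse_arrow(3)[unfolded reverse_arrow(1)]]
  have h: "h \<in> halves G" using lD reverse_arrow by auto
  have "g ` (ini - {h}) = g ` ini - {g h}"
    using assms(2) lD(3) h by (auto simp: graph_iso_def bij_betw_def inj_on_def)
  then have "map_labelling f g l' = (map f vs, insert (bar G' (g h)) (g ` ini - {g h}))"
    using assms(2) h reverse_arrow by (simp add: map_labelling_def graph_iso_def)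
  moreover have "map_labelling f g l = (map f vs, g ` ini)" using reverse_arrow
    by (simp add: map_labelling_def)
  ultimately show ?thesis
    using labellings_map_labelling[OF assms(1,2) reverse_arrow(3)] reverse_arrow(4)
    by (metis image_eqI moves.reverse_arrow)
next
  case (switch_numbers vs ini v w)
  note lD = labellingsD[OF assms(1) switch_numbers(3)[unfolded switch_numbers(1)]]
  have f: "inj_on f (verts G)" "f ` verts G = verts G'"
    using assms(2) by (auto simp: graph_iso_def bij_betw_def)
  have "f (transpose v w x) = transpose (f v) (f w) (f x)" if "x \<in> set vs" for x
    using that lD(2) f(1) switch_numbers by (auto simp: transpose_def inj_on_def)
  then have "map_labelling f g l' = (map (transpose (f v) (f w)) (map f vs), g ` ini)"
    using switch_numbers by (simp add: map_labelling_def)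
  moreover have "map_labelling f g l = (map f vs, g ` ini)" using switch_numbers
    by (simp add: map_labelling_def)
  moreover have "f v \<noteq> f w" "f v \<in> verts G'" "f w \<in> verts G'"
    using f switch_numbers by (auto simp: inj_on_def)
  ultimately show ?thesis
    using labellings_map_labelling[OF assms(1,2) switch_numbers(3)] by (metis moves.switch_numbers)
qed

lemma parity_map_labelling:
  assumes "is_graph G" "is_graph G'" "graph_iso f g G G'" "l \<in> labellings G" "l' \<in> labellings G"
  shows "parity G' (map_labelling f g l) = parity G' (map_labelling f g l') \<longleftrightarrow> parity G l
    = parity G l'"
  using assms(1,2,4,5) labellings_map_labelling[OF assms(1,3)] moves_map_labelling[OF assms(1,3)]
    by (rule parity_transport)

text \<open>An isomorphism preserves relative parity, so the sign is independent of the
  representatives in the definition and can be read off from a single pair of labellings.\<close>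

lemma signed_iso_orient:
  assumes "is_graph G" "is_graph G'" "l \<in> labellings G" "l' \<in> labellings G'"
  shows "signed_iso s f g (orient G l) (orient G' l') \<longleftrightarrow> graph_iso f g G G'
    \<and> (parity G' (map_labelling f g l) \<noteq> parity G' l') = s"
proof
  assume "signed_iso s f g (orient G l) (orient G' l')"
  then obtain m m' where gi: "graph_iso f g G G'" and m: "m \<in> labellings G"
    "parity G m = parity G l"
    "parity G' m' = parity G' l'" "(parity G' (map_labelling f g m) \<noteq> parity G' m') = s"
    unfolding signed_iso_def using assms by auto
  then have "parity G' (map_labelling f g m) = parity G' (map_labelling f g l)"
    using parity_map_labelling[OF assms(1,2) gi m(1) assms(3)] by simp
  then show "graph_iso f g G G' \<and> (parity G' (map_labelling f g l) \<noteq> parity G' l') = s" using gi m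
    by simp
next
  assume "graph_iso f g G G' \<and> (parity G' (map_labelling f g l) \<noteq> parity G' l') = s"
  moreover have "l \<in> orientation_of (orient G l)" "l' \<in> orientation_of (orient G' l')"
    using assms by simp_all
  ultimately show "signed_iso s f g (orient G l) (orient G' l')"
    unfolding signed_iso_def using assms by (metis orient_simps(1))
qed

lemma gluable_graph_iso:
  assumes "is_graph G" "graph_iso f g G G'" "gluable G h k"
  shows "gluable G' (g h) (g k)"
proof -
  note gl = gluableD[OF assms(1,3)]
  have f: "inj_on f (verts G)" and g: "inj_on g (halves G)" "g ` halves G = halves G'"
    using assms(2) by (auto simp: graph_iso_def bij_betw_def)
  have "g k \<noteq> g (bar G h)" using gl g(1) by (simp add: inj_on_eq_iff)
  moreover have "f (vtx G h) \<noteq> f (vtx G k)" using gl f by (simp add: inj_on_eq_iff)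
  ultimately show ?thesis using assms(2) gl g(2) by (auto simp: gluable_def graph_iso_def)
qed

text \<open>The only name chosen in a gluing is that of the merged vertex, and it is
  \<open>vtx G h\<close>; hence \<open>f\<close> and \<open>g\<close> themselves restrict to the
  glued graphs.\<close>

lemma graph_iso_glued:
  assumes "is_graph G" "is_graph G'" "graph_iso f g G G'" "gluable G h k"
  shows "graph_iso f g (glued G h k) (glued G' (g h) (g k))"
proof -
  note gl = gluableD[OF assms(1,4)]
  have gl': "gluable G' (g h) (g k)" by (rule gluable_graph_iso[OF assms(1,3,4)])
  note s = glued_simps[OF assms(1,4)] and s' = glued_simps[OF assms(2) gl']
  have f: "inj_on f (verts G)" "f ` verts G = verts G'"
    and g: "inj_on g (halves G)" "g ` halves G = halves G'"
    and c: "\<And>m. m \<in> halves G \<Longrightarrow> vtx G' (g m) = f (vtx G m)"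
      "\<And>m. m \<in> halves G \<Longrightarrow> bar G' (g m) = g (bar G m)"
    using assms(3) by (auto simp: graph_iso_def bij_betw_def)
  have "bij_betw f (verts G - {vtx G k}) (verts G' - {vtx G' (g k)})"
    using f gl c by (auto simp: bij_betw_def inj_on_diff inj_on_image_set_diff[OF f(1)])
  moreover have "bij_betw g (halves G - {h, k}) (halves G' - {g h, g k})"
    using g gl c by (auto simp: bij_betw_def inj_on_diff inj_on_image_set_diff[OF g(1)])
  moreover have "vtx (glued G' (g h) (g k)) (g m) = f (vtx (glued G h k) m)" if m: "m \<in> halves G"
    for m
    using gl m f(1) graphD(1)[OF assms(1) m] by (simp add: s s' c inj_on_eq_iff)
  moreover have "bar (glued G' (g h) (g k)) (g m) = g (bar (glued G h k) m)" if m: "m \<in> halves G"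
    for m
  proof -
    have "g m = g x \<longleftrightarrow> m = x" if "x \<in> halves G" for x using g(1) m that by (simp add: inj_on_eq_iff)
    then show ?thesis using gl m by (simp add: s s' c)
  qed
  ultimately show ?thesis by (simp add: graph_iso_def s(1,2) s'(1,2))
qed

lemma normal_map_labelling:
  assumes "is_graph G" "graph_iso f g G G'" "gluable G h k" "normal G h k l"
  shows "normal G' (g h) (g k) (map_labelling f g l)"
    "glue_labelling G' (g h) (map_labelling f g l) = map_labelling f g (glue_labelling G h l)"
proof -
  note gl = gluableD[OF assms(1,3)]
  obtain r i where l: "l = (vtx G h # vtx G k # r, i)" "l \<in> labellings G" "h \<in> i" "k \<notin> i"
    "glue_labelling G h l = (vtx G h # r, i - {h})" using assms(4) by (rule normalE)
  have i: "i \<subseteq> halves G" using l by (auto simp: labellings_def)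
  have g: "inj_on g (halves G)" and v: "vtx G' (g h) = f (vtx G h)" "vtx G' (g k) = f (vtx G k)"
    using assms(2) gl by (auto simp: graph_iso_def bij_betw_def)
  show "normal G' (g h) (g k) (map_labelling f g l)"
    using labellings_map_labelling[OF assms(1,2) l(2)] l v i gl(1,2) g
    by (auto simp: normal_def map_labelling_def inj_on_image_mem_iff)
  have "g ` (i - {h}) = g ` i - {g h}" using i g gl(1) by (auto simp: inj_on_def)
  then show "glue_labelling G' (g h) (map_labelling f g l)
    = map_labelling f g (glue_labelling G h l)"
    unfolding l(5) by (simp add: l(1) glue_labelling_def map_labelling_def v)
qed

lemma glue_normal:
  assumes "gluable (graph_of X) h k"
  obtains l where "l \<in> orientation_of X" "normal (graph_of X) h k l"
    "glue X h k = orient (glued (graph_of X) h k) (glue_labelling (graph_of X) h l)"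
    "glue_labelling (graph_of X) h l \<in> labellings (glued (graph_of X) h k)"
proof -
  obtain G l where X: "X = orient G l" "is_graph G" "l \<in> labellings G" by (cases X)
  then obtain l' where l': "normal G h k l'" "parity G l' = parity G l"
    using normal_exists[of G h k l] assms by auto
  moreover have "l' \<in> labellings G" using l' by (simp add: normal_def)
  moreover have "X = orient G l'" using X l' \<open>l' \<in> labellings G\<close> by (auto intro: orient_eqI)
  ultimately show thesis
    using that[of l'] glue_orient[of G h k l'] labellings_glue_labelling[of G h k l'] X(2,3) assms
      X(1) by auto
qed

lemma graph_of_glue: "gluable (graph_of X) h k \<Longrightarrow> graph_of (glue X h k) = glued (graph_of X) h k"
  using glue_normal[of X h k] is_graph_glued[of "graph_of X" h k]
    by (metis is_graph_graph_of orient_simps(1))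

lemma signed_isoD:
  assumes "signed_iso s f g X X'" "l \<in> orientation_of X" "l' \<in> orientation_of X'"
  shows "graph_iso f g (graph_of X) (graph_of X')"
    "(parity (graph_of X') (map_labelling f g l) \<noteq> parity (graph_of X') l') = s"
proof -
  have "X = orient (graph_of X) l" "X' = orient (graph_of X') l'"
    "l \<in> labellings (graph_of X)" "l' \<in> labellings (graph_of X')"
    using assms orient_orientation_of orientation_of_labellings by metis+
  then show "graph_iso f g (graph_of X) (graph_of X')"
    "(parity (graph_of X') (map_labelling f g l) \<noteq> parity (graph_of X') l') = s"
    using signed_iso_orient[of "graph_of X" "graph_of X'" l l' s f g] assms(1) by auto
qed

text \<open>Isomorphisms carry normal labellings to normal labellings and commute with
  \<open>glue_labelling\<close>, so the sign is handed on unchanged.\<close>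

lemma signed_iso_glue:
  assumes "signed_iso s f g X X'" "gluable (graph_of X) h k"
  shows "signed_iso s f g (glue X h k) (glue X' (g h) (g k))"
proof -
  let ?G = "graph_of X" and ?G' = "graph_of X'"
  have gi: "graph_iso f g ?G ?G'" using assms by (simp add: signed_iso_def)
  have gl': "gluable ?G' (g h) (g k)" using gluable_graph_iso[OF _ gi assms(2)] by simp
  obtain l where l: "l \<in> orientation_of X" "normal ?G h k l"
    "glue X h k = orient (glued ?G h k) (glue_labelling ?G h l)"
      "glue_labelling ?G h l \<in> labellings (glued ?G h k)"
    using glue_normal[OF assms(2)] .
  obtain l' where l': "l' \<in> orientation_of X'" "normal ?G' (g h) (g k) l'"
    "glue X' (g h) (g k) = orient (glued ?G' (g h) (g k)) (glue_labelling ?G' (g h) l')"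
    "glue_labelling ?G' (g h) l' \<in> labellings (glued ?G' (g h) (g k))"
    using glue_normal[OF gl'] .
  have n: "normal ?G' (g h) (g k) (map_labelling f g l)"
    "glue_labelling ?G' (g h) (map_labelling f g l) = map_labelling f g (glue_labelling ?G h l)"
    using normal_map_labelling[OF _ gi assms(2) l(2)] by auto
  have "(parity (glued ?G' (g h) (g k)) (map_labelling f g (glue_labelling ?G h l)) \<noteq> parity
    (glued ?G' (g h) (g k)) (glue_labelling ?G' (g h) l')) = s"
    using parity_glue_labelling[OF _ gl' n(1) l'(2)] signed_isoD(2)[OF assms(1) l(1) l'(1)] n(2)
      by simp
  then show ?thesis
    unfolding l(3) l'(3)
    using signed_iso_orient[OF is_graph_glued[OF _ assms(2)] is_graph_glued[OF _ gl'] l(4) l'(4)]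
      graph_iso_glued[OF _ _ gi assms(2)] by simp
qed

section \<open>Classes of oriented graphs and their transport along signed isomorphisms\<close>

definition graph_class :: "ograph \<Rightarrow> 'k::field_char_0 graph_space" where
  "graph_class X = abs_graph_space (basis X)"

definition signed :: "bool \<Rightarrow> 'a::ab_group_add \<Rightarrow> 'a" where
  "signed s x = (if s then - x else x)"

lemma abs_eq_iff: "abs_graph_space u = abs_graph_space v \<longleftrightarrow> u - v \<in> fscale.span relations"
  by (simp add: graph_space.abs_eq_iff graph_rel_def)

text \<open>The relations speak of a single move only. A path between labellings of different parity
  has odd length; everything but its last move is an even path and stays within one orientation, so
  the last move exhibits the two orientations as opposite.\<close>

lemma graph_class_opposite:
  assumes "is_graph G" "l \<in> labellings G" "l' \<in> labellings G" "parity G l \<noteq> parity G l'"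
  shows "graph_class (orient G l') = - (graph_class (orient G l) :: 'k::field_char_0 graph_space)"
proof -
  obtain n where n: "(l, l') \<in> moves G ^^ n"
    using moves_connected[OF assms(1-3)] rtrancl_power by blast
  then have "odd n" using relpow_moves_parity[OF assms(1,2) n] assms(4) by blast
  then obtain m where m: "n = Suc m" "even m" by (metis even_Suc odd_Suc_minus_one old.nat.exhaust)
  then obtain l'' where l'': "(l, l'') \<in> moves G ^^ m" "(l'', l') \<in> moves G" using n by auto
  have "l'' \<in> orientation_of (orient G l)"
    using relpow_moves_parity[OF assms(1,2) l''(1)] m assms by simp
  moreover have "l' \<in> orientation_of (orient G l')" using assms by simp
  ultimately have "opposite G (orientation_of (orient G l)) (orientation_of (orient G l'))"
    using l''(2) unfolding opposite_def by blast
  then have "basis (orient G l) + (basis (orient G l') :: ograph \<Rightarrow>\<^sub>0 'k) \<in> relations"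
    unfolding relations_def using assms(1-3) by
      (intro UnI2 CollectI exI[of _ "orient G l"] exI[of _ "orient G l'"]) simp_all
  then have "basis (orient G l') + (basis (orient G l) :: ograph \<Rightarrow>\<^sub>0 'k) \<in> relations"
    by (simp add: add.commute)
  then have "abs_graph_space (basis (orient G l') + basis (orient G l)) = (0 :: 'k graph_space)"
    unfolding zero_graph_space.abs_eq abs_eq_iff by (simp add: fscale.span_base)
  then show ?thesis
    unfolding graph_class_def by (simp add: eq_neg_iff_add_eq_0 plus_graph_space.abs_eq)
qed

lemma graph_class_isomorphic: "isomorphic X Y \<Longrightarrow> graph_class X = graph_class Y"
  unfolding graph_class_def abs_eq_iff relations_def by (intro fscale.span_base) auto

text \<open>\<open>isomorphic\<close> asks for equality of orientations as sets of labellings, so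
  every labelling of the target has to be reached.\<close>

lemma map_labelling_surj:
  assumes "is_graph G" "is_graph G'" "graph_iso f g G G'" "l' \<in> labellings G'"
  obtains l where "l \<in> labellings G" "map_labelling f g l = l'"
proof -
  obtain vs' i' where l': "l' = (vs', i')" by fastforce
  note lD = labellingsD[OF assms(2) assms(4)[unfolded l']]
  have f: "inj_on f (verts G)" "f ` verts G = verts G'"
    and g: "inj_on g (halves G)" "g ` halves G = halves G'"
    and c: "\<And>m. m \<in> halves G \<Longrightarrow> bar G' (g m) = g (bar G m)"
    using assms(3) by (auto simp: graph_iso_def bij_betw_def)
  define vs where "vs = map (inv_into (verts G) f) vs'"
  define i where "i = {h \<in> halves G. g h \<in> i'}"
  have "map f vs = vs'"
  proof -
    have "f (inv_into (verts G) f x) = x" if "x \<in> set vs'" for x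
      using that lD(2) f(2) by (simp add: f_inv_into_f)
    then show ?thesis by (simp add: vs_def map_idI)
  qed
  moreover have "g ` i = i'"
    using lD(3) g by (auto simp: i_def)
  moreover have "distinct vs" using lD(1,2) f
    by (auto simp: vs_def distinct_map inj_on_inv_into)
  moreover have "set vs = verts G"
    using lD(2) f by (simp add: vs_def) (metis inv_into_image_cancel order_refl)
  moreover have "\<forall>h\<in>halves G. h \<in> i \<longleftrightarrow> bar G h \<notin> i"
  proof
    fix h assume "h \<in> halves G"
    then show "h \<in> i \<longleftrightarrow> bar G h \<notin> i"
      using lD(4)[of "g h"] g(2) c[of h] graphD(2)[OF assms(1), of h] by (auto simp: i_def)
  qed
  moreover have "i \<subseteq> halves G" by (auto simp: i_def)
  ultimately have "(vs, i) \<in> labellings G" "map_labelling f g (vs, i) = l'"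
    unfolding labellings_def map_labelling_def l' mem_Collect_eq split fst_conv snd_conv by blast+
  then show thesis by (rule that)
qed

text \<open>The map is an orientation-preserving isomorphism onto \<open>G'\<close> with the image
  labelling. What is left compares two orientations of the one graph \<open>G'\<close>.\<close>

lemma signed_iso_graph_class:
  assumes "signed_iso s f g X X'"
  shows "graph_class X' = signed s (graph_class X :: 'k::field_char_0 graph_space)"
proof -
  obtain G l where X: "X = orient G l" "is_graph G" "l \<in> labellings G" by (cases X)
  obtain G' l' where X': "X' = orient G' l'" "is_graph G'" "l' \<in> labellings G'" by (cases X')
  have gi: "graph_iso f g G G'" and p: "(parity G' (map_labelling f g l) \<noteq> parity G' l') = s"
    using assms signed_iso_orient[OF X(2) X'(2) X(3) X'(3)] X X' by auto
  have m: "map_labelling f g l \<in> labellings G'" by (rule labellings_map_labelling[OF X(2) gi X(3)])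
  have "isomorphic X (orient G' (map_labelling f g l))"
  proof -
    have "orientation_of (orient G' (map_labelling f g l)) = map_labelling f g ` orientation_of X"
    proof (intro equalityI subsetI)
      fix y assume "y \<in> orientation_of (orient G' (map_labelling f g l))"
      then have y: "y \<in> labellings G'" "parity G' y = parity G' (map_labelling f g l)" using X' m
        by auto
      obtain x where x: "x \<in> labellings G" "map_labelling f g x = y"
        using map_labelling_surj[OF X(2) X'(2) gi y(1)] .
      then show "y \<in> map_labelling f g ` orientation_of X"
        using X y parity_map_labelling[OF X(2) X'(2) gi x(1) X(3)] by auto
    next
      fix y assume "y \<in> map_labelling f g ` orientation_of X"
      then obtain x where x: "y = map_labelling f g x" "x \<in> labellings G" "parity G x = parity G l"
        using X by auto
      then show "y \<in> orientation_of (orient G' (map_labelling f g l))"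
        using X X' m parity_map_labelling[OF X(2) X'(2) gi x(2) X(3)]
          labellings_map_labelling[OF X(2) gi x(2)] by auto
    qed
    moreover have "map_labelling f g = (\<lambda>(vs, ini). (map f vs, g ` ini))"
      by (auto simp: map_labelling_def fun_eq_iff)
    ultimately show ?thesis
      unfolding isomorphic_def using gi X X' m
        by (intro exI[of _ f] exI[of _ g]) (auto simp: graph_iso_def)
  qed
  then have 1: "graph_class (orient G' (map_labelling f g l)) = (graph_class X :: 'k graph_space)"
    by (simp add: graph_class_isomorphic)
  show ?thesis
  proof (cases s)
    case True
    then show ?thesis using graph_class_opposite[OF X'(2) m X'(3), where ?'k = 'k] p 1 X'(1)
      by (simp add: signed_def)
  next
    case False
    then have "X' = orient G' (map_labelling f g l)" using X' m p by (auto intro: orient_eqI)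
    then show ?thesis using 1 False by (simp add: signed_def)
  qed
qed

lemma signed_simps [simp]: "signed False x = x" "signed True x = - x"
  "signed s (- x) = - signed s x" "signed s 0 = 0"
  "signed s (signed s' x) = signed (s \<noteq> s') x"
  by (auto simp: signed_def)

lemma isomorphic_signed_iso:
  assumes "isomorphic X Y"
  obtains f g where "signed_iso False f g X Y"
proof -
  obtain f g where fg: "graph_iso f g (graph_of X) (graph_of Y)"
    "orientation_of Y = (\<lambda>(vs, ini). (map f vs, g ` ini)) ` orientation_of X"
    using assms unfolding isomorphic_def graph_iso_def by blast
  obtain l where l: "l \<in> orientation_of X" using some_orientation_of by blast
  then have "map_labelling f g l \<in> orientation_of Y" unfolding fg(2)
    by (auto simp: map_labelling_def split_beta intro!: image_eqI[of _ _ l])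
  then have "signed_iso False f g X Y" using fg(1) l unfolding signed_iso_def by blast
  then show thesis by (rule that)
qed

lemma graph_iso_id: "graph_iso id id G G"
  by (simp add: graph_iso_def)

lemma map_labelling_id [simp]: "map_labelling id id l = l"
  by (simp add: map_labelling_def)

lemma signed_iso_id_orient:
  assumes "is_graph G" "l \<in> labellings G" "l' \<in> labellings G"
  shows "signed_iso (parity G l \<noteq> parity G l') id id (orient G l) (orient G l')"
  using assms by (simp add: signed_iso_orient graph_iso_id)

text \<open>Together with \<open>isomorphic_signed_iso\<close> this gives both kinds of relations
  one form, so that compatibility with the quotient has to be checked for signed isomorphisms
  only.\<close>

lemma opposite_signed_iso:
  assumes "graph_of X = graph_of Y" "opposite (graph_of X) (orientation_of X) (orientation_of Y)"
  shows "signed_iso True id id X Y"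
proof -
  obtain l l' where l: "l \<in> orientation_of X" "l' \<in> orientation_of Y" "(l, l') \<in> moves (graph_of X)"
    using assms(2) by (auto simp: opposite_def)
  then have "parity (graph_of X) l' \<longleftrightarrow> \<not> parity (graph_of X) l" using moves_parity by simp
  then have "(parity (graph_of Y) (map_labelling id id l) \<noteq> parity (graph_of Y) l') = True"
    using assms(1) by simp
  then show ?thesis unfolding signed_iso_def using l(1,2) assms(1) graph_iso_id by metis
qed

definition glue_class :: "ograph \<Rightarrow> nat \<Rightarrow> nat \<Rightarrow> 'k::field_char_0 graph_space" where
  "glue_class X h k = abs_graph_space (contract X h k)"

lemma glue_class_eq: "glue_class X h k = (if vtx (graph_of X) h
  = vtx (graph_of X) k then 0 else graph_class (glue X h k))"
  by (simp add: glue_class_def contract_def graph_class_def glue_def zero_graph_space.abs_eq)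

lemma glue_class_gluable: "gluable (graph_of X) h k \<Longrightarrow> glue_class X h k = graph_class (glue X h k)"
  by (simp add: glue_class_eq gluable_def)

lemma signed_iso_glue_class:
  assumes "signed_iso s f g X X'" "h \<in> halves (graph_of X)" "k \<in> halves (graph_of X)"
    "k \<noteq> bar (graph_of X) h"
  shows "glue_class X' (g h) (g k) = signed s (glue_class X h k :: 'k::field_char_0 graph_space)"
proof (cases "vtx (graph_of X) h = vtx (graph_of X) k")
  case True
  moreover have "vtx (graph_of X') (g h) = vtx (graph_of X') (g k)"
    using assms True by (simp add: signed_iso_def graph_iso_def)
  ultimately show ?thesis by (simp add: glue_class_eq)
next
  case False
  then have g: "gluable (graph_of X) h k" using assms by (simp add: gluable_def)
  then have g': "gluable (graph_of X') (g h) (g k)"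
    using gluable_graph_iso[OF is_graph_graph_of _ g] assms(1) unfolding signed_iso_def by blast
  show ?thesis
    unfolding glue_class_gluable[OF g] glue_class_gluable[OF g']
      by (rule signed_iso_graph_class[OF signed_iso_glue[OF assms(1) g]])
qed

section \<open>Vertex order and arrows as separate contributions to the sign\<close>

definition arrows :: "graph \<Rightarrow> nat set set" where
  "arrows G = {i. i \<subseteq> halves G \<and> (\<forall>h\<in>halves G. h \<in> i \<longleftrightarrow> bar G h \<notin> i)}"

definition arrow_parity :: "graph \<Rightarrow> nat set \<Rightarrow> bool" where
  "arrow_parity G i \<longleftrightarrow> odd (card {h \<in> i. bar G h < h})"

definition list_parity :: "nat list \<Rightarrow> bool" where
  "list_parity vs \<longleftrightarrow> odd (inversions vs)"

lemma labellings_iff: "(vs, i) \<in> labellings G \<longleftrightarrow> distinct vs \<and> set vs = verts G \<and> i \<in> arrows G"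
  by (auto simp: labellings_def arrows_def)

lemma parity_iff: "parity G (vs, i) \<longleftrightarrow> list_parity vs \<noteq> arrow_parity G i"
  by (auto simp: parity_def list_parity_def arrow_parity_def)

lemma list_parity_move_front:
  "distinct (as @ x # bs) \<Longrightarrow> list_parity (as @ x # bs) \<longleftrightarrow> list_parity (x # as @ bs) \<noteq> odd (length as)"
  unfolding list_parity_def by (rule odd_inversions_move_front)

lemma graph_finite: "is_graph G \<Longrightarrow> finite (verts G)" "is_graph G \<Longrightarrow> finite (halves G)"
  by (simp_all add: is_graph_def)

lemma arrowsD: "i \<in> arrows G \<Longrightarrow> h \<in> halves G \<Longrightarrow> bar G h \<in> i \<longleftrightarrow> h \<notin> i"
  by (simp add: arrows_def)

text \<open>A \<open>reverse_arrow\<close> move with an arbitrary numbering of the vertices, whose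
  contribution to the parity cancels.\<close>

lemma arrows_flip:
  assumes "is_graph G" "i \<in> arrows G" "h \<in> i"
  shows "insert (bar G h) (i - {h}) \<in> arrows G"
    "arrow_parity G (insert (bar G h) (i - {h})) \<longleftrightarrow> \<not> arrow_parity G i"
proof -
  obtain vs where vs: "distinct vs" "set vs = verts G"
    using finite_distinct_list[OF graph_finite(1)[OF assms(1)]] by blast
  then have m: "((vs, i), (vs, insert (bar G h) (i - {h}))) \<in> moves G"
    using assms by (intro reverse_arrow) (simp_all add: labellings_iff)
  show "insert (bar G h) (i - {h}) \<in> arrows G"
    "arrow_parity G (insert (bar G h) (i - {h})) \<longleftrightarrow> \<not> arrow_parity G i"
    using moves_labellings[OF assms(1) m] moves_parity[OF assms(1) m]
      by (auto simp: labellings_iff parity_iff)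
qed

lemma arrows_force:
  assumes "is_graph G" "i \<in> arrows G" "h \<in> halves G"
  shows "insert h (i - {bar G h}) \<in> arrows G"
proof (cases "h \<in> i")
  case True
  then have "insert h (i - {bar G h}) = i" using assms by (auto simp: arrows_def)
  then show ?thesis using assms by simp
next
  case False
  then have "bar G h \<in> i" using assms by (auto simp: arrows_def)
  from arrows_flip(1)[OF assms(1,2) this] show ?thesis using graphD[OF assms(1,3)] by simp
qed

lemma arrows_collapse:
  assumes "is_graph G" "gluable G h k" "i \<in> arrows G" "h \<in> i" "k \<notin> i"
  shows "i - {h} \<in> arrows (glued G h k)"
proof -
  note g = gluableD[OF assms(1,2)]
  obtain r where r: "distinct r" "set r = verts G - {vtx G h, vtx G k}"
    using finite_distinct_list[of "verts G - {vtx G h, vtx G k}"] graph_finite[OF assms(1)] by blast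
  then have "normal G h k (vtx G h # vtx G k # r, i)"
    using assms g by (auto simp: normal_def labellings_iff)
  from labellings_glue_labelling[OF assms(1,2) this] show ?thesis
    by (simp add: glue_labelling_def labellings_iff)
qed

text \<open>Allows a gluing to be computed from any convenient normal labelling; the given labelling
  enters only through a sign.\<close>

lemma signed_iso_id_glue:
  assumes "is_graph G" "gluable G h k" "normal G h k l'" "l \<in> labellings G"
  shows "signed_iso (parity G l \<noteq> parity G l') id id (glue (orient G l) h k) (orient (glued G h k)
    (glue_labelling G h l'))"
proof -
  have l': "l' \<in> labellings G" using assms(3) by (simp add: normal_def)
  from signed_iso_glue[OF signed_iso_id_orient[OF assms(1,4) l'], of h k]
  show ?thesis using assms(1,2,4) by (simp add: glue_orient[OF assms(1-3)])
qed

text \<open>The merged vertex inherits its name from the first half-edge of the pair, so the two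
  graphs differ by the exchange of two vertex names.\<close>

lemma glued_swap_graph_iso:
  assumes "is_graph G" "gluable G h k"
  shows "graph_iso (transpose (vtx G h) (vtx G k)) id (glued G h k) (glued G k h)"
proof -
  note g = gluableD[OF assms]
  have gl: "gluable G k h" using g by (simp add: gluable_def)
  note s = glued_simps[OF assms] and s' = glued_simps[OF assms(1) gl]
  let ?f = "transpose (vtx G h) (vtx G k)"
  have "bij_betw ?f (verts G - {vtx G k}) (verts G - {vtx G h})"
    by (rule bij_betwI[of _ _ _ ?f]) (use g in \<open>auto simp: transpose_def\<close>)
  moreover have "bar (glued G k h) = bar (glued G h k)"
    unfolding s s' using g by (auto simp: fun_eq_iff)
  moreover have "vtx (glued G k h) m = ?f (vtx (glued G h k) m)" for m
    using g(7) by (simp add: s(3) s'(3) transpose_def)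
  ultimately show ?thesis unfolding graph_iso_def by (simp add: s(1,2) s'(1,2) insert_commute)
qed

text \<open>Exchanging \<open>h\<close> and \<open>k\<close> exchanges the vertices numbered 1 and
  2, which is one sign, reverses both edges to be cut, which is none, and gives the surviving edge
  of \<open>bar G h\<close> and \<open>bar G k\<close> the opposite direction, which is one more.
  Altogether X_hk = X_kh.\<close>

lemma signed_iso_glue_swap:
  assumes "gluable (graph_of X) h k"
  shows "signed_iso False (transpose (vtx (graph_of X) h) (vtx (graph_of X) k)) id (glue X h k)
    (glue X k h)"
proof -
  define G where "G = graph_of X"
  have G: "is_graph G" "gluable G h k" using assms by (simp_all add: G_def)
  note g = gluableD[OF this]
  have gl: "gluable G k h" using g by (simp add: gluable_def)
  let ?f = "transpose (vtx G h) (vtx G k)"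
  obtain l where l: "l \<in> orientation_of X" "normal G h k l"
    "glue X h k = orient (glued G h k) (glue_labelling G h l)"
    "glue_labelling G h l \<in> labellings (glued G h k)"
    using glue_normal[of X h k] G unfolding G_def by blast
  obtain r i where li: "l = (vtx G h # vtx G k # r, i)" "l \<in> labellings G" "h \<in> i" "k \<notin> i"
    "glue_labelling G h l = (vtx G h # r, i - {h})" using l(2) by (rule normalE)
  have i: "i \<in> arrows G" and d: "distinct (vtx G h # vtx G k # r)"
    "set (vtx G h # vtx G k # r) = verts G"
    using li by (auto simp: labellings_iff)
  have "bar G k \<in> i" "bar G h \<notin> i" using arrowsD[OF i] li(3,4) g(1,2) by auto
  \<comment> \<open>\<open>i2\<close> arises by reversing the edge of \<open>h\<close> and then the
    edge of \<open>bar G k\<close>, so that \<open>k\<close> is initial and \<open>h\<close> is not,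
    as normality for the exchanged pair requires.\<close>
  define i1 where "i1 = insert (bar G h) (i - {h})"
  define i2 where "i2 = insert (bar G (bar G k)) (i1 - {bar G k})"
  have i1: "i1 \<in> arrows G" "arrow_parity G i1 \<longleftrightarrow> \<not> arrow_parity G i"
    using arrows_flip[OF G(1) i li(3)] by (simp_all add: i1_def)
  have "bar G k \<in> i1" using g(5) \<open>bar G k \<in> i\<close> by (simp add: i1_def)
  then have i2: "i2 \<in> arrows G" "arrow_parity G i2 \<longleftrightarrow> arrow_parity G i"
    using arrows_flip[OF G(1) i1(1)] i1(2) by (simp_all add: i2_def)
  have i2': "i2 = insert k (insert (bar G h) (i - {h, bar G k}))"
    using g by (auto simp: i1_def i2_def)
  let ?l' = "(vtx G k # vtx G h # r, i2)"
  have n': "normal G k h ?l'"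
  proof -
    have "distinct (vtx G k # vtx G h # r)" "set (vtx G k # vtx G h # r) = verts G" using d by auto
    moreover have "k \<in> i2" "h \<notin> i2" using g by (auto simp: i2')
    ultimately show ?thesis using i2(1) by (simp add: normal_def labellings_iff)
  qed
  have "list_parity (vtx G k # vtx G h # r) \<longleftrightarrow> \<not> list_parity (vtx G h # vtx G k # r)"
    using list_parity_move_front[of "[vtx G h]" "vtx G k" r] d by auto
  then have p': "parity G ?l' \<longleftrightarrow> \<not> parity G l" using i2 by (auto simp: parity_iff li(1))
  have lX: "X = orient G l" using orient_orientation_of[OF l(1)] by (simp add: G_def)
  have 1: "signed_iso True id id (glue X k h) (orient (glued G k h) (vtx G k # r, i2 - {k}))"
    using signed_iso_id_glue[OF G(1) gl n' li(2)] p' unfolding lX by (simp add: glue_labelling_def)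
  have "signed_iso False ?f id (glue X h k) (glue X k h)"
  proof -
    obtain m where m: "m \<in> orientation_of (glue X k h)" using some_orientation_of by blast
    have gk: "graph_of (glue X k h) = glued G k h" "is_graph (glued G k h)" "is_graph (glued G h k)"
      using graph_of_glue gl is_graph_glued G by (auto simp: G_def)
    have lab: "(vtx G k # r, i2 - {k}) \<in> labellings (glued G k h)"
      using labellings_glue_labelling[OF G(1) gl n'] by (simp add: glue_labelling_def)
    have Cm: "glue X k h = orient (glued G k h) m" "m \<in> labellings (glued G k h)"
      using orient_orientation_of[OF m] orientation_of_labellings[OF m] gk by simp_all
    have pm: "parity (glued G k h) m \<longleftrightarrow> \<not> parity (glued G k h) (vtx G k # r, i2 - {k})"
      using 1 unfolding Cm(1) using signed_iso_orient[OF gk(2,2) Cm(2) lab] by auto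
    have ml: "map_labelling ?f id (glue_labelling G h l) = (vtx G k # r, i - {h})"
    proof -
      have "map ?f r = r" using d by (intro map_idI) (auto simp: transpose_def)
      then show ?thesis by (simp add: li(5) map_labelling_def)
    qed
    have mlab: "(vtx G k # r, i - {h}) \<in> labellings (glued G k h)"
      using labellings_map_labelling[OF gk(3) glued_swap_graph_iso[OF G] l(4)] unfolding ml .
    have bk: "bar (glued G k h) (bar G k) = bar G h"
      using glued_simps(4)[OF G(1) gl] g by auto
    have "insert (bar (glued G k h) (bar G k)) (i - {h} - {bar G k}) = i2 - {k}"
      using g li(4) by (auto simp: i2' bk)
    then have "parity (glued G k h) (vtx G k # r, i2 - {k})
      \<longleftrightarrow> \<not> parity (glued G k h) (vtx G k # r, i - {h})"
      using arrows_flip(2)[OF gk(2), of "i - {h}" "bar G k"] mlab \<open>bar G k \<in> i\<close> g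
      by (auto simp: labellings_iff parity_iff)
    then have "(parity (glued G k h) (map_labelling ?f id (glue_labelling G h l)) \<noteq> parity
      (glued G k h) m) = False"
      unfolding ml pm by simp
    then show ?thesis unfolding l(3) Cm(1)
      using signed_iso_orient[OF gk(3,2) l(4) Cm(2)] glued_swap_graph_iso[OF G] by blast
  qed
  then show ?thesis by (simp add: G_def)
qed

lemma glue_class_swap:
  assumes "h \<in> halves (graph_of X)" "k \<in> halves (graph_of X)" "k \<noteq> bar (graph_of X) h"
  shows "glue_class X h k = (glue_class X k h :: 'k::field_char_0 graph_space)"
proof (cases "vtx (graph_of X) h = vtx (graph_of X) k")
  case True then show ?thesis by (simp add: glue_class_eq)
next
  case False
  then have "gluable (graph_of X) h k" using assms by (simp add: gluable_def)
  from signed_iso_graph_class[OF signed_iso_glue_swap[OF this], where ?'k = 'k] show ?thesis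
    using False by (simp add: glue_class_eq)
qed

lemma glue_class_glue_swap:
  assumes "gluable (graph_of X) h k"
    "a \<in> halves (graph_of (glue X h k))" "b \<in> halves (graph_of (glue X h k))"
      "b \<noteq> bar (graph_of (glue X h k)) a"
  shows "glue_class (glue X h k) a b
    = (glue_class (glue X k h) a b :: 'k::field_char_0 graph_space)"
  using signed_iso_glue_class[OF signed_iso_glue_swap[OF assms(1)] assms(2-4), where ?'k = 'k]
    by simp

section \<open>Two successive gluings anticommute\<close>

text \<open>
  The case \<open>b = bar G h\<close>, in which the second gluing cuts an edge created by the first, is allowed.
\<close>

lemma glued_commute:
  assumes "is_graph G" "gluable G h k" "gluable G b a" "gluable (glued G h k) b a"
    "gluable (glued G b a) h k"
    and "a \<noteq> bar G h" "b \<noteq> bar G k" "a \<noteq> bar G k" "vtx G h \<noteq> vtx G a" "vtx G b \<noteq> vtx G k"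
      "vtx G k \<noteq> vtx G a"
  shows "glued (glued G h k) b a = glued (glued G b a) h k"
proof -
  note g = gluableD[OF assms(1,2)] and g' = gluableD[OF assms(1,3)]
  have H: "is_graph (glued G h k)" "is_graph (glued G b a)" using is_graph_glued assms(1-3) by auto
  note s1 = glued_simps[OF assms(1,2)] and s2 = glued_simps[OF assms(1,3)]
    and s3 = glued_simps[OF H(1) assms(4)] and s4 = glued_simps[OF H(2) assms(5)]
  have d: "b \<notin> {h, k}" "a \<notin> {h, k}"
    using assms(4) by (auto simp: gluable_def s1)
  have bb: "bar G a \<noteq> h" "bar G a \<noteq> k" "bar G b \<noteq> k" "bar G h \<noteq> bar G b" "bar G h \<noteq> bar G a"
    "bar G k \<noteq> bar G b" "bar G k \<noteq> bar G a" "bar G b = h \<longleftrightarrow> b = bar G h"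
    using g g' d assms(6-8) by (metis insert_iff)+
  have "bar (glued (glued G h k) b a) = bar (glued (glued G b a) h k)"
  proof (cases "b = bar G h")
    case True
    then have "bar G b = h" using g by simp
    then show ?thesis unfolding s3 s4 unfolding s1 s2
      using True g g' d bb assms(6-8) by (auto simp: fun_eq_iff)
  next
    case False
    then show ?thesis unfolding s3 s4 unfolding s1 s2
      using g g' d bb assms(6-8) by (auto simp: fun_eq_iff)
  qed
  moreover have "verts (glued (glued G h k) b a) = verts (glued (glued G b a) h k)"
    unfolding s3 s4 unfolding s1 s2 using assms(9-11) by auto
  moreover have "halves (glued (glued G h k) b a) = halves (glued (glued G b a) h k)"
    unfolding s3 s4 unfolding s1 s2 by auto
  moreover have "vtx (glued (glued G h k) b a) = vtx (glued (glued G b a) h k)"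
    unfolding s3 s4 unfolding s1 s2 using assms(9-11) by (auto simp: fun_eq_iff)
  ultimately show ?thesis by simp
qed

text \<open>Here all four letters are vertices. The lists for the first collapse use
  \<open>p\<close> in one order of the gluings and \<open>q\<close> in the other; those for the
  second use \<open>p'\<close> and \<open>q'\<close>. The four comparisons concern the two starting
  lists, the transition between the collapses in either order, and the two final lists. Their total
  is the sign of the anticommutation.\<close>

lemma vertex_chain:
  assumes "finite V" "h \<in> V" "k \<in> V" "b \<in> V" "a \<in> V" "h \<noteq> k" "b \<noteq> a" "h \<noteq> a" "b \<noteq> k" "k \<noteq> a"
  obtains p q p' q' where
    "distinct (h # k # p)" "set (h # k # p) = V" "distinct (b # a # q)" "set (b # a # q) = V"
    "distinct (b # a # p')" "set (b # a # p') = V - {k}" "distinct (h # k # q')"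
      "set (h # k # q') = V - {a}"
    "((list_parity (h # k # p) \<noteq> list_parity (b # a # q)) \<noteq> (list_parity (h # p) \<noteq> list_parity
      (b # a # p'))) \<noteq>
     ((list_parity (b # q) \<noteq> list_parity (h # k # q')) \<noteq> (list_parity (b # p') \<noteq> list_parity
       (h # q')))"
proof (cases "h = b")
  case True
  \<comment> \<open>Both half-edges of the hub begin at one vertex. The starting lists differ by the
    exchange of \<open>k\<close> and \<open>a\<close>, and the other three comparisons are between
    equal lists.\<close>
  obtain r where r: "distinct r" "set r = V - {h, k, a}"
    using finite_distinct_list[of "V - {h, k, a}"] assms(1) by auto
  have "list_parity (b # k # a # r) \<longleftrightarrow> \<not> list_parity (b # a # k # r)"
    using list_parity_move_front[of "[b, k]" a r] list_parity_move_front[of "[b]" k r]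
      list_parity_move_front[of "[a, b]" k r] list_parity_move_front[of "[a]" b "k # r"] r assms
        True by auto
  then show thesis
    using that[of "a # r" "k # r" r r] r assms True by auto
next
  case False
  \<comment> \<open>With two hub vertices the first three comparisons move vertices past pairs of
    vertices and are even. The sign comes from the final lists, where the merged vertices
    \<open>h\<close> and \<open>b\<close> occupy the first two places in opposite order.\<close>
  obtain r where r: "distinct r" "set r = V - {h, k, a, b}"
    using finite_distinct_list[of "V - {h, k, a, b}"] assms(1) by auto
  have "list_parity (h # k # b # a # r) \<longleftrightarrow> list_parity (b # a # h # k # r)"
    using list_parity_move_front[of "[h, k, b]" a r] list_parity_move_front[of "[a, h, k]" b r]
      list_parity_move_front[of "[b]" a "h # k # r"] r assms False by auto
  moreover have "list_parity (h # b # a # r) \<longleftrightarrow> list_parity (b # a # h # r)"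
    using list_parity_move_front[of "[b, a]" h r] r assms False by auto
  moreover have "list_parity (b # h # k # r) \<longleftrightarrow> list_parity (h # k # b # r)"
    using list_parity_move_front[of "[h, k]" b r] r assms False by auto
  moreover have "list_parity (b # h # r) \<longleftrightarrow> \<not> list_parity (h # b # r)"
    using list_parity_move_front[of "[b]" h r] r assms False by auto
  ultimately show thesis
    using that[of "b # a # r" "h # k # r" "h # r" "b # r"] r assms False by auto
qed

text \<open>The arrows contribute no sign. If the hub half-edges lie in different edges, one arrow
  set serves both orders. If \<open>b = bar G h\<close>, they cannot both be initial; then all four
  comparisons are odd, and they cancel.\<close>

lemma arrows_chain:
  assumes "is_graph G" "gluable G h k" "gluable G b a" "gluable (glued G h k) b a"
    "gluable (glued G b a) h k"
    and "a \<noteq> bar G h" "b \<noteq> bar G k" "a \<noteq> bar G k" "vtx G h \<noteq> vtx G a" "vtx G b \<noteq> vtx G k"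
      "vtx G k \<noteq> vtx G a"
    and "arrows G \<noteq> {}"
  obtains i i' j j' where
    "i \<in> arrows G" "h \<in> i" "k \<notin> i" "i' \<in> arrows G" "b \<in> i'" "a \<notin> i'"
    "j \<in> arrows (glued G h k)" "b \<in> j" "a \<notin> j" "j' \<in> arrows (glued G b a)" "h \<in> j'" "k \<notin> j'"
    "((arrow_parity G i \<noteq> arrow_parity G i') \<noteq> (arrow_parity (glued G h k) (i - {h}) \<noteq> arrow_parity
      (glued G h k) j)) =
     ((arrow_parity (glued G b a) (i' - {b}) \<noteq> arrow_parity (glued G b a) j') \<noteq>
      (arrow_parity (glued (glued G h k) b a) (j - {b}) \<noteq> arrow_parity (glued (glued G h k) b a)
        (j' - {h})))"
proof -
  note g = gluableD[OF assms(1,2)] and g' = gluableD[OF assms(1,3)]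
  let ?H = "glued G h k" and ?H' = "glued G b a" and ?K = "glued (glued G h k) b a"
  have H: "is_graph ?H" "is_graph ?H'" using is_graph_glued assms(1-3) by auto
  have K: "is_graph ?K" using is_graph_glued[OF H(1) assms(4)] .
  have Keq: "glued ?H' h k = ?K" using glued_commute[OF assms(1-11)] by simp
  note s1 = glued_simps[OF assms(1,2)] and s2 = glued_simps[OF assms(1,3)]
  have d: "b \<noteq> h" "b \<noteq> k" "a \<noteq> h" "a \<noteq> k"
    using assms(4) by (auto simp: gluable_def s1)
  have bb: "bar G a \<noteq> h" "bar G a \<noteq> k" "bar G b \<noteq> k" "bar G h \<noteq> bar G b" "bar G h \<noteq> bar G a"
    "bar G k \<noteq> bar G b" "bar G k \<noteq> bar G a"
    using g g' d assms(6-8) by metis+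
  obtain i0 where i0: "i0 \<in> arrows G" using assms(12) by blast
  \<comment> \<open>Makes \<open>h\<close>, \<open>bar G k\<close> and \<open>bar G a\<close>
    initial. The arrow at \<open>b\<close> is left to the case distinction, since it may be tied to
    that at \<open>h\<close>.\<close>
  define i1 where "i1 = insert h (insert (bar G k) (insert (bar G a) (i0 - {a}) - {k}) - {bar G h})"
  have i1: "i1 \<in> arrows G"
    using arrows_force[OF assms(1) arrows_force[OF assms(1) arrows_force[OF assms(1) i0 g'(13)]
      g(13)] g(1)]
    unfolding i1_def g(11) g'(11) .
  have i1h: "h \<in> i1" "k \<notin> i1" "a \<notin> i1" "bar G k \<in> i1" "bar G a \<in> i1" "bar G h \<notin> i1"
    using g g' d bb assms(6-8) by (auto simp: i1_def)
  show thesis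
  proof (cases "b = bar G h")
    case False
    define i where "i = insert b (i1 - {bar G b})"
    have "bar G b \<noteq> h" using False g' by metis
    then have i: "i \<in> arrows G" "h \<in> i" "k \<notin> i" "a \<notin> i" "b \<in> i"
      using arrows_force[OF assms(1) i1 g'(1)] i1h g' d bb by (auto simp: i_def)
    have "i - {h} - {b} = i - {b} - {h}" by auto
    then show thesis
      using that[of i i "i - {h}" "i - {b}"] i d arrows_collapse[OF assms(1,2) i(1-3)]
        arrows_collapse[OF assms(1,3) i(1,5,4)] by simp
  next
    case True
    then have hb: "bar G b = h" using g by simp
    \<comment> \<open>Each of the four comparisons is now the reversal of a single edge:
      \<open>{h, b}\<close> in \<open>G\<close>, \<open>{b, bar G k}\<close> in \<open>?H\<close>,
      \<open>{h, bar G a}\<close> in \<open>?H'\<close>, and \<open>{bar G a, bar G k}\<close> in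
      \<open>?K\<close>.\<close>
    define i' where "i' = insert b (i1 - {h})"
    have i': "i' \<in> arrows G" "arrow_parity G i' \<longleftrightarrow> \<not> arrow_parity G i1"
      using arrows_flip[OF assms(1) i1 i1h(1)] by (simp_all add: i'_def True)
    have c1: "i1 - {h} \<in> arrows ?H" using arrows_collapse[OF assms(1,2) i1 i1h(1,2)] .
    define j where "j = insert b (i1 - {h} - {bar G k})"
    have "bar ?H (bar G k) = b" using g True by (simp add: s1)
    then have j: "j \<in> arrows ?H" "arrow_parity ?H j \<longleftrightarrow> \<not> arrow_parity ?H (i1 - {h})"
      using arrows_flip[OF H(1) c1, of "bar G k"] i1h g by (simp_all add: j_def)
    have i'b: "i' - {b} = i1 - {h}" using i1h True by (auto simp: i'_def)
    have c2: "i1 - {h} \<in> arrows ?H'"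
      using arrows_collapse[OF assms(1,3) i'(1)] d i1h g'(3)
        by (auto simp: i'b) (simp_all add: i'_def)
    define j' where "j' = insert h (i1 - {h} - {bar G a})"
    have "bar ?H' (bar G a) = h" using g' hb by (simp add: s2)
    then have j': "j' \<in> arrows ?H'" "arrow_parity ?H' j' \<longleftrightarrow> \<not> arrow_parity ?H' (i1 - {h})"
      using arrows_flip[OF H(2) c2, of "bar G a"] i1h bb by (simp_all add: j'_def)
    have jb: "j - {b} = i1 - {h} - {bar G k}" using i1h True by (auto simp: j_def)
    have jh: "j' - {h} = i1 - {h} - {bar G a}" by (auto simp: j'_def)
    have jm: "b \<in> j" "a \<notin> j" "h \<in> j'" "k \<notin> j'"
      using i1h d g'(3) g(3) by (auto simp: j_def j'_def)
    have jK: "j - {b} \<in> arrows ?K" using arrows_collapse[OF H(1) assms(4) j(1) jm(1,2)] .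
    have "bar ?K (bar G a) = bar G k"
    proof -
      note s3 = glued_simps(4)[OF H(1) assms(4)]
      have "bar ?H b = bar G k" using True g d by (simp add: s1)
      moreover have "bar ?H a = bar G a" using d assms(6,8) by (simp add: s1)
      ultimately show ?thesis using g' bb d by (simp add: s3)
    qed
    moreover have "insert (bar G k) (j - {b} - {bar G a}) = j' - {h}"
      using i1h g bb by (auto simp: jb jh)
    ultimately have "arrow_parity ?K (j' - {h}) \<longleftrightarrow> \<not> arrow_parity ?K (j - {b})"
      using arrows_flip(2)[OF K jK, of "bar G a"] i1h bb by (simp add: jb)
    then show thesis
      using that[of i1 i' j j'] i1 i1h i' j j' jm g'(3) by (simp add: i'b) (simp add: i'_def)
  qed
qed

text \<open>The double gluings are literally the same graph, because in either order the merged
  vertices carry the names of the hub vertices. Both classes are compared with \<open>T\<close>; the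
  vertex lists give the factor -1 and the arrows none.\<close>

lemma glue_class_anticommute:
  assumes "gluable (graph_of X) h k" "gluable (graph_of X) b a"
    "h \<noteq> b" "k \<noteq> a" "h \<noteq> a" "b \<noteq> k"
    "a \<noteq> bar (graph_of X) h" "b \<noteq> bar (graph_of X) k" "a \<noteq> bar (graph_of X) k"
    "vtx (graph_of X) h \<noteq> vtx (graph_of X) a" "vtx (graph_of X) b \<noteq> vtx (graph_of X) k"
    "vtx (graph_of X) k \<noteq> vtx (graph_of X) a"
  shows "glue_class (glue X b a) h k
    = - (glue_class (glue X h k) b a :: 'k::field_char_0 graph_space)"
proof -
  obtain G l where X: "X = orient G l" "is_graph G" "l \<in> labellings G" by (cases X)
  have A: "gluable G h k" "gluable G b a" "a \<noteq> bar G h" "b \<noteq> bar G k" "a \<noteq> bar G k"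
    "vtx G h \<noteq> vtx G a" "vtx G b \<noteq> vtx G k" "vtx G k \<noteq> vtx G a"
    using assms X by simp_all
  note g = gluableD[OF X(2) A(1)] and g' = gluableD[OF X(2) A(2)]
  note s1 = glued_simps[OF X(2) A(1)] and s2 = glued_simps[OF X(2) A(2)]
  let ?H = "glued G h k" and ?H' = "glued G b a" and ?K = "glued (glued G h k) b a"
  have gl1: "gluable ?H b a"
    using A g g' assms(3-6) by (auto simp: gluable_def s1)
  have gl2: "gluable ?H' h k"
    using A g g' assms(3-6) by (auto simp: gluable_def s2)
  have H: "is_graph ?H" "is_graph ?H'" using is_graph_glued X A by auto
  have K: "is_graph ?K" using is_graph_glued[OF H(1) gl1] .
  have Keq: "glued ?H' h k = ?K" using glued_commute[OF X(2) A(1,2) gl1 gl2 A(3-8)] by simp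
  obtain vs0 i0 where "l = (vs0, i0)" by fastforce
  then have ne: "arrows G \<noteq> {}" using X by (auto simp: labellings_iff)
  obtain i i' j j' where ar:
    "i \<in> arrows G" "h \<in> i" "k \<notin> i" "i' \<in> arrows G" "b \<in> i'" "a \<notin> i'"
    "j \<in> arrows ?H" "b \<in> j" "a \<notin> j" "j' \<in> arrows ?H'" "h \<in> j'" "k \<notin> j'"
    and ap: "((arrow_parity G i \<noteq> arrow_parity G i') \<noteq> (arrow_parity ?H (i - {h})
      \<noteq> arrow_parity ?H j)) =
     ((arrow_parity ?H' (i' - {b}) \<noteq> arrow_parity ?H' j') \<noteq> (arrow_parity ?K (j - {b})
       \<noteq> arrow_parity ?K (j' - {h})))"
    by (rule arrows_chain[OF X(2) A(1,2) gl1 gl2 A(3-8) ne])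
  obtain p q p' q' where vs: "distinct (vtx G h # vtx G k # p)"
    "set (vtx G h # vtx G k # p) = verts G"
    "distinct (vtx G b # vtx G a # q)" "set (vtx G b # vtx G a # q) = verts G"
    "distinct (vtx G b # vtx G a # p')" "set (vtx G b # vtx G a # p') = verts G - {vtx G k}"
    "distinct (vtx G h # vtx G k # q')" "set (vtx G h # vtx G k # q') = verts G - {vtx G a}"
    and vp: "((list_parity (vtx G h # vtx G k # p) \<noteq> list_parity (vtx G b # vtx G a # q)) \<noteq>
      (list_parity (vtx G h # p) \<noteq> list_parity (vtx G b # vtx G a # p'))) \<noteq>
     ((list_parity (vtx G b # q) \<noteq> list_parity (vtx G h # vtx G k # q')) \<noteq> (list_parity
       (vtx G b # p') \<noteq> list_parity (vtx G h # q')))"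
    by (rule vertex_chain[OF graph_finite(1)[OF X(2)] g(14,15) g'(14,15) g(7) g'(7) A(6-8)])
  let ?l = "(vtx G h # vtx G k # p, i)" and ?l' = "(vtx G b # vtx G a # q, i')"
  let ?m = "(vtx G h # p, i - {h})" and ?m' = "(vtx G b # vtx G a # p', j)"
  let ?n = "(vtx G b # q, i' - {b})" and ?n' = "(vtx G h # vtx G k # q', j')"
  have v1: "vtx ?H b = vtx G b" "vtx ?H a = vtx G a" and v2: "vtx ?H' h = vtx G h"
    "vtx ?H' k = vtx G k"
    using A g g' by (simp_all add: s1 s2)
  have N: "normal G h k ?l" "normal G b a ?l'" using ar vs
    by (simp_all add: normal_def labellings_iff)
  have N1: "normal ?H b a ?m'" using ar vs A(7,8) by (simp add: normal_def labellings_iff v1 s1)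
  have N2: "normal ?H' h k ?n'" using ar vs A(6,8) by (simp add: normal_def labellings_iff v2 s2)
  have ct: "glue_labelling G h ?l = ?m" "glue_labelling G b ?l' = ?n"
    "glue_labelling ?H b ?m' = (vtx G b # p', j - {b})"
    "glue_labelling ?H' h ?n' = (vtx G h # q', j' - {h})"
    by (simp_all add: glue_labelling_def v1 v2)
  have L: "?m \<in> labellings ?H" "?n \<in> labellings ?H'" "(vtx G b # p', j - {b}) \<in> labellings ?K"
    "(vtx G h # q', j' - {h}) \<in> labellings ?K"
    using labellings_glue_labelling[OF X(2) A(1) N(1)] labellings_glue_labelling[OF X(2) A(2) N(2)]
      labellings_glue_labelling[OF H(1) gl1 N1] labellings_glue_labelling[OF H(2) gl2 N2]
        by (simp_all add: ct Keq)
  define T where "T = (graph_class (orient ?K (vtx G b # p', j - {b})) :: 'k graph_space)"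
  \<comment> \<open>The orientation of \<open>X\<close> is replaced by that of the convenient
    labelling. This multiplies both sides of the claim by the same sign \<open>s\<close>, which is
    put back at the end.\<close>
  let ?Y = "orient G ?l"
  have Y: "?l \<in> labellings G" "?l' \<in> labellings G" using N by (simp_all add: normal_def)
  have halvesH: "b \<in> halves ?H" "a \<in> halves ?H" "a \<noteq> bar ?H b" "h \<in> halves ?H'" "k \<in> halves ?H'"
    "k \<noteq> bar ?H' h"
    using gl1 gl2 by (auto simp: gluable_def)
  have t1: "glue_class (glue ?Y h k) b a = signed (parity ?H ?m \<noteq> parity ?H ?m') T"
  proof -
    have "glue_class (glue ?Y h k) b a = (graph_class (glue (orient ?H ?m) b a) :: 'k graph_space)"
      using glue_orient[OF X(2) A(1) N(1)] gl1 L H by (simp add: glue_class_gluable ct)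
    moreover have "T = signed (parity ?H ?m \<noteq> parity ?H ?m') (graph_class (glue
      (orient ?H ?m) b a))"
      using signed_iso_graph_class[OF signed_iso_id_glue[OF H(1) gl1 N1 L(1)], where ?'k = 'k]
        by (simp add: T_def ct)
    ultimately show ?thesis by simp
  qed
  have t2: "glue_class (glue ?Y b a) h k
    = signed (((parity G ?l \<noteq> parity G ?l') \<noteq> (parity ?H' ?n \<noteq> parity ?H' ?n')) \<noteq>
      (parity ?K (vtx G b # p', j - {b}) \<noteq> parity ?K (vtx G h # q', j' - {h}))) T"
  proof -
    have gY: "graph_of (glue ?Y b a) = ?H'" using graph_of_glue[of ?Y b a] A Y X by simp
    have "glue_class (orient ?H' ?n) h k
      = signed (parity G ?l \<noteq> parity G ?l') (glue_class (glue ?Y b a) h k :: 'k graph_space)"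
      using signed_iso_glue_class[OF signed_iso_id_glue[OF X(2) A(2) N(2) Y(1)], of h k, where ?'k =
        'k] halvesH by (simp add: gY ct)
    moreover have "glue_class (orient ?H' ?n) h k
      = (graph_class (glue (orient ?H' ?n) h k) :: 'k graph_space)"
      using gl2 L H by (simp add: glue_class_gluable)
    moreover have "graph_class (orient ?K (vtx G h # q', j' - {h}))
      = signed (parity ?H' ?n \<noteq> parity ?H' ?n') (graph_class (glue
      (orient ?H' ?n) h k) :: 'k graph_space)"
      using signed_iso_graph_class[OF signed_iso_id_glue[OF H(2) gl2 N2 L(2)], where ?'k = 'k]
        by (simp add: ct Keq)
    moreover have "graph_class (orient ?K (vtx G h # q', j' - {h}))
      = signed (parity ?K (vtx G b # p', j - {b}) \<noteq> parity ?K (vtx G h # q', j' - {h})) T"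
      using signed_iso_graph_class[OF signed_iso_id_orient[OF K L(3,4)], where ?'k = 'k]
        by (simp add: T_def)
    ultimately show ?thesis by (auto simp: signed_def split: if_splits)
  qed
  have ppar: "(((parity G ?l \<noteq> parity G ?l') \<noteq> (parity ?H' ?n \<noteq> parity ?H' ?n')) \<noteq>
      (parity ?K (vtx G b # p', j - {b}) \<noteq> parity ?K (vtx G h # q', j' - {h}))) \<noteq> (parity ?H ?m
        \<noteq> parity ?H ?m')"
    using ap vp unfolding parity_iff by argo
  then have ty: "glue_class (glue ?Y b a) h k = - (glue_class (glue ?Y h k) b a :: 'k graph_space)"
    unfolding t1 t2 by (auto simp: signed_def)
  obtain s where s: "signed_iso s id id ?Y X" using signed_iso_id_orient[OF X(2) Y(1) X(3)] X(1)
    by blast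
  have gY: "graph_of (glue ?Y h k) = ?H" "graph_of (glue ?Y b a) = ?H'" "graph_of ?Y = G"
    using graph_of_glue[of ?Y h k] graph_of_glue[of ?Y b a] A Y X by simp_all
  have "glue_class (glue X h k) b a = signed s (glue_class (glue ?Y h k) b a :: 'k graph_space)"
    using signed_iso_glue_class[OF signed_iso_glue[OF s], of h k b a, where ?'k = 'k] A halvesH
      by (simp add: gY)
  moreover have "glue_class (glue X b a) h k
    = signed s (glue_class (glue ?Y b a) h k :: 'k graph_space)"
    using signed_iso_glue_class[OF signed_iso_glue[OF s], of b a h k, where ?'k = 'k] A halvesH
      by (simp add: gY)
  ultimately show ?thesis using ty by simp
qed

section \<open>Products\<close>

lemma even_odd_images:
  "2 * a \<noteq> 2 * b + (1::nat)" "2 * b + (1::nat) \<noteq> 2 * a" "2 * a \<noteq> Suc (2 * b)" "Suc (2 * b) \<noteq> 2 * a"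
  by presburger+

lemma union_simps:
  "verts (union_graph G H) = (\<lambda>v. 2 * v) ` verts G \<union> (\<lambda>v. 2 * v + 1) ` verts H"
  "halves (union_graph G H) = (\<lambda>v. 2 * v) ` halves G \<union> (\<lambda>v. 2 * v + 1) ` halves H"
  "vtx (union_graph G H) (2 * h) = 2 * vtx G h"
    "vtx (union_graph G H) (2 * h + 1) = 2 * vtx H h + 1"
  "bar (union_graph G H) (2 * h) = 2 * bar G h"
    "bar (union_graph G H) (2 * h + 1) = 2 * bar H h + 1"
  by (simp_all add: union_graph_def)

lemma is_graph_union:
  assumes "is_graph G" "is_graph H"
  shows "is_graph (union_graph G H)"
proof -
  let ?U = "union_graph G H"
  have A: "{h \<in> halves ?U. vtx ?U h = 2 * v} = (\<lambda>v. 2 * v) ` {h \<in> halves G. vtx G h = v}" for v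
    by (auto simp: union_simps even_odd_images simp del: add_Suc_right One_nat_def)
  have B: "{h \<in> halves ?U. vtx ?U h = 2 * v + 1} = (\<lambda>v. 2 * v + 1) ` {h \<in> halves H. vtx H h = v}"
    for v
    by (auto simp: union_simps even_odd_images simp del: add_Suc_right One_nat_def)
  have "3 \<le> card {h \<in> halves ?U. vtx ?U h = v}" if "v \<in> verts ?U" for v
  proof -
    from that consider w where "v = 2 * w" "w \<in> verts G" | w where "v = 2 * w + 1" "w \<in> verts H"
      by (auto simp: union_simps(1))
    then show ?thesis
    proof cases
      case 1
      have "card {h \<in> halves ?U. vtx ?U h = v} = card {h \<in> halves G. vtx G h = w}"
        unfolding 1(1) A by (intro card_image) (auto simp: inj_on_def)
      then show ?thesis using assms(1) 1 by (simp add: is_graph_def)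
    next
      case 2
      have "card {h \<in> halves ?U. vtx ?U h = v} = card {h \<in> halves H. vtx H h = w}"
        unfolding 2(1) B by (intro card_image) (auto simp: inj_on_def)
      then show ?thesis using assms(2) 2 by (simp add: is_graph_def)
    qed
  qed
  moreover have "vtx ?U h \<in> verts ?U \<and> bar ?U h \<in> halves ?U \<and> bar ?U h \<noteq> h \<and> bar ?U (bar ?U h) = h"
    if "h \<in> halves ?U" for h
  proof -
    from that consider w where "h = 2 * w" "w \<in> halves G" | w where "h = 2 * w + 1" "w \<in> halves H"
      by (auto simp: union_simps(2))
    then show ?thesis
    proof cases
      case 1
      then show ?thesis using graphD[OF assms(1) 1(2)] unfolding 1(1) union_simps(3,5)
        by (simp add: union_simps)
    next
      case 2
      then show ?thesis using graphD[OF assms(2) 2(2)] unfolding 2(1) union_simps(4,6)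
        by (simp add: union_simps(1,2))
    qed
  qed
  ultimately show ?thesis
    using graph_finite[OF assms(1)] graph_finite[OF assms(2)]
      by (simp add: is_graph_def union_simps(1,2))
qed

lemma arrows_union:
  assumes "i \<in> arrows G" "j \<in> arrows H"
  shows "(\<lambda>h. 2 * h) ` i \<union> (\<lambda>h. 2 * h + 1) ` j \<in> arrows (union_graph G H)"
proof -
  let ?I = "(\<lambda>h. 2 * h) ` i \<union> (\<lambda>h. 2 * h + 1) ` j"
  have e: "2 * h \<in> ?I \<longleftrightarrow> h \<in> i" "2 * h + 1 \<in> ?I \<longleftrightarrow> h \<in> j" for h
    by (auto simp: even_odd_images)
  have "h \<in> ?I \<longleftrightarrow> bar (union_graph G H) h \<notin> ?I" if h: "h \<in> halves (union_graph G H)" for h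
  proof -
    from h consider w where "h = 2 * w" "w \<in> halves G" | w where "h = 2 * w + 1" "w \<in> halves H"
      by (auto simp: union_simps(2))
    then show ?thesis
    proof cases
      case 1
      show ?thesis unfolding 1(1) union_simps(5) e using arrowsD[OF assms(1) 1(2)] by blast
    next
      case 2
      show ?thesis unfolding 2(1) union_simps(6) e using arrowsD[OF assms(2) 2(2)] by blast
    qed
  qed
  moreover have "?I \<subseteq> halves (union_graph G H)"
    unfolding union_simps(2) using assms by (intro Un_mono image_mono) (simp_all add: arrows_def)
  ultimately show ?thesis unfolding arrows_def by blast
qed

lemma labellings_union:
  assumes "l \<in> labellings G" "m \<in> labellings H"
  shows "union_labelling l m \<in> labellings (union_graph G H)"
proof -
  obtain vs i ws j where lm: "l = (vs, i)" "m = (ws, j)" by fastforce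
  have "distinct (map (\<lambda>v. 2 * v) vs @ map (\<lambda>v. 2 * v + 1) ws)"
    using assms by (auto simp: lm labellings_iff distinct_map inj_on_def even_odd_images)
  moreover have "set (map (\<lambda>v. 2 * v) vs @ map (\<lambda>v. 2 * v + 1) ws) = verts (union_graph G H)"
    using assms by (simp add: lm labellings_iff union_simps(1))
  ultimately show ?thesis
    using assms arrows_union unfolding lm union_labelling_def fst_conv snd_conv labellings_iff
      by blast
qed

lemma moves_union_left:
  assumes "(l, l') \<in> moves G" "m \<in> labellings H"
  shows "(union_labelling l m, union_labelling l' m) \<in> moves (union_graph G H)"
  using assms(1)
proof (cases rule: moves_cases)
  case (reverse_arrow vs i h)
  let ?I = "(\<lambda>h. 2 * h) ` i \<union> (\<lambda>h. 2 * h + 1) ` snd m"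
  have "insert (2 * bar G h) (?I - {2 * h})
    = (\<lambda>h. 2 * h) ` insert (bar G h) (i - {h}) \<union> (\<lambda>h. 2 * h + 1) ` snd m"
    by (auto simp: even_odd_images)
  then have "union_labelling l' m = (fst (union_labelling l m),
      insert (bar (union_graph G H) (2 * h)) (snd (union_labelling l m) - {2 * h}))"
    by (simp add: reverse_arrow(1,2) union_labelling_def union_simps(5))
  moreover have "2 * h \<in> snd (union_labelling l m)"
    using reverse_arrow by (simp add: union_labelling_def)
  ultimately show ?thesis
    using labellings_union[OF reverse_arrow(3) assms(2)]
      by (metis moves.reverse_arrow prod.collapse)
next
  case (switch_numbers vs i v w)
  have "map (transpose (2 * v) (2 * w)) (fst (union_labelling l m)) = fst (union_labelling l' m)"
    by (auto simp: switch_numbers(1,2) union_labelling_def transpose_def even_odd_images)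
  moreover have "snd (union_labelling l' m) = snd (union_labelling l m)"
    by (simp add: switch_numbers(1,2) union_labelling_def)
  moreover have "2 * v \<in> verts (union_graph G H)" "2 * w \<in> verts (union_graph G H)" "2 * v \<noteq> 2 * w"
    using switch_numbers by (auto simp: union_simps(1))
  ultimately show ?thesis
    using labellings_union[OF switch_numbers(3) assms(2)]
      by (metis moves.switch_numbers prod.collapse)
qed

lemma moves_union_right:
  assumes "(m, m') \<in> moves H" "l \<in> labellings G"
  shows "(union_labelling l m, union_labelling l m') \<in> moves (union_graph G H)"
  using assms(1)
proof (cases rule: moves_cases)
  case (reverse_arrow vs i h)
  let ?I = "(\<lambda>h. 2 * h) ` snd l \<union> (\<lambda>h. 2 * h + 1) ` i"
  have "insert (2 * bar H h + 1) (?I - {2 * h + 1})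
    = (\<lambda>h. 2 * h) ` snd l \<union> (\<lambda>h. 2 * h + 1) ` insert (bar H h) (i - {h})"
    by (auto simp: even_odd_images)
  then have "union_labelling l m' = (fst (union_labelling l m),
      insert (bar (union_graph G H) (2 * h + 1)) (snd (union_labelling l m) - {2 * h + 1}))"
    by (simp only: reverse_arrow(1,2) union_labelling_def union_simps(6) fst_conv snd_conv)
  moreover have "2 * h + 1 \<in> snd (union_labelling l m)"
    using reverse_arrow by (simp add: union_labelling_def)
  ultimately show ?thesis
    using labellings_union[OF assms(2) reverse_arrow(3)]
      by (metis moves.reverse_arrow prod.collapse)
next
  case (switch_numbers vs i v w)
  have "map (transpose (2 * v + 1) (2 * w + 1)) (fst (union_labelling l m))
    = fst (union_labelling l m')"
    by (auto simp: switch_numbers(1,2) union_labelling_def transpose_def even_odd_images)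
  moreover have "snd (union_labelling l m') = snd (union_labelling l m)"
    by (simp add: switch_numbers(1,2) union_labelling_def)
  moreover have "2 * v + 1 \<in> verts (union_graph G H)" "2 * w + 1 \<in> verts (union_graph G H)"
    "2 * v + 1 \<noteq> 2 * w + 1"
    using switch_numbers by (auto simp: union_simps(1))
  ultimately show ?thesis
    using labellings_union[OF assms(2) switch_numbers(3)]
      by (metis moves.switch_numbers prod.collapse)
qed

text \<open>One labelling is changed at a time; with the other one fixed, the union sends moves to
  moves.\<close>

lemma parity_union:
  assumes "is_graph G" "is_graph H" "l \<in> labellings G" "l' \<in> labellings G" "m \<in> labellings H"
    "m' \<in> labellings H"
  shows "parity (union_graph G H) (union_labelling l m)
    = parity (union_graph G H) (union_labelling l' m') \<longleftrightarrow>
    (parity G l = parity G l') = (parity H m = parity H m')"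
proof -
  note U = is_graph_union[OF assms(1,2)]
  have "parity (union_graph G H) (union_labelling l m)
    = parity (union_graph G H) (union_labelling l' m) \<longleftrightarrow>
      parity G l = parity G l'"
    using assms labellings_union moves_union_left
    by (intro parity_transport[where \<phi> = "\<lambda>l. union_labelling l m", OF assms(1) U]) auto
  moreover have "parity (union_graph G H) (union_labelling l' m)
    = parity (union_graph G H) (union_labelling l' m') \<longleftrightarrow>
      parity H m = parity H m'"
    using assms labellings_union moves_union_right
    by (intro parity_transport[where \<phi> = "union_labelling l'", OF assms(2) U]) auto
  ultimately show ?thesis by argo
qed

lemma oprod_orient:
  assumes "is_graph G" "is_graph H" "l \<in> labellings G" "m \<in> labellings H"
  shows "oprod (orient G l) (orient H m) = orient (union_graph G H) (union_labelling l m)"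
proof -
  obtain l' m' where e: "(SOME l'. l' \<in> orientation_of (orient G l)) = l'"
    "(SOME m'. m' \<in> orientation_of (orient H m)) = m'"
    by blast
  then have lm: "l' \<in> labellings G" "parity G l' = parity G l" "m' \<in> labellings H"
    "parity H m' = parity H m"
    using some_orientation_of[of "orient G l"] some_orientation_of[of "orient H m"] assms by auto
  have "oprod (orient G l) (orient H m) = orient (union_graph G H) (union_labelling l' m')"
    unfolding oprod_def e using assms by simp
  also have "\<dots> = orient (union_graph G H) (union_labelling l m)"
    using assms lm labellings_union is_graph_union parity_union by (intro orient_eqI) auto
  finally show ?thesis .
qed

lemma graph_of_oprod: "graph_of (oprod X Y) = union_graph (graph_of X) (graph_of Y)"
  by (cases X; cases Y) (simp add: oprod_orient is_graph_union labellings_union)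

definition union_map :: "(nat \<Rightarrow> nat) \<Rightarrow> (nat \<Rightarrow> nat) \<Rightarrow> nat \<Rightarrow> nat" where
  "union_map f f' n = (if even n then 2 * f (n div 2) else 2 * f' (n div 2) + 1)"

lemma union_map_simps [simp]: "union_map f f' (2 * n) = 2 * f n"
  "union_map f f' (2 * n + 1) = 2 * f' n + 1" "union_map f f' (Suc (2 * n)) = Suc (2 * f' n)"
  by (simp_all add: union_map_def)

lemma bij_betw_union_map:
  assumes "bij_betw f A B" "bij_betw f' A' B'"
  shows "bij_betw (union_map f f') ((\<lambda>v. 2 * v) ` A \<union> (\<lambda>v. 2 * v + 1) ` A') ((\<lambda>v. 2 * v) ` B \<union>
    (\<lambda>v. 2 * v + 1) ` B')"
proof (rule bij_betw_combine)
  show "bij_betw (union_map f f') ((\<lambda>v. 2 * v) ` A) ((\<lambda>v. 2 * v) ` B)"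
    using assms(1) by (auto simp: bij_betw_def inj_on_def image_image)
  show "bij_betw (union_map f f') ((\<lambda>v. 2 * v + 1) ` A') ((\<lambda>v. 2 * v + 1) ` B')"
    using assms(2) by (auto simp: bij_betw_def inj_on_def image_image)
  show "(\<lambda>v. 2 * v) ` B \<inter> (\<lambda>v. 2 * v + 1) ` B' = {}"
    by (auto simp: even_odd_images)
qed

lemma graph_iso_union:
  assumes "graph_iso f g G G'" "graph_iso f' g' H H'"
  shows "graph_iso (union_map f f') (union_map g g') (union_graph G H) (union_graph G' H')"
proof -
  have "vtx (union_graph G' H') (union_map g g' h) = union_map f f' (vtx (union_graph G H) h) \<and>
      bar (union_graph G' H') (union_map g g' h) = union_map g g' (bar (union_graph G H) h)"
    if h: "h \<in> halves (union_graph G H)" for h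
  proof -
    from h consider w where "h = 2 * w" "w \<in> halves G" | w where "h = 2 * w + 1" "w \<in> halves H"
      by (auto simp: union_simps(2))
    then show ?thesis
    proof cases
      case 1
      then show ?thesis using assms(1) unfolding 1(1)
        by (simp only: union_map_simps union_simps) (simp add: graph_iso_def)
    next
      case 2
      then show ?thesis using assms(2) unfolding 2(1)
        by (simp only: union_map_simps union_simps) (simp add: graph_iso_def)
    qed
  qed
  then show ?thesis
    using assms unfolding graph_iso_def union_simps(1,2)
      by (simp add: bij_betw_union_map del: add_Suc_right One_nat_def)
qed

lemma signed_iso_oprod:
  assumes "signed_iso s f g X X'" "signed_iso s' f' g' Y Y'"
  shows "signed_iso (s \<noteq> s') (union_map f f') (union_map g g') (oprod X Y) (oprod X' Y')"
proof -
  obtain G l where X: "X = orient G l" "is_graph G" "l \<in> labellings G" by (cases X)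
  obtain G' l' where X': "X' = orient G' l'" "is_graph G'" "l' \<in> labellings G'" by (cases X')
  obtain H m where Y: "Y = orient H m" "is_graph H" "m \<in> labellings H" by (cases Y)
  obtain H' m' where Y': "Y' = orient H' m'" "is_graph H'" "m' \<in> labellings H'" by (cases Y')
  have s1: "graph_iso f g G G'" "(parity G' (map_labelling f g l) \<noteq> parity G' l') = s"
    using assms(1) X X' by (simp_all add: signed_iso_orient)
  have s2: "graph_iso f' g' H H'" "(parity H' (map_labelling f' g' m) \<noteq> parity H' m') = s'"
    using assms(2) Y Y' by (simp_all add: signed_iso_orient)
  have "map_labelling (union_map f f') (union_map g g') (union_labelling l m)
    = union_labelling (map_labelling f g l) (map_labelling f' g' m)"
    by (simp add: map_labelling_def union_labelling_def image_Un image_image comp_def)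
  then show ?thesis
    using X X' Y Y' s1 s2 graph_iso_union[OF s1(1) s2(1)]
      labellings_map_labelling[OF X(2) s1(1) X(3)] labellings_map_labelling[OF Y(2) s2(1) Y(3)]
    by (simp add: oprod_orient signed_iso_orient is_graph_union labellings_union parity_union, argo)
qed

lemma signed_iso_refl: "signed_iso False id id X X"
  by (cases X) (simp add: signed_iso_orient graph_iso_id)

lemma list_parity_append_swap: "distinct (as @ bs) \<Longrightarrow> list_parity (as @ bs)
  \<longleftrightarrow> list_parity (bs @ as) \<noteq> odd (length as * length bs)"
proof (induction bs arbitrary: as)
  case (Cons b bs)
  have "list_parity (as @ b # bs) \<longleftrightarrow> list_parity ((b # as) @ bs) \<noteq> odd (length as)"
    using list_parity_move_front[of as b bs] Cons.prems by simp
  moreover have "list_parity ((b # as) @ bs)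
    \<longleftrightarrow> list_parity (bs @ b # as) \<noteq> odd (length (b # as) * length bs)"
    using Cons.prems by (intro Cons.IH) auto
  moreover have "list_parity (bs @ b # as) \<longleftrightarrow> list_parity ((b # bs) @ as) \<noteq> odd (length bs)"
    using list_parity_move_front[of bs b as] Cons.prems by auto
  ultimately show ?case by auto
qed simp

definition swap_parts :: "nat \<Rightarrow> nat" where
  "swap_parts n = (if even n then n + 1 else n - 1)"

lemma swap_parts_simps [simp]: "swap_parts (2 * n) = 2 * n + 1" "swap_parts (2 * n + 1) = 2 * n"
  "swap_parts (Suc (2 * n)) = 2 * n"
  by (simp_all add: swap_parts_def)

lemma nverts_orient: "is_graph G \<Longrightarrow> (vs, i) \<in> labellings G \<Longrightarrow> nverts (orient G (vs, i)) = length vs"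
  unfolding nverts_def by (simp add: labellings_iff distinct_card flip: distinct_card)

text \<open>The arrows are only renamed, so the sign is that of exchanging a block of x vertices
  with a block of y vertices.\<close>

lemma signed_iso_oprod_commute:
  "signed_iso (odd (nverts X * nverts Y)) swap_parts swap_parts (oprod X Y) (oprod Y X)"
proof -
  obtain G vs i where X: "X = orient G (vs, i)" "is_graph G" "(vs, i) \<in> labellings G"
    by (metis ograph_cases surj_pair)
  obtain H ws j where Y: "Y = orient H (ws, j)" "is_graph H" "(ws, j) \<in> labellings H"
    by (metis ograph_cases surj_pair)
  have bij: "bij_betw swap_parts ((\<lambda>v. 2 * v) ` A \<union> (\<lambda>v. 2 * v + 1) ` B) ((\<lambda>v. 2 * v) ` B \<union>
    (\<lambda>v. 2 * v + 1) ` A)" for A B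
    by (rule bij_betwI[of _ _ _ "swap_parts"]) auto
  have gi: "graph_iso swap_parts swap_parts (union_graph G H) (union_graph H G)"
    unfolding graph_iso_def union_simps(1,2) using bij
      by (auto simp: union_simps simp del: add_Suc_right One_nat_def)
  let ?W = "map (\<lambda>v. 2 * v + 1) vs @ map (\<lambda>v. 2 * v) ws" and ?W'
    = "map (\<lambda>v. 2 * v) ws @ map (\<lambda>v. 2 * v + 1) vs"
  have ml: "map_labelling swap_parts swap_parts (union_labelling (vs, i) (ws, j))
    = (?W, (\<lambda>v. 2 * v) ` j \<union> (\<lambda>v. 2 * v + 1) ` i)"
    by (simp add: map_labelling_def union_labelling_def image_Un image_image comp_def Un_commute)
  have ul: "union_labelling (ws, j) (vs, i) = (?W', (\<lambda>v. 2 * v) ` j \<union> (\<lambda>v. 2 * v + 1) ` i)"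
    by (simp add: union_labelling_def)
  have "distinct ?W"
    using X(3) Y(3) by (auto simp: labellings_iff distinct_map inj_on_def even_odd_images)
  then have "(parity (union_graph H G) (map_labelling swap_parts swap_parts (union_labelling (vs, i)
    (ws, j))) \<noteq>
      parity (union_graph H G) (union_labelling (ws, j) (vs, i))) = odd (length vs * length ws)"
    unfolding ml ul parity_iff
    using list_parity_append_swap[of "map (\<lambda>v. 2 * v + 1) vs" "map (\<lambda>v. 2 * v) ws"]
    unfolding length_map by argo
  then show ?thesis
    using X Y gi by (simp add: oprod_orient signed_iso_orient is_graph_union labellings_union
      nverts_orient)
qed

text \<open>
  In \<open>X \<cdot> (Y \<cdot> Z)\<close> the names from \<open>X\<close>, \<open>Y\<close>, \<open>Z\<close> are \<open>2n\<close>, \<open>4n + 1\<close>, \<open>4n + 3\<close>.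
\<close>

definition cycle_parts :: "nat \<Rightarrow> nat" where
  "cycle_parts n = (if even n then 2 * n + 1 else if even (n div 2) then n + 2 else 2 * (n div 4))"

lemma cycle_parts_simps: "cycle_parts (2 * n) = 2 * (2 * n) + 1"
  "cycle_parts (2 * (2 * n) + 1) = 2 * (2 * n + 1) + 1"
  "cycle_parts (2 * (2 * n + 1) + 1) = 2 * n"
  by (simp_all add: cycle_parts_def)

lemma nat_mod4_cases:
  obtains w where "n = 2 * w" | w where "n = 2 * (2 * w) + 1" | w where "n
    = 2 * (2 * w + 1) + (1::nat)"
  by (metis evenE oddE)

lemma inj_cycle_parts: "inj cycle_parts"
proof (rule inj_on_inverseI)
  fix n
  \<comment> \<open>The explicit inverse sends 2w to 4w + 3, 4w + 1 to 2w, and 4w + 3 to 4w +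
    1.\<close>
  show "(\<lambda>n. if even n then 2 * (n + 1) + 1 else if even (n div 2) then n div 2 else n - 2)
    (cycle_parts n) = n"
    by (rule nat_mod4_cases[of n]) (simp_all add: cycle_parts_def)
qed

text \<open>One isomorphism does both the rotation of the factors and the change of bracketing,
  which alters names because the even and odd codings are nested. The sign is that of moving the
  vertices of \<open>Z\<close> in front of those of \<open>X\<close> and \<open>Y\<close>.\<close>

lemma signed_iso_oprod_cycle:
  "signed_iso (odd (nverts Z * (nverts X + nverts Y))) cycle_parts cycle_parts (oprod X (oprod Y Z))
    (oprod Z (oprod X Y))"
proof -
  obtain G vs i where X: "X = orient G (vs, i)" "is_graph G" "(vs, i) \<in> labellings G"
    by (metis ograph_cases surj_pair)
  obtain H ws j where Y: "Y = orient H (ws, j)" "is_graph H" "(ws, j) \<in> labellings H"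
    by (metis ograph_cases surj_pair)
  obtain K us k where Z: "Z = orient K (us, k)" "is_graph K" "(us, k) \<in> labellings K"
    by (metis ograph_cases surj_pair)
  let ?e = "\<lambda>v::nat. 2 * v" and ?o = "\<lambda>v::nat. 2 * v + 1"
  have inj: "inj_on cycle_parts S" for S
    using inj_cycle_parts inj_on_subset by blast
  have im: "cycle_parts ` (?e ` A \<union> ?o ` (?e ` B \<union> ?o ` D)) = ?e ` D \<union> ?o ` (?e ` A \<union> ?o ` B)"
    for A B D
    unfolding image_Un image_image cycle_parts_simps by blast
  have gi: "graph_iso cycle_parts cycle_parts (union_graph G (union_graph H K)) (union_graph K
    (union_graph G H))"
  proof -
    let ?U = "union_graph G (union_graph H K)" and ?U' = "union_graph K (union_graph G H)"
    have "vtx ?U' (cycle_parts h) = cycle_parts (vtx ?U h) \<and> bar ?U' (cycle_parts h)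
      = cycle_parts (bar ?U h)" if h: "h \<in> halves ?U" for h
    proof -
      from h consider w where "h = 2 * w" | w where "h = 2 * (2 * w) + 1" | w where "h
        = 2 * (2 * w + 1) + 1"
        by (auto simp: union_simps(2))
      then show ?thesis by cases (simp_all only: cycle_parts_simps union_simps simp_thms)
    qed
    moreover have "bij_betw cycle_parts (verts ?U) (verts ?U')"
      "bij_betw cycle_parts (halves ?U) (halves ?U')"
      unfolding bij_betw_def union_simps(1,2) im using inj by simp_all
    ultimately show ?thesis unfolding graph_iso_def by blast
  qed
  let ?A = "map (\<lambda>v. ?o (?e v)) vs @ map (\<lambda>v. ?o (?o v)) ws" and ?B = "map ?e us"
  let ?I = "?e ` k \<union> ?o ` (?e ` i \<union> ?o ` j)"
  have ml: "map_labelling cycle_parts cycle_parts (union_labelling (vs, i) (union_labelling (ws, j)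
    (us, k))) = (?A @ ?B, ?I)"
    unfolding map_labelling_def union_labelling_def fst_conv snd_conv im map_append map_map comp_def
      cycle_parts_simps append_assoc
    by (rule refl)
  have ul: "union_labelling (us, k) (union_labelling (vs, i) (ws, j)) = (?B @ ?A, ?I)"
    by (simp add: union_labelling_def comp_def)
  have "distinct (?A @ ?B)"
    using labellings_map_labelling[OF is_graph_union[OF X(2) is_graph_union[OF Y(2) Z(2)]] gi
        labellings_union[OF X(3) labellings_union[OF Y(3) Z(3)]]]
    unfolding ml labellings_iff by blast
  then have "(parity (union_graph K (union_graph G H)) (map_labelling cycle_parts cycle_parts
    (union_labelling (vs, i) (union_labelling (ws, j) (us, k)))) \<noteq>
      parity (union_graph K (union_graph G H)) (union_labelling (us, k) (union_labelling (vs, i)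
        (ws, j)))) =
      odd (length us * (length vs + length ws))"
    unfolding ml ul parity_iff using list_parity_append_swap[of ?A ?B]
    unfolding length_append length_map mult.commute[of "length us"] by argo
  then show ?thesis
    using X Y Z gi by (simp add: oprod_orient signed_iso_orient is_graph_union labellings_union
      nverts_orient)
qed

section \<open>Gluing within one factor of a product\<close>

lemma union_simps_Suc:
  "vtx (union_graph G H) (Suc (2 * h)) = Suc (2 * vtx H h)"
  "bar (union_graph G H) (Suc (2 * h)) = Suc (2 * bar H h)"
  by (simp_all add: union_graph_def)

lemma gluable_union:
  "gluable (union_graph G H) (2 * h) (2 * k) \<longleftrightarrow> gluable G h k"
  "gluable (union_graph G H) (2 * h + 1) (2 * k + 1) \<longleftrightarrow> gluable H h k"
  unfolding gluable_def union_simps by (auto simp: even_odd_images)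

lemma graph_eqI: "verts G = verts H \<Longrightarrow> halves G = halves H \<Longrightarrow> vtx G = vtx H \<Longrightarrow> bar G = bar H \<Longrightarrow> G
  = (H :: graph)"
  by simp

lemma fun_parity_eqI:
  assumes "\<And>n. f (2 * n) = g (2 * n)" "\<And>n. f (2 * n + 1) = g (2 * n + 1)"
  shows "f = (g :: nat \<Rightarrow> 'a)"
proof
  fix n show "f n = g n"
    by (cases "even n") (use assms in \<open>metis evenE oddE\<close>)+
qed

lemma glued_union:
  assumes "is_graph G" "is_graph H"
  shows "gluable G h k \<Longrightarrow> glued (union_graph G H) (2 * h) (2 * k) = union_graph (glued G h k) H"
    and "gluable H h k \<Longrightarrow> glued (union_graph G H) (2 * h + 1) (2 * k + 1)
      = union_graph G (glued H h k)"
proof -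
  note U = is_graph_union[OF assms]
  {
    assume gl: "gluable G h k"
    note s = glued_simps[OF U gluable_union(1)[THEN iffD2, OF gl]] and s'
      = glued_simps[OF assms(1) gl]
    show "glued (union_graph G H) (2 * h) (2 * k) = union_graph (glued G h k) H" (is "?L = ?R")
    proof (rule graph_eqI)
      show "verts ?L = verts ?R"
        unfolding s unfolding union_simps s' by (auto simp: even_odd_images)
      show "halves ?L = halves ?R"
        unfolding s unfolding union_simps s' by (auto simp: even_odd_images)
      show "vtx ?L = vtx ?R"
        by (rule fun_parity_eqI; unfold s; unfold union_simps s'; simp add: even_odd_images)
      show "bar ?L = bar ?R"
        by (rule fun_parity_eqI; unfold s; unfold union_simps s'; simp add: even_odd_images
          union_simps union_simps_Suc)
    qed
  }
  {
    assume gl: "gluable H h k"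
    note s = glued_simps[OF U gluable_union(2)[THEN iffD2, OF gl]] and s'
      = glued_simps[OF assms(2) gl]
    show "glued (union_graph G H) (2 * h + 1) (2 * k + 1) = union_graph G (glued H h k)" (is "?L
      = ?R")
    proof (rule graph_eqI)
      show "verts ?L = verts ?R"
        unfolding s unfolding union_simps s' by (auto simp: even_odd_images)
      show "halves ?L = halves ?R"
        unfolding s unfolding union_simps s' by (auto simp: even_odd_images)
      show "vtx ?L = vtx ?R"
        by (rule fun_parity_eqI; unfold s; unfold union_simps s'; simp add: even_odd_images)
      show "bar ?L = bar ?R"
        by (rule fun_parity_eqI; unfold s; unfold union_simps s' fun_upd_def; simp add:
          even_odd_images union_simps union_simps_Suc)
    qed
  }
qed

text \<open>No sign arises: the vertices of \<open>X\<close> come first in the product, so a normal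
  labelling of \<open>X\<close> followed by any labelling of \<open>Y\<close> is normal.\<close>

lemma glue_oprod_left:
  assumes "gluable (graph_of X) h k"
  shows "glue (oprod X Y) (2 * h) (2 * k) = oprod (glue X h k) Y"
proof -
  obtain H m where Y: "Y = orient H m" "is_graph H" "m \<in> labellings H" by (cases Y)
  define G where "G = graph_of X"
  have G: "is_graph G" "gluable G h k" using assms by (simp_all add: G_def)
  obtain l where l: "l \<in> orientation_of X" "normal G h k l"
    "glue X h k = orient (glued G h k) (glue_labelling G h l)"
    "glue_labelling G h l \<in> labellings (glued G h k)"
    using glue_normal[OF assms] unfolding G_def .
  have X: "X = orient G l" using orient_orientation_of[OF l(1)] by (simp add: G_def)
  obtain r i where li: "l = (vtx G h # vtx G k # r, i)" "l \<in> labellings G" "h \<in> i" "k \<notin> i"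
    "glue_labelling G h l = (vtx G h # r, i - {h})" using l(2) by (rule normalE)
  let ?U = "union_graph G H" and ?n = "union_labelling l m"
  have U: "is_graph ?U" "gluable ?U (2 * h) (2 * k)"
    using is_graph_union[OF G(1) Y(2)] G(2) by (simp_all add: gluable_union)
  have n: "normal ?U (2 * h) (2 * k) ?n"
    unfolding normal_def
    using labellings_union[OF li(2) Y(3)] li(3,4)
    by (auto simp: li(1) union_labelling_def union_simps even_odd_images)
  have "glue_labelling ?U (2 * h) ?n = union_labelling (glue_labelling G h l) m"
    unfolding li(5) by (auto simp: li(1) union_labelling_def union_simps glue_labelling_def
      even_odd_images)
  then show ?thesis
    using glue_orient[OF U n] oprod_orient[OF G(1) Y(2) li(2) Y(3)]
      glued_union(1)[OF G(1) Y(2) G(2)]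
      oprod_orient[OF is_graph_glued[OF G] Y(2) l(4) Y(3)]
    by (simp add: X Y(1) glue_orient[OF G l(2)])
qed

text \<open>The collapse numbers the merged vertex 1, whereas in \<open>oprod X (glue Y h k)\<close>
  it stands behind all vertices of \<open>X\<close>. Moving it there gives the sign (-1)^x, the same
  as in the definition of \<open>bracket\<close>.\<close>

lemma glue_oprod_right:
  assumes "gluable (graph_of Y) h k"
  shows "signed_iso (odd (nverts X)) id id (glue (oprod X Y) (2 * h + 1) (2 * k + 1)) (oprod X
    (glue Y h k))"
proof -
  obtain G vs j where X: "X = orient G (vs, j)" "is_graph G" "(vs, j) \<in> labellings G"
    by (metis ograph_cases surj_pair)
  define H where "H = graph_of Y"
  have H: "is_graph H" "gluable H h k" using assms by (simp_all add: H_def)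
  obtain l where l: "l \<in> orientation_of Y" "normal H h k l"
    "glue Y h k = orient (glued H h k) (glue_labelling H h l)"
    "glue_labelling H h l \<in> labellings (glued H h k)"
    using glue_normal[OF assms] unfolding H_def .
  have Y: "Y = orient H l" using orient_orientation_of[OF l(1)] by (simp add: H_def)
  obtain r i where li: "l = (vtx H h # vtx H k # r, i)" "l \<in> labellings H" "h \<in> i" "k \<notin> i"
    "glue_labelling H h l = (vtx H h # r, i - {h})" using l(2) by (rule normalE)
  let ?U = "union_graph G H" and ?e = "\<lambda>v::nat. 2 * v" and ?o = "\<lambda>v::nat. 2 * v + 1"
  define I where "I = ?e ` j \<union> ?o ` i"
  define L where "L = map ?e vs"
  define R where "R = map ?o r"
  let ?h = "?o (vtx H h)" and ?k = "?o (vtx H k)"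
  have ul: "union_labelling (vs, j) l = (L @ ?h # ?k # R, I)"
    by (simp add: li(1) union_labelling_def I_def L_def R_def)
  have lab: "(L @ ?h # ?k # R, I) \<in> labellings ?U"
    using labellings_union[OF X(3) li(2)] unfolding ul .
  have U: "is_graph ?U" "gluable ?U (?o h) (?o k)"
    using is_graph_union[OF X(2) H(1)] H(2) by (simp_all only: gluable_union simp_thms)
  have d: "distinct (L @ ?h # ?k # R)" "set (L @ ?h # ?k # R) = verts ?U" "I \<in> arrows ?U"
    using lab by (simp_all only: labellings_iff simp_thms)
  let ?n = "(?h # ?k # L @ R, I)"
  have n: "normal ?U (?o h) (?o k) ?n"
    using d li(3,4) unfolding normal_def labellings_iff union_simps(4)
      by (auto simp: I_def even_odd_images)
  \<comment> \<open>Before the collapse there is no sign: two vertices pass those of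
    \<open>X\<close>, which is an even number of exchanges.\<close>
  have "parity ?U (L @ ?h # ?k # R, I) = parity ?U ?n"
    using d(1) list_parity_move_front[of L ?h "?k # R"] list_parity_move_front[of "?h # L" ?k R]
      list_parity_move_front[of "[?k]" ?h "L @ R"] unfolding parity_iff
        by (auto simp del: add_Suc_right One_nat_def)
  moreover have "?n \<in> labellings ?U" using n unfolding normal_def by blast
  ultimately have "orient ?U (L @ ?h # ?k # R, I) = orient ?U ?n"
    using orient_eqI[OF U(1) lab] by blast
  then have "oprod X Y = orient ?U ?n"
    using oprod_orient[OF X(2) H(1) X(3) li(2)] unfolding X(1) Y ul by simp
  then have C1: "glue (oprod X Y) (?o h) (?o k)
    = orient (union_graph G (glued H h k)) (?h # L @ R, I - {?o h})"
    using glue_orient[OF U n] unfolding glued_union(2)[OF X(2) H]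
      by (simp add: glue_labelling_def union_simps_Suc)
  have lab1: "(?h # L @ R, I - {?o h}) \<in> labellings (union_graph G (glued H h k))"
    using labellings_glue_labelling[OF U n] unfolding glued_union(2)[OF X(2) H]
      by (simp add: glue_labelling_def union_simps_Suc)
  have ul2: "union_labelling (vs, j) (glue_labelling H h l) = (L @ ?h # R, I - {?o h})"
    unfolding li(5) by (auto simp: union_labelling_def I_def L_def R_def even_odd_images)
  have C2: "oprod X (glue Y h k) = orient (union_graph G (glued H h k)) (L @ ?h # R, I - {?o h})"
    using oprod_orient[OF X(2) is_graph_glued[OF H] X(3) l(4)] unfolding X(1) l(3) ul2 .
  have lab2: "(L @ ?h # R, I - {?o h}) \<in> labellings (union_graph G (glued H h k))"
    using labellings_union[OF X(3) l(4)] unfolding ul2 .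
  have "nverts X = length L" using nverts_orient[OF X(2,3)] X(1) by (simp add: L_def)
  then have "(list_parity (?h # L @ R) \<noteq> list_parity (L @ ?h # R)) = odd (nverts X)"
    using list_parity_move_front[of L ?h R] d(1) by auto
  then have eq: "(parity (union_graph G (glued H h k)) (?h # L @ R, I - {?o h}) \<noteq>
      parity (union_graph G (glued H h k)) (L @ ?h # R, I - {?o h})) = odd (nverts X)"
    unfolding parity_iff by blast
  show ?thesis
    unfolding C1 C2 using signed_iso_id_orient[OF is_graph_union[OF X(2) is_graph_glued[OF H]] lab1
      lab2] unfolding eq .
qed

section \<open>Linear algebra of bilinear extensions\<close>

lemma abs_add: "abs_graph_space (u + v) = abs_graph_space u + abs_graph_space v"
  by (simp add: plus_graph_space.abs_eq)

lemma abs_diff: "abs_graph_space (u - v) = abs_graph_space u - abs_graph_space v"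
  by (simp add: minus_graph_space.abs_eq)

lemma abs_zero: "abs_graph_space 0 = 0"
  by (simp add: zero_graph_space.abs_eq)

lemma abs_scale: "abs_graph_space (fscale c u) = gscale c (abs_graph_space u)"
  by (simp add: gscale.abs_eq)

lemma abs_sum: "abs_graph_space (sum f A) = (\<Sum>x\<in>A. abs_graph_space (f x))"
  by (induction A rule: infinite_finite_induct) (simp_all add: abs_zero abs_add)

abbreviation "keys \<equiv> Poly_Mapping.keys"
abbreviation "lookup \<equiv> Poly_Mapping.lookup"

lemma bilinear_extension_superset:
  assumes "finite S" "keys u \<subseteq> S" "finite T" "keys v \<subseteq> T"
  shows "bilinear_extension f u v =
    (\<Sum>X\<in>S. \<Sum>Y\<in>T. fscale (lookup u X * lookup v Y) (f X Y))"
proof -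
  have "(\<Sum>Y\<in>keys v. fscale (lookup u X * lookup v Y) (f X Y)) =
    (\<Sum>Y\<in>T. fscale (lookup u X * lookup v Y) (f X Y))" for X
    using assms(3,4) by (intro sum.mono_neutral_left) (auto simp: in_keys_iff)
  moreover have "(\<Sum>X\<in>keys u. \<Sum>Y\<in>T. fscale (lookup u X * lookup v Y) (f X Y)) =
    (\<Sum>X\<in>S. \<Sum>Y\<in>T. fscale (lookup u X * lookup v Y) (f X Y))"
    using assms(1,2) by (intro sum.mono_neutral_left) (auto simp: in_keys_iff)
  ultimately show ?thesis by (simp add: bilinear_extension_def)
qed

lemma bilinear_extension_add_left:
  "bilinear_extension f (u + u') v = bilinear_extension f u v + bilinear_extension f u' v"
proof -
  let ?S = "keys u \<union> keys u' \<union> keys (u + u')"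
  have "bilinear_extension f w v = (\<Sum>X\<in>?S. \<Sum>Y\<in>keys v. fscale (lookup w X * lookup v Y) (f X Y))"
    if "keys w \<subseteq> ?S" for w
    using that by (intro bilinear_extension_superset) auto
  note e = this
  have "bilinear_extension f (u + u') v = (\<Sum>X\<in>?S. \<Sum>Y\<in>keys v.
      fscale (lookup (u + u') X * lookup v Y) (f X Y))"
    by (rule e) auto
  moreover have "bilinear_extension f u v = (\<Sum>X\<in>?S. \<Sum>Y\<in>keys v.
      fscale (lookup u X * lookup v Y) (f X Y))"
    by (rule e) auto
  moreover have "bilinear_extension f u' v = (\<Sum>X\<in>?S. \<Sum>Y\<in>keys v.
      fscale (lookup u' X * lookup v Y) (f X Y))"
    by (rule e) auto
  ultimately show ?thesis
    by (simp add: lookup_add distrib_right fscale.scale_left_distrib sum.distrib)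
qed

lemma bilinear_extension_scale_left:
  "bilinear_extension f (fscale c u) v = fscale c (bilinear_extension f u v)"
proof -
  have "bilinear_extension f (fscale c u) v = (\<Sum>X\<in>keys u. \<Sum>Y\<in>keys v.
      fscale (lookup (fscale c u) X * lookup v Y) (f X Y))"
    by (intro bilinear_extension_superset) (auto simp: in_keys_iff)
  then show ?thesis
    by (simp add: bilinear_extension_def fscale.scale_sum_right mult.assoc)
qed

text \<open>Carries the properties of the first argument over to the second.\<close>

lemma bilinear_extension_commute:
  "bilinear_extension f u v = bilinear_extension (\<lambda>X Y. f Y X) v u"
  unfolding bilinear_extension_def by (subst sum.swap) (simp add: mult.commute)

lemma bilinear_extension_add_right:
  "bilinear_extension f u (v + v') = bilinear_extension f u v + bilinear_extension f u v'"
  by (simp add: bilinear_extension_commute[of f u] bilinear_extension_add_left)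

lemma bilinear_extension_scale_right:
  "bilinear_extension f u (fscale c v) = fscale c (bilinear_extension f u v)"
  by (simp add: bilinear_extension_commute[of f u] bilinear_extension_scale_left)

lemma bilinear_extension_zero: "bilinear_extension f 0 v = 0" "bilinear_extension f u 0 = 0"
  by (simp_all add: bilinear_extension_def)

lemma bilinear_extension_sum_left:
  "bilinear_extension f (sum g A) v = (\<Sum>x\<in>A. bilinear_extension f (g x) v)"
  by (induction A rule: infinite_finite_induct)
    (simp_all add: bilinear_extension_zero bilinear_extension_add_left)

lemma bilinear_extension_sum_right:
  "bilinear_extension f u (sum g A) = (\<Sum>x\<in>A. bilinear_extension f u (g x))"
  by (simp add: bilinear_extension_commute[of f u] bilinear_extension_sum_left)

lemma bilinear_extension_basis: "bilinear_extension f (basis X) (basis Y)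
  = (f X Y :: ograph \<Rightarrow>\<^sub>0 'k::field_char_0)"
  by (simp add: bilinear_extension_def)

lemma gscale_sign: "gscale ((-1) ^ n) x = signed (odd n) x"
  by (cases "even n") (simp_all add: signed_def gscale.scale_minus_left)

lemma signed_sum: "signed s (sum f A) = (\<Sum>x\<in>A. signed s (f x))"
  by (simp add: signed_def sum_negf)

section \<open>The bracket as a sum over pairs of half-edges from the two factors\<close>

definition gluings :: "graph \<Rightarrow> (nat \<times> nat) set" where
  "gluings G = {(h, k). h \<in> halves G \<and> k \<in> halves G \<and> h < k \<and> k \<noteq> bar G h}"

lemma finite_gluings: "is_graph G \<Longrightarrow> finite (gluings G)"
  by (rule finite_subset[of _ "halves G \<times> halves G"]) (auto simp: gluings_def graph_finite)

lemma abs_boundary_H: "abs_graph_space (boundary_H X)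
  = (\<Sum>(h, k)\<in>gluings (graph_of X). glue_class X h k)"
  unfolding boundary_H_def gluings_def abs_sum glue_class_def by (simp add: case_prod_beta)

lemma fprod_boundary_left:
  "abs_graph_space (fprod (boundary_H X) (basis Y)) =
    (\<Sum>(h, k)\<in>gluings (graph_of X). glue_class (oprod X Y) (2 * h)
      (2 * k) :: 'k::field_char_0 graph_space)"
proof -
  have "abs_graph_space (fprod (contract X h k) (basis Y))
    = (glue_class (oprod X Y) (2 * h) (2 * k) :: 'k graph_space)"
    if "(h, k) \<in> gluings (graph_of X)" for h k
  proof (cases "vtx (graph_of X) h = vtx (graph_of X) k")
    case True
    then show ?thesis
      by (simp add: contract_def fprod_def bilinear_extension_zero abs_zero glue_class_eq
        graph_of_oprod union_simps)
  next
    case False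
    then have gl: "gluable (graph_of X) h k" using that by (auto simp: gluings_def gluable_def)
    then have "gluable (graph_of (oprod X Y)) (2 * h) (2 * k)"
      by (simp add: graph_of_oprod gluable_union)
    then show ?thesis using False
      by (simp add: contract_def fprod_def bilinear_extension_basis glue_class_gluable
        glue_oprod_left[OF gl] graph_class_def glue_def[symmetric])
  qed
  then show ?thesis
    unfolding boundary_H_def gluings_def[symmetric] fprod_def bilinear_extension_sum_left abs_sum
    by (intro sum.cong) (auto simp: fprod_def)
qed

lemma fprod_boundary_right:
  "abs_graph_space (fprod (basis X) (boundary_H Y)) =
    (\<Sum>(h, k)\<in>gluings (graph_of Y). signed (odd (nverts X)) (glue_class (oprod X Y) (2 * h + 1)
      (2 * k + 1)) :: 'k::field_char_0 graph_space)"
proof -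
  have "abs_graph_space (fprod (basis X) (contract Y h k))
    = (signed (odd (nverts X)) (glue_class (oprod X Y) (2 * h + 1) (2 * k + 1)) :: 'k graph_space)"
    if "(h, k) \<in> gluings (graph_of Y)" for h k
  proof (cases "vtx (graph_of Y) h = vtx (graph_of Y) k")
    case True
    then have "vtx (graph_of (oprod X Y)) (2 * h + 1) = vtx (graph_of (oprod X Y)) (2 * k + 1)"
      unfolding graph_of_oprod union_simps by simp
    with True show ?thesis
      by (simp add: contract_def fprod_def bilinear_extension_zero abs_zero glue_class_eq)
  next
    case False
    then have gl: "gluable (graph_of Y) h k" using that by (auto simp: gluings_def gluable_def)
    then have "gluable (graph_of (oprod X Y)) (2 * h + 1) (2 * k + 1)"
      unfolding graph_of_oprod gluable_union .
    then show ?thesis using False signed_iso_graph_class[OF glue_oprod_right[OF gl], where ?'k = 'k,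
      of X]
      by (simp add: contract_def fprod_def bilinear_extension_basis glue_class_gluable
        graph_class_def glue_def[symmetric])
  qed
  then show ?thesis
    unfolding boundary_H_def gluings_def[symmetric] fprod_def bilinear_extension_sum_right abs_sum
    by (intro sum.cong) (auto simp: fprod_def)
qed

text \<open>Pairs of half-edges of the product lie in \<open>X\<close>, in \<open>Y\<close>, or are
  mixed. The subtracted products cancel the first two kinds; for \<open>Y\<close> the sign from
  \<open>glue_oprod_right\<close> meets the explicit (-1)^x. The equation is stated for classes
  because mixed pairs must first be put into the order \<open>X\<close>, \<open>Y\<close> by
  \<open>glue_class_swap\<close>.\<close>

lemma abs_bracket:
  "abs_graph_space (bracket X Y) =
    (\<Sum>h\<in>halves (graph_of X). \<Sum>k\<in>halves (graph_of Y). glue_class (oprod X Y) (2 * h) (2 * k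
      + 1) :: 'k::field_char_0 graph_space)"
proof -
  define G H where "G = graph_of X" and "H = graph_of Y"
  have GH: "is_graph G" "is_graph H" by (simp_all add: G_def H_def)
  let ?t = "glue_class (oprod X Y) :: nat \<Rightarrow> nat \<Rightarrow> 'k graph_space"
  let ?U = "union_graph G H" and ?e = "\<lambda>v::nat. 2 * v" and ?o = "\<lambda>v::nat. 2 * v + 1"
  let ?T = "\<lambda>(h, k). ?t h k"
  let ?A = "map_prod ?e ?e ` gluings G" and ?B = "map_prod ?o ?o ` gluings H"
  \<comment> \<open>The boundary lists each pair in increasing order. Since 2h < 2k + 1 exactly when
    h \<le> k, a mixed pair appears as (2h, 2k + 1) over \<open>?P\<close> and as (2k + 1, 2h) over
    \<open>?Q\<close>.\<close>
  let ?P = "{(h, k) \<in> halves G \<times> halves H. h \<le> k}" and ?Q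
    = "{(h, k) \<in> halves G \<times> halves H. \<not> h \<le> k}"
  let ?C = "(\<lambda>(h, k). (?e h, ?o k)) ` ?P" and ?D = "(\<lambda>(h, k). (?o k, ?e h)) ` ?Q"
  have prod: "finite (halves G \<times> halves H)" using GH graph_finite(2) by blast
  have fin: "finite (gluings G)" "finite (gluings H)" "finite ?P" "finite ?Q"
    using GH finite_gluings by (blast intro: finite_subset[OF _ prod])+
  have dec: "gluings ?U = (?A \<union> ?B) \<union> (?C \<union> ?D)"
  proof (intro equalityI subsetI)
    fix x assume "x \<in> gluings ?U"
    then obtain h k where x: "x = (h, k)" "h \<in> halves ?U" "k \<in> halves ?U" "h < k" "k \<noteq> bar ?U h"
      by (auto simp: gluings_def)
    from x(2,3) consider
      h' k' where "h = 2 * h'" "h' \<in> halves G" "k = 2 * k'" "k' \<in> halves G"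
      | h' k' where "h = 2 * h' + 1" "h' \<in> halves H" "k = 2 * k' + 1" "k' \<in> halves H"
      | h' k' where "h = 2 * h'" "h' \<in> halves G" "k = 2 * k' + 1" "k' \<in> halves H"
      | h' k' where "h = 2 * k' + 1" "k' \<in> halves H" "k = 2 * h'" "h' \<in> halves G"
      unfolding union_simps(2) by blast
    then show "x \<in> (?A \<union> ?B) \<union> (?C \<union> ?D)"
    proof cases
      case 1
      then have "(h', k') \<in> gluings G" using x(4,5) by (simp add: gluings_def union_simps)
      then show ?thesis using 1 x(1) by force
    next
      case 2
      then have "(h', k') \<in> gluings H" using x(4,5) unfolding 2 union_simps
        by (simp add: gluings_def)
      then show ?thesis using 2 x(1) by force
    next
      case 3
      then have "(h', k') \<in> ?P" using x(4) by simp
      then show ?thesis using 3 x(1) by force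
    next
      case 4
      then have "(h', k') \<in> ?Q" using x(4) by simp
      then show ?thesis using 4 x(1) by force
    qed
  next
    fix x assume "x \<in> (?A \<union> ?B) \<union> (?C \<union> ?D)"
    then consider h k where "x = (2 * h, 2 * k)" "(h, k) \<in> gluings G"
      | h k where "x = (2 * h + 1, 2 * k + 1)" "(h, k) \<in> gluings H"
      | h k where "x = (2 * h, 2 * k + 1)" "(h, k) \<in> ?P"
      | h k where "x = (2 * k + 1, 2 * h)" "(h, k) \<in> ?Q" by auto
    then show "x \<in> gluings ?U"
      by cases (auto simp: gluings_def union_simps even_odd_images
          union_simps_Suc)
  qed
  have disj: "?A \<inter> ?B = {}" "(?A \<union> ?B) \<inter> (?C \<union> ?D) = {}" "?C \<inter> ?D = {}"
    by (auto simp: even_odd_images)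
  have inj: "inj_on (map_prod ?e ?e) S" "inj_on (map_prod ?o ?o) S"
    "inj_on (\<lambda>(h, k). (?e h, ?o k)) S" "inj_on (\<lambda>(h, k). (?o k, ?e h)) S" for S
    by (auto simp: inj_on_def)
  have "sum ?T (gluings ?U) = (sum ?T ?A + sum ?T ?B) + (sum ?T ?C + sum ?T ?D)"
    unfolding dec using fin disj by (simp add: sum.union_disjoint)
  moreover have "sum ?T ?A = (\<Sum>(h, k)\<in>gluings G. ?t (2 * h) (2 * k))"
    by (subst sum.reindex[OF inj(1)]) (auto intro!: sum.cong)
  moreover have "sum ?T ?B = (\<Sum>(h, k)\<in>gluings H. ?t (2 * h + 1) (2 * k + 1))"
    by (subst sum.reindex[OF inj(2)]) (auto intro!: sum.cong)
  moreover have "sum ?T ?C = (\<Sum>(h, k)\<in>?P. ?t (2 * h) (2 * k + 1))"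
    by (subst sum.reindex[OF inj(3)]) (auto intro!: sum.cong)
  moreover have "sum ?T ?D = (\<Sum>(h, k)\<in>?Q. ?t (2 * h) (2 * k + 1))"
  proof -
    have "?t (2 * k + 1) (2 * h) = (?t (2 * h) (2 * k + 1) )"
      if "h \<in> halves G" "k \<in> halves H" for h k
    proof (rule glue_class_swap)
      show "2 * k + 1 \<in> halves (graph_of (oprod X Y))" "2 * h \<in> halves (graph_of (oprod X Y))"
        using that by (simp_all add: graph_of_oprod union_simps G_def H_def)
      show "2 * h \<noteq> bar (graph_of (oprod X Y)) (2 * k + 1)"
        unfolding graph_of_oprod union_simps by presburger
    qed
    then show ?thesis by (subst sum.reindex[OF inj(4)]) (auto intro!: sum.cong)
  qed
  moreover have "(\<Sum>(h, k)\<in>?P. ?t (2 * h) (2 * k + 1)) + (\<Sum>(h, k)\<in>?Q. ?t (2 * h) (2 * k + 1))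
    = (\<Sum>(h, k)\<in>halves G \<times> halves H. ?t (2 * h) (2 * k + 1) )"
    using fin by (subst sum.union_disjoint[symmetric]) (auto intro!: sum.cong)
  ultimately have "sum ?T (gluings ?U) = (\<Sum>(h, k)\<in>gluings G. ?t (2 * h) (2 * k)) +
     (\<Sum>(h, k)\<in>gluings H. ?t (2 * h + 1) (2 * k + 1)) +
     (\<Sum>(h, k)\<in>halves G \<times> halves H. ?t (2 * h) (2 * k + 1))"
    by simp
  moreover have "abs_graph_space (boundary_H (oprod X Y)) = sum ?T (gluings ?U)"
    by (simp add: abs_boundary_H graph_of_oprod G_def H_def)
  moreover have "abs_graph_space (fscale ((-1) ^ nverts X) (fprod (basis X) (boundary_H Y))) =
    (\<Sum>(h, k)\<in>gluings H. ?t (2 * h + 1) (2 * k + 1) )"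
    unfolding abs_scale gscale_sign fprod_boundary_right signed_sum H_def
    by (intro sum.cong refl) (auto simp: signed_def)
  moreover have "abs_graph_space (fprod (boundary_H X) (basis Y)) =
    (\<Sum>(h, k)\<in>gluings G. ?t (2 * h) (2 * k) )"
    unfolding fprod_boundary_left G_def ..
  ultimately have "abs_graph_space (bracket X Y) =
     (\<Sum>(h, k)\<in>halves G \<times> halves H. ?t (2 * h) (2 * k + 1) )"
    unfolding bracket_def abs_diff by simp
  then show ?thesis by (simp add: sum.cartesian_product G_def H_def)
qed

section \<open>The Jacobi identity\<close>

text \<open>Expresses that two sets of half-edges come from different factors of a product, so that
  the double sums can be handled without the coding of names.\<close>

definition separated :: "graph \<Rightarrow> nat set \<Rightarrow> nat set \<Rightarrow> bool" where
  "separated G A B \<longleftrightarrow> A \<subseteq> halves G \<and> B \<subseteq> halves G \<and> (\<forall>h\<in>A. bar G h \<in> A) \<and> (\<forall>h\<in>B. bar G h \<in> B) \<and>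
     (\<forall>h\<in>A. \<forall>k\<in>B. vtx G h \<noteq> vtx G k)"

lemma separated_sym: "separated G A B \<Longrightarrow> separated G B A"
  unfolding separated_def by metis

lemma separatedD:
  assumes "separated G A B" "h \<in> A" "k \<in> B"
  shows "gluable G h k" "h \<in> halves G" "k \<in> halves G" "bar G h \<in> A" "bar G k \<in> B"
    "vtx G h \<noteq> vtx G k"
    "h \<noteq> k" "bar G h \<noteq> k" "h \<notin> B" "k \<notin> A"
proof -
  show h: "h \<in> halves G" "k \<in> halves G" "bar G h \<in> A" "bar G k \<in> B" "vtx G h \<noteq> vtx G k"
    using assms by (auto simp: separated_def)
  show "bar G h \<noteq> k" "h \<notin> B" "k \<notin> A" "h \<noteq> k" using assms h(3) unfolding separated_def by blast+
  then show "gluable G h k" using h by (auto simp: gluable_def)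
qed

text \<open>The half-edges \<open>h\<close> and \<open>b\<close> of the hub \<open>P\<close> are glued to \<open>Q\<close> and \<open>R\<close> respectively.\<close>

definition hub_sum :: "ograph \<Rightarrow> nat set \<Rightarrow> nat set \<Rightarrow> nat set \<Rightarrow> 'k::field_char_0 graph_space" where
  "hub_sum W P Q R = (\<Sum>h\<in>P. \<Sum>b\<in>P. if h = b then 0 else \<Sum>k\<in>Q. \<Sum>a\<in>R. glue_class (glue W h k) b a)"

text \<open>Term by term from \<open>glue_class_anticommute\<close>; its inequalities all follow
  from the separation of the three factors and \<open>h \<noteq> b\<close>. The two hub half-edges
  exchange their roles, and the excluded diagonal is symmetric under this.\<close>

lemma hub_sum_antisym:
  assumes "separated (graph_of W) P Q" "separated (graph_of W) P R" "separated (graph_of W) Q R"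
  shows "hub_sum W P R Q = - (hub_sum W P Q R :: 'k::field_char_0 graph_space)"
proof -
  have "glue_class (glue W b a) h k = - (glue_class (glue W h k) b a :: 'k graph_space)"
    if "h \<in> P" "b \<in> P" "h \<noteq> b" "k \<in> Q" "a \<in> R" for h k b a
  proof (rule glue_class_anticommute)
    note s = separatedD[OF assms(1) that(1,4)] separatedD[OF assms(1) that(2,4)]
      separatedD[OF assms(2) that(1,5)] separatedD[OF assms(2) that(2,5)]
        separatedD[OF assms(3) that(4,5)]
    show "gluable (graph_of W) h k" "gluable (graph_of W) b a" "h \<noteq> b" "k \<noteq> a" "h \<noteq> a" "b \<noteq> k"
      "a \<noteq> bar (graph_of W) h" "b \<noteq> bar (graph_of W) k" "a \<noteq> bar (graph_of W) k"
      "vtx (graph_of W) h \<noteq> vtx (graph_of W) a" "vtx (graph_of W) b \<noteq> vtx (graph_of W) k"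
      "vtx (graph_of W) k \<noteq> vtx (graph_of W) a"
      using s that by metis+
  qed
  then have *: "(\<Sum>a\<in>R. \<Sum>k\<in>Q. glue_class (glue W b a) h k)
    = - (\<Sum>k\<in>Q. \<Sum>a\<in>R. glue_class (glue W h k) b a :: 'k graph_space)"
    if "h \<in> P" "b \<in> P" "h \<noteq> b" for h b
    by (subst sum.swap) (use that in \<open>simp add: sum_negf\<close>)
  have "hub_sum W P R Q = (\<Sum>h\<in>P. \<Sum>b\<in>P. if b
    = h then 0 else \<Sum>a\<in>R. \<Sum>k\<in>Q. glue_class (glue W b a) h k :: 'k graph_space)"
    unfolding hub_sum_def by (rule sum.swap)
  also have "\<dots> = (\<Sum>h\<in>P. \<Sum>b\<in>P. - (if h = b then 0 else \<Sum>k\<in>Q. \<Sum>a\<in>R. glue_class (glue W h k) b a))"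
    by (intro sum.cong refl) (auto simp: *)
  finally show ?thesis by (simp add: hub_sum_def sum_negf)
qed

text \<open>
  Up to sign the bracket \<open>[A, [B, D]]\<close>: after the gluing of \<open>h\<close> to \<open>k\<close> the half-edges of the factors \<open>B\<close>
  and \<open>D\<close>, except for \<open>h\<close> and \<open>k\<close>, are those of a single graph.
\<close>

definition double_sum :: "ograph \<Rightarrow> nat set \<Rightarrow> nat set \<Rightarrow> nat set \<Rightarrow> 'k::field_char_0 graph_space" where
  "double_sum W A B D = (\<Sum>h\<in>B. \<Sum>k\<in>D. \<Sum>a\<in>A. \<Sum>b\<in>(B \<union> D) - {h, k}. glue_class (glue W h k) a b)"

text \<open>The second gluing attaches \<open>a\<close> to a half-edge left over from
  \<open>B\<close> or from \<open>D\<close>. In the first case \<open>B\<close> is the hub, in the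
  second \<open>D\<close>; the symmetry of gluing brings each pair into the form with the hub
  first.\<close>

lemma double_sum_eq:
  assumes "separated (graph_of W) A B" "separated (graph_of W) A D" "separated (graph_of W) B D"
  shows "double_sum W A B D = (hub_sum W B D A + hub_sum W D B A :: 'k::field_char_0 graph_space)"
proof -
  let ?G = "graph_of W"
  have G: "is_graph ?G" by simp
  have fin: "finite A" "finite B" "finite D"
    using assms graph_finite(2)[OF G] unfolding separated_def by (meson finite_subset)+
  have sw: "glue_class (glue W h k) a b = (glue_class (glue W h k) b a :: 'k graph_space)"
    "glue_class (glue W h k) b a = (glue_class (glue W k h) b a :: 'k graph_space)"
    if h: "h \<in> B" "k \<in> D" "a \<in> A" "b \<in> B \<union> D" "b \<noteq> h" "b \<noteq> k" for h k a b
  proof -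
    note s = separatedD[OF assms(1) h(3,1)] separatedD[OF assms(2) h(3,2)]
      separatedD[OF assms(3) h(1,2)]
    have gl: "gluable ?G h k" by (rule s)
    note c = glued_simps[OF G gl]
    have "B \<union> D \<subseteq> halves ?G" using assms(3) by (simp add: separated_def)
    then have b: "b \<in> halves ?G" "b \<notin> A"
      using h(4) separatedD(10)[OF assms(1) h(3), of b] separatedD(10)[OF assms(2) h(3), of b]
        by blast+
    have ab: "bar ?G a \<noteq> b" using s(4) b by blast
    have a: "a \<notin> {h, k, bar ?G h, bar ?G k}" using s h(3) by auto
    have hv: "a \<in> halves (glued ?G h k)" "b \<in> halves (glued ?G h k)"
      using a b s h(5,6) by (auto simp: c)
    have ba: "b \<noteq> bar (glued ?G h k) a" using a ab by (simp add: c)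
    have ab': "a \<noteq> bar (glued ?G h k) b"
      using ba graphD(4)[OF is_graph_glued[OF G gl] hv(2)] by metis
    show "glue_class (glue W h k) a b = (glue_class (glue W h k) b a :: 'k graph_space)"
      by (rule glue_class_swap) (use hv ba graph_of_glue[OF gl] in simp_all)
    show "glue_class (glue W h k) b a = (glue_class (glue W k h) b a :: 'k graph_space)"
      by (rule glue_class_glue_swap[OF gl]) (use hv ab' graph_of_glue[OF gl] in simp_all)
  qed
  have "double_sum W A B D = (\<Sum>h\<in>B. \<Sum>k\<in>D. \<Sum>a\<in>A. (\<Sum>b\<in>B - {h}. glue_class (glue W h k) b a) +
      (\<Sum>b\<in>D - {k}. glue_class (glue W k h) b a) :: 'k graph_space)"
    unfolding double_sum_def
  proof (intro sum.cong refl)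
    fix h k a assume h: "h \<in> B" "k \<in> D" "a \<in> A"
    note d = separatedD(9,10)[OF assms(3) h(1,2)]
    have "B \<inter> D = {}" using separatedD(9)[OF assms(3)] h(2) by blast
    then have "(B \<union> D) - {h, k} = (B - {h}) \<union> (D - {k})" "(B - {h}) \<inter> (D - {k}) = {}" using d
      by auto
    then have "(\<Sum>b\<in>(B \<union> D) - {h, k}. glue_class (glue W h k) a b) =
       (\<Sum>b\<in>B - {h}. glue_class (glue W h k) a b) + (\<Sum>b\<in>D - {k}. glue_class
         (glue W h k) a b :: 'k graph_space)"
      using fin by (simp add: sum.union_disjoint)
    also have "(\<Sum>b\<in>B - {h}. glue_class (glue W h k) a b)
      = (\<Sum>b\<in>B - {h}. glue_class (glue W h k) b a :: 'k graph_space)"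
      using h d by (intro sum.cong refl sw(1)) auto
    also have "(\<Sum>b\<in>D - {k}. glue_class (glue W h k) a b)
      = (\<Sum>b\<in>D - {k}. glue_class (glue W k h) b a :: 'k graph_space)"
      using h d sw by (intro sum.cong refl) (metis DiffE UnI2 insertI1)
    finally show "(\<Sum>b\<in>(B \<union> D) - {h, k}. glue_class (glue W h k) a b) =
      (\<Sum>b\<in>B - {h}. glue_class (glue W h k) b a) + (\<Sum>b\<in>D - {k}. glue_class
        (glue W k h) b a :: 'k graph_space)" .
  qed
  moreover have "(\<Sum>h\<in>B. \<Sum>k\<in>D. \<Sum>a\<in>A. \<Sum>b\<in>B - {h}. glue_class (glue W h k) b a)
    = (hub_sum W B D A :: 'k graph_space)"
  proof -
    have "(\<Sum>k\<in>D. \<Sum>a\<in>A. \<Sum>b\<in>B - {h}. glue_class (glue W h k) b a) =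
      (\<Sum>b\<in>B. if h = b then 0 else \<Sum>k\<in>D. \<Sum>a\<in>A. glue_class (glue W h k) b a :: 'k graph_space)"
        if "h \<in> B" for h
    proof -
      have "(\<Sum>k\<in>D. \<Sum>a\<in>A. \<Sum>b\<in>B - {h}. glue_class (glue W h k) b a) =
        (\<Sum>b\<in>B - {h}. \<Sum>k\<in>D. \<Sum>a\<in>A. glue_class (glue W h k) b a :: 'k graph_space)"
        by (subst sum.swap[of _ "B - {h}"], subst sum.swap[of _ "B - {h}"]) (rule refl)
      also have "\<dots> = (\<Sum>b\<in>B. if h = b then 0 else \<Sum>k\<in>D. \<Sum>a\<in>A. glue_class (glue W h k) b a)"
        using fin by (intro sum.mono_neutral_cong_left) auto
      finally show ?thesis .
    qed
    then show ?thesis by (simp add: hub_sum_def)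
  qed
  moreover have "(\<Sum>h\<in>B. \<Sum>k\<in>D. \<Sum>a\<in>A. \<Sum>b\<in>D - {k}. glue_class (glue W k h) b a)
    = (hub_sum W D B A :: 'k graph_space)"
  proof -
    have "(\<Sum>h\<in>B. \<Sum>a\<in>A. \<Sum>b\<in>D - {k}. glue_class (glue W k h) b a) =
      (\<Sum>b\<in>D. if k = b then 0 else \<Sum>h\<in>B. \<Sum>a\<in>A. glue_class (glue W k h) b a :: 'k graph_space)"
        if "k \<in> D" for k
    proof -
      have "(\<Sum>h\<in>B. \<Sum>a\<in>A. \<Sum>b\<in>D - {k}. glue_class (glue W k h) b a) =
        (\<Sum>b\<in>D - {k}. \<Sum>h\<in>B. \<Sum>a\<in>A. glue_class (glue W k h) b a :: 'k graph_space)"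
        by (subst sum.swap[of _ "D - {k}"], subst sum.swap[of _ "D - {k}"]) (rule refl)
      also have "\<dots> = (\<Sum>b\<in>D. if k = b then 0 else \<Sum>h\<in>B. \<Sum>a\<in>A. glue_class (glue W k h) b a)"
        using fin by (intro sum.mono_neutral_cong_left) auto
      finally show ?thesis .
    qed
    then show ?thesis unfolding hub_sum_def by (subst sum.swap) simp
  qed
  ultimately show ?thesis by (simp add: sum.distrib)
qed

text \<open>Among the six hub sums each factor is the hub twice, with the two other factors in
  opposite order.\<close>

lemma double_sum_cyclic:
  assumes "separated (graph_of W) A B" "separated (graph_of W) A D" "separated (graph_of W) B D"
  shows "double_sum W A B D + double_sum W D A B + double_sum W B D A
    = (0 :: 'k::field_char_0 graph_space)"
proof -
  note s = assms[THEN separated_sym]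
  have "double_sum W A B D = (hub_sum W B D A + hub_sum W D B A :: 'k graph_space)"
    "double_sum W D A B = (hub_sum W A B D + hub_sum W B A D :: 'k graph_space)"
    "double_sum W B D A = (hub_sum W D A B + hub_sum W A D B :: 'k graph_space)"
    using assms s by (auto intro: double_sum_eq)
  moreover have "hub_sum W B A D = - (hub_sum W B D A :: 'k graph_space)"
    "hub_sum W D A B = - (hub_sum W D B A :: 'k graph_space)"
    "hub_sum W A D B = - (hub_sum W A B D :: 'k graph_space)"
    using assms s by (auto intro: hub_sum_antisym)
  ultimately show ?thesis by simp
qed

text \<open>The three Jacobi terms live in differently ordered products; this brings them into a
  single one.\<close>

lemma double_sum_signed_iso:
  assumes "signed_iso s f g W W'"
    and "separated (graph_of W) A B" "separated (graph_of W) A D" "separated (graph_of W) B D"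
  shows "double_sum W' (g ` A) (g ` B) (g ` D)
    = signed s (double_sum W A B D :: 'k::field_char_0 graph_space)"
proof -
  let ?G = "graph_of W"
  have G: "is_graph ?G" by simp
  have "inj_on g (halves ?G)" using assms(1) by
    (simp add: signed_iso_def graph_iso_def bij_betw_def)
  then have inj: "inj_on g S" if "S \<subseteq> halves ?G" for S using that inj_on_subset by blast
  have sub: "A \<subseteq> halves ?G" "B \<subseteq> halves ?G" "D \<subseteq> halves ?G"
    using assms by (simp_all add: separated_def)
  have "(\<Sum>b\<in>(g ` B \<union> g ` D) - {g h, g k}. glue_class (glue W' (g h) (g k)) (g a) b) =
      signed s (\<Sum>b\<in>(B \<union> D) - {h, k}. glue_class (glue W h k) a b :: 'k graph_space)"
    if h: "h \<in> B" "k \<in> D" "a \<in> A" for h k a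
  proof -
    note s = separatedD[OF assms(2) h(3,1)] separatedD[OF assms(3) h(3,2)]
      separatedD[OF assms(4) h(1,2)]
    have gl: "gluable ?G h k" by (rule s)
    note c = glued_simps[OF G gl]
    have "inj_on g (B \<union> D)" using inj sub by simp
    then have e: "(g ` B \<union> g ` D) - {g h, g k} = g ` ((B \<union> D) - {h, k})"
      using h by (auto simp: inj_on_def)
    have "glue_class (glue W' (g h) (g k)) (g a) (g b)
      = signed s (glue_class (glue W h k) a b :: 'k graph_space)"
      if b: "b \<in> (B \<union> D) - {h, k}" for b
    proof (rule signed_iso_glue_class[OF signed_iso_glue[OF assms(1) gl]])
      have a: "a \<notin> {h, k, bar ?G h, bar ?G k}" using s h(3) by auto
      have "b \<notin> A" using b separatedD(9)[OF assms(2)] separatedD(9)[OF assms(3)] by blast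
      then show "b \<noteq> bar (graph_of (glue W h k)) a" using a s(4)
        by (auto simp: graph_of_glue[OF gl] c)
      show "a \<in> halves (graph_of (glue W h k))" "b \<in> halves (graph_of (glue W h k))"
        using a b sub h(3) by (auto simp: graph_of_glue[OF gl] c)
    qed
    then show ?thesis unfolding e using sub
      by (subst sum.reindex) (auto simp: signed_sum intro!: inj sum.cong)
  qed
  then show ?thesis
    unfolding double_sum_def using inj sub by (simp add: sum.reindex signed_sum)
qed

abbreviation part1 :: "ograph \<Rightarrow> nat set" where
  "part1 X \<equiv> (\<lambda>h. 2 * h) ` halves (graph_of X)"

abbreviation part2 :: "ograph \<Rightarrow> nat set" where
  "part2 X \<equiv> (\<lambda>h. 2 * (2 * h) + 1) ` halves (graph_of X)"

abbreviation part3 :: "ograph \<Rightarrow> nat set" where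
  "part3 X \<equiv> (\<lambda>h. 2 * (2 * h + 1) + 1) ` halves (graph_of X)"

lemma separated_union:
  assumes "A \<subseteq> halves G" "\<And>h. h \<in> A \<Longrightarrow> bar G h \<in> A" "B \<subseteq> halves H" "\<And>h. h \<in> B \<Longrightarrow> bar H h \<in> B"
  shows "separated (union_graph G H) ((\<lambda>h. 2 * h) ` A) ((\<lambda>h. 2 * h + 1) ` B)"
  unfolding separated_def
proof (intro conjI ballI)
  show "(\<lambda>h. 2 * h) ` A \<subseteq> halves (union_graph G H)" "(\<lambda>h. 2 * h + 1) ` B \<subseteq> halves (union_graph G H)"
    unfolding union_simps using assms by blast+
  show "bar (union_graph G H) h \<in> (\<lambda>h. 2 * h) ` A" if "h \<in> (\<lambda>h. 2 * h) ` A" for h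
    using that assms(2) by (auto simp: union_simps)
  show "bar (union_graph G H) h \<in> (\<lambda>h. 2 * h + 1) ` B" if "h \<in> (\<lambda>h. 2 * h + 1) ` B" for h
    using that assms(4) by (auto simp: union_simps_Suc)
  show "vtx (union_graph G H) h \<noteq> vtx (union_graph G H) k"
    if "h \<in> (\<lambda>h. 2 * h) ` A" "k \<in> (\<lambda>h. 2 * h + 1) ` B" for h k
    using that by (auto simp: union_simps union_simps_Suc even_odd_images)
qed

lemma separated_union_right:
  assumes "separated H A B"
  shows "separated (union_graph G H) ((\<lambda>h. 2 * h + 1) ` A) ((\<lambda>h. 2 * h + 1) ` B)"
  unfolding separated_def
proof (intro conjI ballI)
  show "(\<lambda>h. 2 * h + 1) ` A \<subseteq> halves (union_graph G H)"
    "(\<lambda>h. 2 * h + 1) ` B \<subseteq> halves (union_graph G H)"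
    unfolding union_simps using assms unfolding separated_def by blast+
  show "bar (union_graph G H) h \<in> (\<lambda>h. 2 * h + 1) ` A" if "h \<in> (\<lambda>h. 2 * h + 1) ` A" for h
    using that assms by (auto simp: union_simps_Suc separated_def)
  show "bar (union_graph G H) h \<in> (\<lambda>h. 2 * h + 1) ` B" if "h \<in> (\<lambda>h. 2 * h + 1) ` B" for h
    using that assms by (auto simp: union_simps_Suc separated_def)
  show "vtx (union_graph G H) h \<noteq> vtx (union_graph G H) k"
    if "h \<in> (\<lambda>h. 2 * h + 1) ` A" "k \<in> (\<lambda>h. 2 * h + 1) ` B" for h k
    using that assms by (auto simp: union_simps_Suc separated_def)
qed

lemma separated_parts:
  "separated (graph_of (oprod X (oprod Y Z))) (part1 X) (part2 Y)"
  "separated (graph_of (oprod X (oprod Y Z))) (part1 X) (part3 Z)"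
  "separated (graph_of (oprod X (oprod Y Z))) (part2 Y) (part3 Z)"
proof -
  let ?U = "union_graph (graph_of Y) (graph_of Z)"
  let ?Y = "(\<lambda>h. 2 * h) ` halves (graph_of Y)" and ?Z = "(\<lambda>h. 2 * h + 1) ` halves (graph_of Z)"
  have U: "separated ?U ?Y ?Z" by (rule separated_union) (simp_all add: graphD)
  have im: "part2 Y = (\<lambda>h. 2 * h + 1) ` ?Y" "part3 Z = (\<lambda>h. 2 * h + 1) ` ?Z"
    by (simp_all only: image_image)
  show "separated (graph_of (oprod X (oprod Y Z))) (part1 X) (part2 Y)"
    unfolding graph_of_oprod im by (rule separated_union) (use U in \<open>auto simp: graphD separated_def\<close>)
  show "separated (graph_of (oprod X (oprod Y Z))) (part1 X) (part3 Z)"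
    unfolding graph_of_oprod im by (rule separated_union) (use U in \<open>auto simp: graphD separated_def\<close>)
  show "separated (graph_of (oprod X (oprod Y Z))) (part2 Y) (part3 Z)"
    unfolding graph_of_oprod im by (rule separated_union_right[OF U])
qed

section \<open>The twisted bracket of two oriented graphs\<close>

definition bracket_class :: "ograph \<Rightarrow> ograph \<Rightarrow> 'k::field_char_0 graph_space" where
  "bracket_class X Y = abs_graph_space (bracket_phi X Y)"

lemma bracket_class_eq:
  "bracket_class X Y = signed (odd (nverts X))
    (\<Sum>h\<in>halves (graph_of X). \<Sum>k\<in>halves (graph_of Y). glue_class (oprod X Y) (2 * h) (2 * k + 1))"
  by (simp add: bracket_class_def bracket_phi_def abs_scale gscale_sign abs_bracket)

lemma gluable_oprod:
  "h \<in> halves (graph_of X) \<Longrightarrow> k \<in> halves (graph_of Y)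
    \<Longrightarrow> gluable (graph_of (oprod X Y)) (2 * h) (2 * k + 1)"
  unfolding gluable_def graph_of_oprod union_simps using even_odd_images by auto

lemma signed_iso_nverts: "signed_iso s f g X X' \<Longrightarrow> nverts X' = nverts X"
  unfolding signed_iso_def graph_iso_def nverts_def using bij_betw_same_card by metis

lemma nverts_oprod: "nverts (oprod X Y) = nverts X + nverts Y"
proof -
  have "card ((\<lambda>v. 2 * v) ` verts (graph_of X) \<union> (\<lambda>v. 2 * v + 1) ` verts (graph_of Y)) =
    card ((\<lambda>v. 2 * v) ` verts (graph_of X)) + card ((\<lambda>v. 2 * v + 1) ` verts (graph_of Y))"
    by (rule card_Un_disjoint) (auto simp: graph_finite even_odd_images)
  then show ?thesis
    unfolding nverts_def graph_of_oprod union_simps(1) by (simp add: card_image inj_on_def)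
qed

lemma nverts_glue: "gluable (graph_of X) h k \<Longrightarrow> Suc (nverts (glue X h k)) = nverts X"
  using card_Suc_Diff1[OF graph_finite(1) gluableD(15)[of "graph_of X" h k]]
  by (simp add: nverts_def graph_of_glue glued_simps)

lemma signed_iso_bracket_class:
  assumes "signed_iso s f g X X'" "signed_iso s' f' g' Y Y'"
  shows "bracket_class X' Y' = signed (s \<noteq> s') (bracket_class X Y :: 'k::field_char_0 graph_space)"
proof -
  have b: "bij_betw g (halves (graph_of X)) (halves (graph_of X'))"
    "bij_betw g' (halves (graph_of Y)) (halves (graph_of Y'))"
    using assms by (simp_all add: signed_iso_def graph_iso_def)
  have *: "glue_class (oprod X' Y') (2 * g h) (2 * g' k + 1)
    = signed (s \<noteq> s') (glue_class (oprod X Y) (2 * h) (2 * k + 1) :: 'k graph_space)"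
    if "h \<in> halves (graph_of X)" "k \<in> halves (graph_of Y)" for h k
    using signed_iso_glue_class[OF signed_iso_oprod[OF assms], of "2 * h"
      "2 * k + 1", where ?'k = 'k] gluable_oprod[OF that]
    unfolding gluable_def union_map_simps by blast
  have "(\<Sum>h\<in>halves (graph_of X'). \<Sum>k\<in>halves (graph_of Y'). glue_class (oprod X' Y') (2 * h) (2 * k
    + 1)) =
     (\<Sum>h\<in>halves (graph_of X). \<Sum>k\<in>halves (graph_of Y). glue_class (oprod X' Y') (2 * g h) (2 * g' k
       + 1) :: 'k graph_space)"
    by (simp only: sum.reindex_bij_betw[OF b(1), symmetric]
      sum.reindex_bij_betw[OF b(2), symmetric])
  also have "\<dots> = signed (s \<noteq> s') (\<Sum>h\<in>halves (graph_of X). \<Sum>k\<in>halves (graph_of Y). glue_class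
    (oprod X Y) (2 * h) (2 * k + 1))"
    unfolding signed_sum by (intro sum.cong refl *)
  finally show ?thesis by (simp add: bracket_class_eq signed_iso_nverts[OF assms(1)] signed_def)
qed

text \<open>The exponent collects xy from the exchange of the factors and x and y from the two
  twists. Modulo 2 it is (x - 1)(y - 1) + 1, the antisymmetry sign in shifted degrees.\<close>

lemma bracket_class_antisym:
  "bracket_class X Y = signed (odd (nverts X * nverts Y + nverts X + nverts Y))
    (bracket_class Y X :: 'k::field_char_0 graph_space)"
proof -
  let ?e = "odd (nverts X * nverts Y)"
  have *: "glue_class (oprod X Y) (2 * h) (2 * k + 1)
    = signed ?e (glue_class (oprod Y X) (2 * k) (2 * h + 1) :: 'k graph_space)"
    if "h \<in> halves (graph_of X)" "k \<in> halves (graph_of Y)" for h k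
  proof -
    have gl: "gluable (graph_of (oprod X Y)) (2 * h) (2 * k + 1)" by (rule gluable_oprod[OF that])
    have gl': "gluable (graph_of (oprod Y X)) (2 * k) (2 * h + 1)"
      by (rule gluable_oprod[OF that(2,1)])
    have "glue_class (oprod Y X) (2 * h + 1) (2 * k)
      = signed ?e (glue_class (oprod X Y) (2 * h) (2 * k + 1) :: 'k graph_space)"
      using signed_iso_glue_class[OF signed_iso_oprod_commute[of X Y], of "2 * h"
        "2 * k + 1", where ?'k = 'k] gl
      unfolding gluable_def swap_parts_simps by blast
    moreover have "glue_class (oprod Y X) (2 * k) (2 * h + 1)
      = (glue_class (oprod Y X) (2 * h + 1) (2 * k) :: 'k graph_space)"
      by (rule glue_class_swap) (use gl' in \<open>simp_all only: gluable_def simp_thms\<close>)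
    ultimately show ?thesis by (simp add: signed_def)
  qed
  have "(\<Sum>h\<in>halves (graph_of X). \<Sum>k\<in>halves (graph_of Y). glue_class (oprod X Y) (2 * h) (2 * k
    + 1)) =
     signed ?e (\<Sum>k\<in>halves (graph_of Y). \<Sum>h\<in>halves (graph_of X). glue_class (oprod Y X) (2 * k)
       (2 * h + 1) :: 'k graph_space)"
    unfolding signed_sum by (subst sum.swap) (intro sum.cong refl *)
  then show ?thesis by (auto simp: bracket_class_eq signed_def)
qed

section \<open>The bracket on the graph space\<close>

definition bracket_extension :: "(ograph \<Rightarrow>\<^sub>0 'k::field_char_0) \<Rightarrow>
  (ograph \<Rightarrow>\<^sub>0 'k) \<Rightarrow> 'k graph_space" where
  "bracket_extension u v = abs_graph_space (bilinear_extension bracket_phi u v)"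

lemma bracket_extension_simps:
  "bracket_extension (u + u') v = bracket_extension u v + bracket_extension u' v"
    "bracket_extension u (v + v') = bracket_extension u v + bracket_extension u v'"
  "bracket_extension (fscale c u) v = gscale c (bracket_extension u v)"
    "bracket_extension u (fscale c v) = gscale c (bracket_extension u v)"
  by (simp_all add: bracket_extension_def bilinear_extension_add_left bilinear_extension_add_right
      bilinear_extension_scale_left bilinear_extension_scale_right abs_add abs_scale)

lemma bracket_extension_diff: "bracket_extension (u - u') v
  = bracket_extension u v - bracket_extension u' v"
  "bracket_extension u (v - v') = bracket_extension u v - bracket_extension u v'"
  using bracket_extension_simps(1)[of "u - u'" u' v] bracket_extension_simps(2)[of u "v - v'" v']
    by (simp_all add: algebra_simps)

lemma bracket_extension_zero: "bracket_extension 0 v = 0" "bracket_extension u 0 = 0"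
  using bracket_extension_diff(1)[of 0 0 v] bracket_extension_diff(2)[of u 0 0] by simp_all

lemma bracket_extension_basis_left: "bracket_extension (basis X) v
  = (\<Sum>Y\<in>keys v. gscale (lookup v Y) (bracket_class X Y))"
  by (simp add: bracket_extension_def bilinear_extension_def abs_sum abs_scale bracket_class_def)

lemma bracket_extension_basis_right: "bracket_extension u (basis Y)
  = (\<Sum>X\<in>keys u. gscale (lookup u X) (bracket_class X Y))"
  by (simp add: bracket_extension_def bilinear_extension_def abs_sum abs_scale bracket_class_def)

lemma relations_cases:
  assumes "r \<in> (relations :: (ograph \<Rightarrow>\<^sub>0 'k::field_char_0) set)"
  obtains f g X Y where "signed_iso False f g X Y" "r = basis X - basis Y"
    | f g X Y where "signed_iso True f g X Y" "r = basis X + basis Y"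
proof -
  from assms consider X Y where "r = basis X - basis Y" "isomorphic X Y"
    | X Y where "r = basis X + basis Y" "signed_iso True id id X Y"
    unfolding relations_def using opposite_signed_iso by blast
  then show thesis
    by cases (use that isomorphic_signed_iso in metis)+
qed

text \<open>By \<open>relations_cases\<close> every relation comes from a signed isomorphism, and
  \<open>signed_iso_bracket_class\<close> transports brackets along it.\<close>

lemma bracket_extension_relations:
  assumes "r \<in> relations"
  shows "bracket_extension r v = (0 :: 'k::field_char_0 graph_space)"
    "bracket_extension v r = (0 :: 'k graph_space)"
proof -
  show "bracket_extension r v = 0"
    using assms
  proof (cases rule: relations_cases)
    case (1 f g X Y)
    then have "bracket_class Y Z = (bracket_class X Z :: 'k graph_space)" for Z
      using signed_iso_bracket_class[OF 1(1) signed_iso_refl, where ?'k = 'k] by simp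
    then show ?thesis by (simp add: 1(2) bracket_extension_diff bracket_extension_basis_left)
  next
    case (2 f g X Y)
    then have "bracket_class Y Z = - (bracket_class X Z :: 'k graph_space)" for Z
      using signed_iso_bracket_class[OF 2(1) signed_iso_refl, where ?'k = 'k] by simp
    then show ?thesis by (simp add: 2(2) bracket_extension_simps bracket_extension_basis_left
      gscale.scale_minus_right sum_negf)
  qed
  show "bracket_extension v r = 0"
    using assms
  proof (cases rule: relations_cases)
    case (1 f g X Y)
    then have "bracket_class Z Y = (bracket_class Z X :: 'k graph_space)" for Z
      using signed_iso_bracket_class[OF signed_iso_refl 1(1), where ?'k = 'k] by simp
    then show ?thesis by (simp add: 1(2) bracket_extension_diff bracket_extension_basis_right)
  next
    case (2 f g X Y)
    then have "bracket_class Z Y = - (bracket_class Z X :: 'k graph_space)" for Z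
      using signed_iso_bracket_class[OF signed_iso_refl 2(1), where ?'k = 'k] by simp
    then show ?thesis by (simp add: 2(2) bracket_extension_simps bracket_extension_basis_right
      gscale.scale_minus_right sum_negf)
  qed
qed

lemma bracket_extension_span:
  assumes "r \<in> fscale.span relations"
  shows "bracket_extension r v = 0" "bracket_extension v r = 0"
  using assms by (induction rule: fscale.span_induct_alt)
    (simp_all add: bracket_extension_zero bracket_extension_simps bracket_extension_relations)

lemma bracket_extension_cong:
  assumes "abs_graph_space u = abs_graph_space u'" "abs_graph_space v = abs_graph_space v'"
  shows "bracket_extension u v = bracket_extension u' v'"
  using assms bracket_extension_span(1)[of "u - u'" v] bracket_extension_span(2)[of "v - v'" u']
    by (simp add: abs_eq_iff bracket_extension_diff)

lemma abs_rep: "abs_graph_space (rep_graph_space a) = a"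
  by (rule Quotient3_abs_rep[OF Quotient3_graph_space])

lemma lie_bracket_abs: "lie_bracket (abs_graph_space u) (abs_graph_space v) = bracket_extension u v"
  unfolding lie_bracket_def bracket_extension_def[symmetric]
    by (rule bracket_extension_cong) (rule abs_rep)+

lemma lie_bracket_graph_class: "lie_bracket (graph_class X) (graph_class Y) = bracket_class X Y"
  by (simp add: graph_class_def lie_bracket_abs bracket_extension_def bilinear_extension_basis
    bracket_class_def)

lemma lie_bracket_simps:
  "lie_bracket (a + a') b = lie_bracket a b + lie_bracket a' b"
  "lie_bracket a (b + b') = lie_bracket a b + lie_bracket a b'"
  "lie_bracket (gscale c a) b = gscale c (lie_bracket a b)"
  "lie_bracket a (gscale c b) = gscale c (lie_bracket a b)"
proof -
  obtain u u' v v' where "a = abs_graph_space u" "a' = abs_graph_space u'" "b = abs_graph_space v"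
    "b' = abs_graph_space v'"
    using abs_rep by metis
  then show "lie_bracket (a + a') b = lie_bracket a b + lie_bracket a' b"
    "lie_bracket a (b + b') = lie_bracket a b + lie_bracket a b'"
    "lie_bracket (gscale c a) b = gscale c (lie_bracket a b)"
    "lie_bracket a (gscale c b) = gscale c (lie_bracket a b)"
    by (simp_all add: lie_bracket_abs bracket_extension_simps flip: abs_add abs_scale)
qed

lemma lie_bracket_zero: "lie_bracket 0 b = 0" "lie_bracket a 0 = 0"
  using lie_bracket_simps(1)[of 0 0 b] lie_bracket_simps(2)[of a 0 0] by simp_all

lemma lie_bracket_signed: "lie_bracket (signed s a) b = signed s (lie_bracket a b)"
  "lie_bracket a (signed s b) = signed s (lie_bracket a b)"
proof -
  have "lie_bracket (- a) b = - lie_bracket a b" "lie_bracket a (- b) = - lie_bracket a b"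
    using lie_bracket_simps(3)[of "-1" a b] lie_bracket_simps(4)[of a "-1" b] by simp_all
  then show "lie_bracket (signed s a) b = signed s (lie_bracket a b)"
    "lie_bracket a (signed s b) = signed s (lie_bracket a b)"
    by (simp_all add: signed_def)
qed

lemma lie_bracket_sum_right: "lie_bracket a (sum f A) = (\<Sum>x\<in>A. lie_bracket a (f x))"
  by (induction A rule: infinite_finite_induct) (simp_all add: lie_bracket_zero lie_bracket_simps)

text \<open>The outer twist (-1)^x cancels against the cost of performing the gluing of
  \<open>Y\<close> with \<open>Z\<close> inside the product with \<open>X\<close>. Only the inner
  twist (-1)^y is left.\<close>

lemma jacobi_term:
  "lie_bracket (graph_class X) (bracket_class Y Z) = signed (odd (nverts Y))
    (double_sum (oprod X (oprod Y Z)) (part1 X) (part2 Y)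
      (part3 Z) :: 'k::field_char_0 graph_space)"
proof -
  let ?W = "oprod X (oprod Y Z)" and ?U = "graph_of (oprod Y Z)"
  have "lie_bracket (graph_class X) (glue_class (oprod Y Z) (2 * h) (2 * k + 1)) =
     (\<Sum>a\<in>part1 X. \<Sum>b\<in>(part2 Y \<union> part3 Z) - {2 * (2 * h) + 1, 2 * (2 * k + 1) + 1}.
       glue_class (glue ?W (2 * (2 * h) + 1) (2 * (2 * k + 1) + 1)) a b :: 'k graph_space)"
    if hk: "h \<in> halves (graph_of Y)" "k \<in> halves (graph_of Z)" for h k
  proof -
    let ?p = "2 * h" and ?q = "2 * k + 1"
    have gl: "gluable ?U ?p ?q" by (rule gluable_oprod[OF hk])
    let ?V = "glue (oprod Y Z) ?p ?q"
    have hV: "halves (graph_of ?V) = halves ?U - {?p, ?q}"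
      unfolding graph_of_glue[OF gl] glued_simps[OF is_graph_graph_of gl] ..
    have glW: "gluable (graph_of ?W) (2 * ?p + 1) (2 * ?q + 1)"
      unfolding graph_of_oprod[of X] gluable_union by (rule gl)
    have gW: "graph_of (glue ?W (2 * ?p + 1) (2 * ?q + 1)) = union_graph (graph_of X) (graph_of ?V)"
      unfolding graph_of_glue[OF glW] graph_of_glue[OF gl] unfolding graph_of_oprod[of X]
      by (rule glued_union(2)[OF is_graph_graph_of is_graph_graph_of gl])
    \<comment> \<open>Here the inner gluing is pulled out of the product by
      \<open>glue_oprod_right\<close>, at the cost of (-1)^x.\<close>
    have *: "glue_class (oprod X ?V) (2 * a) (2 * b + 1) =
        signed (odd (nverts X)) (glue_class (glue ?W (2 * ?p + 1) (2 * ?q + 1)) (2 * a) (2 * b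
          + 1) :: 'k graph_space)"
      if "a \<in> halves (graph_of X)" "b \<in> halves (graph_of ?V)" for a b
    proof -
      have "gluable (graph_of (glue ?W (2 * ?p + 1) (2 * ?q + 1))) (2 * a) (2 * b + 1)"
        using gluable_oprod[OF that] unfolding gW graph_of_oprod .
      then show ?thesis
        using signed_iso_glue_class[OF glue_oprod_right[OF gl, of X], where h = "2 * a" and k = "2 *
          b + 1" and ?'k = 'k]
        unfolding gluable_def id_apply by blast
    qed
    have "lie_bracket (graph_class X) (glue_class (oprod Y Z) ?p ?q)
      = (bracket_class X ?V :: 'k graph_space)"
      by (simp only: glue_class_gluable[OF gl] lie_bracket_graph_class)
    also have "\<dots> = signed (odd (nverts X)) (\<Sum>a\<in>halves (graph_of X). \<Sum>b\<in>halves (graph_of ?V).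
        signed (odd (nverts X)) (glue_class (glue ?W (2 * ?p + 1) (2 * ?q + 1)) (2 * a) (2 * b
          + 1)))"
      unfolding bracket_class_eq by (intro arg_cong[where f = "signed _"] sum.cong refl *)
    also have "\<dots> = (\<Sum>a\<in>halves (graph_of X). \<Sum>b\<in>halves (graph_of ?V).
        glue_class (glue ?W (2 * ?p + 1) (2 * ?q + 1)) (2 * a) (2 * b + 1))"
      by (simp add: signed_sum)
    also have "\<dots> = (\<Sum>a\<in>part1 X. \<Sum>b\<in>(\<lambda>b. 2 * b + 1) ` halves (graph_of ?V).
        glue_class (glue ?W (2 * ?p + 1) (2 * ?q + 1)) a b)"
      by (subst sum.reindex, simp add: inj_on_def)+ (simp add: comp_def)
    also have "(\<lambda>b. 2 * b + 1) ` halves (graph_of ?V)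
      = (part2 Y \<union> part3 Z) - {2 * ?p + 1, 2 * ?q + 1}"
    proof -
      have "inj (\<lambda>b::nat. 2 * b + 1)" by (simp add: inj_on_def)
      then have "(\<lambda>b. 2 * b + 1) ` halves (graph_of ?V)
        = (\<lambda>b. 2 * b + 1) ` halves ?U - (\<lambda>b. 2 * b + 1) ` {?p, ?q}"
        unfolding hV by (rule image_set_diff)
      then show ?thesis unfolding graph_of_oprod union_simps(2)
        by (simp only: image_Un image_image image_insert image_empty)
    qed
    finally show ?thesis .
  qed
  note * = this
  have "lie_bracket (graph_class X) (bracket_class Y Z) = signed (odd (nverts Y))
     (\<Sum>h\<in>halves (graph_of Y). \<Sum>k\<in>halves (graph_of Z). lie_bracket (graph_class X) (glue_class
       (oprod Y Z) (2 * h) (2 * k + 1)) :: 'k graph_space)"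
    by (simp only: bracket_class_eq[of Y Z] lie_bracket_signed lie_bracket_sum_right)
  also have "(\<Sum>h\<in>halves (graph_of Y). \<Sum>k\<in>halves (graph_of Z). lie_bracket (graph_class X)
    (glue_class (oprod Y Z) (2 * h) (2 * k + 1))) =
    (double_sum ?W (part1 X) (part2 Y) (part3 Z) :: 'k graph_space)"
  proof -
    have "inj (\<lambda>h::nat. 2 * (2 * h) + 1)" "inj (\<lambda>h::nat. 2 * (2 * h + 1) + 1)"
      by (simp_all add: inj_on_def)
    then have "inj_on (\<lambda>h. 2 * (2 * h) + 1) (halves (graph_of Y))"
      "inj_on (\<lambda>h. 2 * (2 * h + 1) + 1) (halves (graph_of Z))"
      using inj_on_subset by blast+
    then show ?thesis
      unfolding double_sum_def by (simp only: sum.reindex comp_def) (intro sum.cong refl *)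
  qed
  finally show ?thesis .
qed

text \<open>This is the Jacobi identity in shifted degrees multiplied by (-1)^y. In this
  normalization each outer sign cancels the inner twist and the sign of rotating the product into
  \<open>?W\<close>, leaving the unsigned sum of \<open>double_sum_cyclic\<close>.\<close>

lemma jacobi_generators:
  "signed (odd (nverts Y)) (lie_bracket (graph_class X) (bracket_class Y Z)) +
   signed (odd (nverts X + nverts Z * (nverts X + nverts Y))) (lie_bracket (graph_class Z)
     (bracket_class X Y)) +
   signed (odd (nverts Z + nverts X * (nverts Y + nverts Z))) (lie_bracket (graph_class Y)
     (bracket_class Z X)) = (0 :: 'k::field_char_0 graph_space)"
proof -
  let ?W = "oprod X (oprod Y Z)"
  note s = separated_parts[of X Y Z] and s' = separated_parts[of X Y Z, THEN separated_sym]
  have im: "cycle_parts ` part1 X = part2 X" "cycle_parts ` part2 Y = part3 Y"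
    "cycle_parts ` part3 Z = part1 Z" for X Y Z
    by (simp_all only: image_image cycle_parts_simps)
  have 2: "double_sum (oprod Z (oprod X Y)) (part1 Z) (part2 X) (part3 Y) =
      signed (odd (nverts Z * (nverts X + nverts Y))) (double_sum ?W (part3 Z) (part1 X)
        (part2 Y) :: 'k graph_space)"
    using double_sum_signed_iso[OF signed_iso_oprod_cycle[of Z X Y], of "part3 Z" "part1 X"
      "part2 Y"] s s' unfolding im by blast
  note r = separated_parts[of Z X Y] and r' = separated_parts[of Z X Y, THEN separated_sym]
  \<comment> \<open>Two rotations are needed for this term; y(z + x) + z(x + y) is congruent to x(y
    + z) modulo 2.\<close>
  have "double_sum (oprod Y (oprod Z X)) (part1 Y) (part2 Z) (part3 X) =
      signed (odd (nverts Y * (nverts Z + nverts X))) (double_sum (oprod Z (oprod X Y)) (part3 Y)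
        (part1 Z) (part2 X) :: 'k graph_space)"
    using double_sum_signed_iso[OF signed_iso_oprod_cycle[of Y Z X], of "part3 Y" "part1 Z"
      "part2 X"] r r' unfolding im by blast
  moreover have "double_sum (oprod Z (oprod X Y)) (part3 Y) (part1 Z) (part2 X) =
      signed (odd (nverts Z * (nverts X + nverts Y))) (double_sum ?W (part2 Y) (part3 Z)
        (part1 X) :: 'k graph_space)"
    using double_sum_signed_iso[OF signed_iso_oprod_cycle[of Z X Y], of "part2 Y" "part3 Z"
      "part1 X"] s s' unfolding im by blast
  ultimately have 3: "double_sum (oprod Y (oprod Z X)) (part1 Y) (part2 Z) (part3 X) =
      signed (odd (nverts X * (nverts Y + nverts Z))) (double_sum ?W (part2 Y) (part3 Z)
        (part1 X) :: 'k graph_space)"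
    by (auto simp: signed_def)
  have signs: "signed y (signed y a) + signed (odd (nverts X + nverts Z * (nverts X + nverts Y)))
    (signed (odd (nverts X))
        (signed (odd (nverts Z * (nverts X + nverts Y))) b)) +
      signed (odd (nverts Z + nverts X * (nverts Y + nverts Z))) (signed (odd (nverts Z))
        (signed (odd (nverts X * (nverts Y + nverts Z))) c)) = a + b + c"
    for y and a b c :: "'k graph_space"
    by (auto simp: signed_def)
  show ?thesis
    unfolding jacobi_term 2 3 signs by (rule double_sum_cyclic[OF s])
qed

section \<open>Graded identities, extended from generators to homogeneous elements\<close>

lemma power_int_sign: "gscale ((-1) powi n) x = signed (odd n) x"
  by (simp add: signed_def power_int_minus_left)

text \<open>Applied to one argument after the other, this extends a multilinear identity from
  generators to their spans.\<close>

lemma span_linear_zero: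
  assumes "x \<in> gscale.span S"
    and "\<And>x y. F (x + y) = F x + F y" "\<And>c x. F (gscale c x) = gscale c (F x)"
      "\<And>x. x \<in> S \<Longrightarrow> F x = (0 :: 'k::field_char_0 graph_space)"
  shows "F x = 0"
proof -
  have z: "F 0 = 0" using assms(2)[of 0 0] by simp
  show ?thesis
    using assms(1) by (induction rule: gscale.span_induct_alt) (simp_all add: z assms(2-4))
qed

definition generators :: "int \<Rightarrow> 'k::field_char_0 graph_space set" where
  "generators d = {graph_class X | X. int (nverts X) = d + 1}"

lemma shift_down_graph_grading: "shift_down graph_grading d = gscale.span (generators d)"
  by (simp add: shift_down_def graph_grading_def generators_def graph_class_def)

text \<open>A gluing of the product loses one vertex, and (i + 1) + (j + 1) - 1 = (i + j) + 1: the
  shift by one makes the bracket additive in the degrees.\<close>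

lemma lie_bracket_degree:
  assumes "u \<in> gscale.span (generators i)" "v \<in> gscale.span (generators j)"
  shows "lie_bracket u v \<in> gscale.span (generators (i + j))"
proof -
  have "bracket_class X Y \<in> gscale.span (generators (i + j) :: 'a graph_space set)"
    if "int (nverts X) = i + 1" "int (nverts Y) = j + 1" for X Y
  proof -
    have "glue_class (oprod X Y) (2 * h) (2 * k + 1) \<in> gscale.span (generators (i
      + j) :: 'a graph_space set)"
      if hk: "h \<in> halves (graph_of X)" "k \<in> halves (graph_of Y)" for h k
    proof -
      have gl: "gluable (graph_of (oprod X Y)) (2 * h) (2 * k + 1)" by (rule gluable_oprod[OF hk])
      have "int (nverts (glue (oprod X Y) (2 * h) (2 * k + 1))) = i + j + 1"
        using nverts_glue[OF gl] \<open>int (nverts X) = i + 1\<close> \<open>int (nverts Y) = j + 1\<close> by (simp add: nverts_oprod)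
      then show ?thesis unfolding glue_class_gluable[OF gl] generators_def
        by (intro gscale.span_base) blast
    qed
    then show ?thesis
      unfolding bracket_class_eq gscale_sign[symmetric] by (intro gscale.span_scale gscale.span_sum)
  qed
  then have 1: "lie_bracket x y \<in> gscale.span (generators (i + j))" if "x \<in> generators i"
    "y \<in> generators j" for x y :: "'a graph_space"
    using that by (auto simp: generators_def lie_bracket_graph_class)
  have 2: "lie_bracket x v \<in> gscale.span (generators (i + j))" if "x \<in> generators i" for x
    using assms(2) by (induction rule: gscale.span_induct_alt)
      (simp_all add: lie_bracket_zero lie_bracket_simps gscale.span_zero gscale.span_add
        gscale.span_scale 1 that)
  show ?thesis
    using assms(1) by (induction rule: gscale.span_induct_alt)
      (simp_all add: lie_bracket_zero lie_bracket_simps gscale.span_zero gscale.span_add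
        gscale.span_scale 2)
qed

lemmas multilinear_simps = lie_bracket_simps gscale.scale_right_distrib mult_ac add_ac

text \<open>The form of a vanishing sum makes the left side linear in each argument, as
  \<open>span_linear_zero\<close> requires.\<close>

lemma lie_bracket_antisym:
  assumes "v \<in> gscale.span (generators i)" "w \<in> gscale.span (generators j)"
  shows "lie_bracket v w + gscale ((-1) powi (i * j)) (lie_bracket w v) = 0"
proof -
  let ?F = "\<lambda>v w. lie_bracket v w + gscale ((-1) powi (i * j)) (lie_bracket w v)"
  have 1: "?F x y = 0" if xy: "x \<in> generators i" "y \<in> generators j" for x y
  proof -
    obtain X Y where X: "x = graph_class X" "int (nverts X) = i + 1" and Y: "y = graph_class Y"
      "int (nverts Y) = j + 1"
      using xy by (auto simp: generators_def)
    have ij: "i = int (nverts X) - 1" "j = int (nverts Y) - 1" using X Y by simp_all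
    show ?thesis
      unfolding X(1) Y(1) lie_bracket_graph_class power_int_sign bracket_class_antisym[of X Y]
      by (auto simp: ij signed_def)
  qed
  have 2: "?F x w = 0" if "x \<in> generators i" for x
    by (rule span_linear_zero[where F = "?F x", OF assms(2)],
      simp add: multilinear_simps, simp add: multilinear_simps, rule 1[OF that])
  show ?thesis
    by (rule span_linear_zero[where F = "\<lambda>v. ?F v w", OF assms(1)],
      simp add: multilinear_simps, simp add: multilinear_simps, rule 2)
qed

lemma lie_bracket_jacobi:
  assumes "u \<in> gscale.span (generators i)" "v \<in> gscale.span (generators j)"
    "w \<in> gscale.span (generators l)"
  shows "lie_bracket u (lie_bracket v w) + gscale ((-1) powi (l * (i + j))) (lie_bracket w
    (lie_bracket u v))
    + gscale ((-1) powi (i * (j + l))) (lie_bracket v (lie_bracket w u)) = 0"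
proof -
  let ?F = "\<lambda>u v w. lie_bracket u (lie_bracket v w) + gscale ((-1) powi (l * (i + j)))
    (lie_bracket w (lie_bracket u v))
    + gscale ((-1) powi (i * (j + l))) (lie_bracket v (lie_bracket w u))"
  have 1: "?F x y z = 0" if xyz: "x \<in> generators i" "y \<in> generators j" "z \<in> generators l" for x y z
  proof -
    obtain X Y Z where X: "x = graph_class X" "int (nverts X) = i + 1" and Y: "y = graph_class Y"
      "int (nverts Y) = j + 1"
      and Z: "z = graph_class Z" "int (nverts Z) = l + 1"
      using xyz by (auto simp: generators_def)
    have ijl: "i = int (nverts X) - 1" "j = int (nverts Y) - 1" "l = int (nverts Z) - 1" using X Y Z
      by simp_all
    \<comment> \<open>The factor (-1)^y relates the two normalizations: modulo 2, (z - 1)(x + y - 2)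
      + y is x + z(x + y), and (x - 1)(y + z - 2) + y is z + x(y + z), where x, y, z now stand for
      the vertex numbers.\<close>
    have "?F x y z = signed (odd (nverts Y)) (signed (odd (nverts Y)) (lie_bracket (graph_class X)
      (bracket_class Y Z)) +
       signed (odd (nverts X + nverts Z * (nverts X + nverts Y))) (lie_bracket (graph_class Z)
         (bracket_class X Y)) +
       signed (odd (nverts Z + nverts X * (nverts Y + nverts Z))) (lie_bracket (graph_class Y)
         (bracket_class Z X)))"
      unfolding X(1) Y(1) Z(1) lie_bracket_graph_class power_int_sign
      by (cases "even (nverts X)"; cases "even (nverts Y)"; cases "even (nverts Z)")
        (simp_all add: ijl signed_def)
    then show ?thesis unfolding jacobi_generators by simp
  qed
  have 2: "?F x y w = 0" if "x \<in> generators i" "y \<in> generators j" for x y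
    by (rule span_linear_zero[where F = "?F x y", OF assms(3)],
      simp add: multilinear_simps, simp add: multilinear_simps, rule 1[OF that])
  have 3: "?F x v w = 0" if "x \<in> generators i" for x
    by (rule span_linear_zero[where F = "\<lambda>v. ?F x v w", OF assms(2)],
      simp add: multilinear_simps, simp add: multilinear_simps, rule 2[OF that])
  show ?thesis
    by (rule span_linear_zero[where F = "\<lambda>u. ?F u v w", OF assms(1)],
      simp add: multilinear_simps, simp add: multilinear_simps, rule 3)
qed

section \<open>Direct sum decomposition of the graph space by shifted degree\<close>

definition component :: "int \<Rightarrow> (ograph \<Rightarrow>\<^sub>0 'k::field_char_0) \<Rightarrow> 'k graph_space" where
  "component d u = (\<Sum>X\<in>keys u. gscale (lookup u X) (if int (nverts X)
    = d + 1 then graph_class X else 0))"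

lemma component_superset:
  assumes "finite S" "keys u \<subseteq> S"
  shows "component d u = (\<Sum>X\<in>S. gscale (lookup u X) (if int (nverts X)
    = d + 1 then graph_class X else 0))"
  unfolding component_def using assms by (intro sum.mono_neutral_left) (auto simp: in_keys_iff)

lemma component_add: "component d (u + v) = component d u + component d v"
proof -
  let ?S = "keys u \<union> keys v \<union> keys (u + v)"
  have "component d w = (\<Sum>X\<in>?S. gscale (lookup w X) (if int (nverts X)
    = d + 1 then graph_class X else 0))"
    if "w \<in> {u, v, u + v}" for w
    using that by (intro component_superset) auto
  note this[of u] this[of v] this[of "u + v"]
  then show ?thesis by (simp add: lookup_add gscale.scale_left_distrib sum.distrib)
qed

lemma component_scale: "component d (fscale c u) = gscale c (component d u)"
proof -
  have "component d (fscale c u) = (\<Sum>X\<in>keys u. gscale (lookup (fscale c u) X) (if int (nverts X)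
    = d + 1 then graph_class X else 0))"
    by (intro component_superset) (auto simp: in_keys_iff)
  then show ?thesis by (simp add: component_def gscale.scale_sum_right)
qed

lemma component_basis: "component d (basis X) = (if int (nverts X)
  = d + 1 then graph_class X else 0)"
  by (simp add: component_def)

lemma component_diff: "component d (u - v) = component d u - component d v"
  using component_add[of d "u - v" v] by (simp add: algebra_simps)

lemma component_relations:
  assumes "r \<in> relations"
  shows "component d r = (0 :: 'k::field_char_0 graph_space)"
  using assms
proof (cases rule: relations_cases)
  case (1 f g X Y)
  then show ?thesis using signed_iso_nverts[OF 1(1)] signed_iso_graph_class[OF 1(1), where ?'k = 'k]
    by (simp add: component_diff component_basis)
next
  case (2 f g X Y)
  then show ?thesis using signed_iso_nverts[OF 2(1)] signed_iso_graph_class[OF 2(1), where ?'k = 'k]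
    by (simp add: component_add component_basis)
qed

text \<open>The relations connect only graphs with equally many vertices, so the projection to one
  degree descends to the quotient.\<close>

lemma component_cong:
  assumes "abs_graph_space u = abs_graph_space v"
  shows "component d u = component d v"
proof -
  have z: "component d 0 = 0" using component_diff[of d 0 0] by simp
  have "component d r = 0" if "r \<in> fscale.span relations" for r
    using that by (induction rule: fscale.span_induct_alt)
      (simp_all add: z component_add component_scale component_relations)
  then have "component d (u - v) = 0" using assms by (simp add: abs_eq_iff)
  then show ?thesis by (simp add: component_diff)
qed

definition degree_part :: "int \<Rightarrow> 'k::field_char_0 graph_space \<Rightarrow> 'k graph_space" where
  "degree_part d a = component d (rep_graph_space a)"

lemma degree_part_abs: "degree_part d (abs_graph_space u) = component d u"
  unfolding degree_part_def by (rule component_cong) (rule abs_rep)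

lemma degree_part_simps: "degree_part d (a + b) = degree_part d a + degree_part d b"
  "degree_part d (gscale c a) = gscale c (degree_part d a)"
proof -
  obtain u v where "a = abs_graph_space u" "b = abs_graph_space v" using abs_rep by metis
  then show "degree_part d (a + b) = degree_part d a + degree_part d b"
    "degree_part d (gscale c a) = gscale c (degree_part d a)"
    by (simp_all add: degree_part_abs component_add component_scale flip: abs_add abs_scale)
qed

lemma degree_part_zero: "degree_part d 0 = 0"
  using degree_part_simps(1)[of d 0 0] by simp

lemma degree_part_sum: "degree_part d (sum f A) = (\<Sum>x\<in>A. degree_part d (f x))"
  by (induction A rule: infinite_finite_induct) (simp_all add: degree_part_zero degree_part_simps)

lemma degree_part_generators:
  assumes "x \<in> gscale.span (generators d')"
  shows "degree_part d x = (if d = d' then x else 0)"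
  using assms
  by (induction rule: gscale.span_induct_alt)
    (auto simp: degree_part_zero degree_part_simps generators_def graph_class_def degree_part_abs
      component_basis)

lemma abs_expand: "abs_graph_space u = (\<Sum>X\<in>keys u. gscale (lookup u X) (graph_class X))"
proof -
  have "u = (\<Sum>X\<in>keys u. fscale (lookup u X) (basis X))"
    by (rule poly_mapping_eqI) (auto simp: lookup_sum lookup_single when_def in_keys_iff
      if_distrib[of "(*) _"] cong: if_cong)
  then have "abs_graph_space u = abs_graph_space (\<Sum>X\<in>keys u. fscale (lookup u X) (basis X))"
    by simp
  then show ?thesis by (simp only: abs_sum abs_scale graph_class_def)
qed

text \<open>The projections \<open>degree_part d a\<close> provide a decomposition. Applying
  \<open>degree_part d\<close> to an arbitrary decomposition \<open>c\<close> singles out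
  \<open>c d\<close>, which gives uniqueness.\<close>

lemma graded_vector_space_graph_space:
  "graded_vector_space gscale (shift_down graph_grading :: int \<Rightarrow> 'k::field_char_0 graph_space set)"
  unfolding graded_vector_space_def shift_down_graph_grading
proof (intro conjI allI)
  show "vector_space (gscale :: 'k \<Rightarrow> _)" by (rule gscale.vector_space_axioms)
  show "gscale.subspace (gscale.span (generators d :: 'k graph_space set))" for d
    by (rule gscale.subspace_span)
  fix a :: "'k graph_space"
  obtain u where u: "a = abs_graph_space u" using abs_rep by metis
  \<comment> \<open>The shifted degrees of the graphs occurring in the representative
    \<open>u\<close>; all other projections vanish, which makes the sums finite.\<close>
  let ?D = "(\<lambda>X. int (nverts X) - 1) ` keys u"
  have z: "degree_part d a = 0" if "d \<notin> ?D" for d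
  proof -
    have "int (nverts X) \<noteq> d + 1" if "X \<in> keys u" for X
    proof
      assume "int (nverts X) = d + 1"
      then have "d = int (nverts X) - 1" by simp
      then show False using \<open>d \<notin> ?D\<close> that by blast
    qed
    then show ?thesis unfolding u degree_part_abs component_def by (intro sum.neutral ballI) simp
  qed
  show "\<exists>!c. (\<forall>d. c d \<in> gscale.span (generators d)) \<and> finite {d. c d \<noteq> 0} \<and> a = (\<Sum>d | c d \<noteq> 0. c d)"
  proof (rule ex1I[of _ "\<lambda>d. degree_part d a"], intro conjI allI)
    show "degree_part d a \<in> gscale.span (generators d)" for d
      unfolding u degree_part_abs component_def
      by (intro gscale.span_sum gscale.span_scale)
        (auto simp: generators_def gscale.span_zero intro: gscale.span_base)
    show fin: "finite {d. degree_part d a \<noteq> 0}"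
      by (rule finite_subset[of _ ?D]) (use z in auto)
    have "(\<Sum>d | degree_part d a \<noteq> 0. degree_part d a) = (\<Sum>d\<in>?D. degree_part d a)"
      by (intro sum.mono_neutral_left) (use z in auto)
    also have "\<dots> = (\<Sum>X\<in>keys u. \<Sum>d\<in>?D. gscale (lookup u X) (if int (nverts X)
      = d + 1 then graph_class X else 0))"
      unfolding u degree_part_abs component_def by (rule sum.swap)
    also have "\<dots> = (\<Sum>X\<in>keys u. gscale (lookup u X) (graph_class X))"
    proof (intro sum.cong refl)
      fix X assume X: "X \<in> keys u"
      have "(\<Sum>d\<in>?D. gscale (lookup u X) (if int (nverts X) = d + 1 then graph_class X else 0)) =
        (\<Sum>d\<in>?D. if int (nverts X) - 1
          = d then gscale (lookup u X) (graph_class X) else 0 :: 'k graph_space)"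
        by (intro sum.cong refl) auto
      then show "(\<Sum>d\<in>?D. gscale (lookup u X) (if int (nverts X)
        = d + 1 then graph_class X else 0)) =
        (gscale (lookup u X) (graph_class X) :: 'k graph_space)"
        using X by simp
    qed
    finally show "a = (\<Sum>d | degree_part d a \<noteq> 0. degree_part d a)" unfolding u
      by (simp add: abs_expand[of u])
  next
    fix c assume c: "(\<forall>d. c d \<in> gscale.span (generators d)) \<and> finite {d. c d \<noteq> 0} \<and> a
      = (\<Sum>d | c d \<noteq> 0. c d)"
    show "c = (\<lambda>d. degree_part d a)"
    proof
      fix d
      have "degree_part d a = (\<Sum>d' | c d' \<noteq> 0. degree_part d (c d'))" using c degree_part_sum
        by metis
      also have "\<dots> = (\<Sum>d' | c d' \<noteq> 0. if d = d' then c d' else 0)"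
        using c by (intro sum.cong refl degree_part_generators) blast
      also have "\<dots> = c d" using c by simp
      finally show "c d = degree_part d a" by simp
    qed
  qed
qed

text \<open>Because \<open>lie_bracket\<close> is defined through chosen representatives, the first
  conjunct is what certifies that it is the operation induced by \<open>bracket_phi\<close>; it
  rests on \<open>bracket_extension_cong\<close>.\<close>

theorem proposition4p5:
  shows "(\<forall>u v. lie_bracket (abs_graph_space u) (abs_graph_space v) =
            abs_graph_space (bilinear_extension bracket_phi u v :: ograph \<Rightarrow>\<^sub>0 'k::field_char_0)) \<and>
         graded_lie_algebra gscale (shift_down graph_grading)
           (lie_bracket :: 'k graph_space \<Rightarrow> 'k graph_space \<Rightarrow> 'k graph_space)"
proof
  show "\<forall>u v. lie_bracket (abs_graph_space u) (abs_graph_space v) =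
            abs_graph_space (bilinear_extension bracket_phi u v :: ograph \<Rightarrow>\<^sub>0 'k)"
    by (simp add: lie_bracket_abs bracket_extension_def)
  have lin: "Vector_Spaces.linear gscale gscale (lie_bracket u)"
    "Vector_Spaces.linear gscale gscale (\<lambda>u. lie_bracket u v)"
    for u v :: "'k graph_space"
    by (simp_all add: Vector_Spaces.linear_iff lie_bracket_simps gscale.vector_space_axioms)
  show "graded_lie_algebra gscale (shift_down graph_grading)
           (lie_bracket :: 'k graph_space \<Rightarrow> 'k graph_space \<Rightarrow> 'k graph_space)"
    \<comment> \<open>\<open>eq_neg_iff_add_eq_0\<close> rewrites antisymmetry as the vanishing sum
      that \<open>lie_bracket_antisym\<close> provides.\<close>
    unfolding graded_lie_algebra_def shift_down_graph_grading eq_neg_iff_add_eq_0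
    by (intro conjI allI ballI) (rule
      graded_vector_space_graph_space[unfolded shift_down_graph_grading] lin lie_bracket_degree
      lie_bracket_antisym lie_bracket_jacobi | assumption)+
qed

end
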